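(* Let $V,p$ satisfy the dissipativity/periodicity assumption (A) and the compactness assumption (B) of the context, let $\eta>0$ and let $f\in L^2_{\rho^0}(\mathbb{R}^d)$ (equivalently $f \in L^2_{\rho^\varepsilon}(\mathbb{R}^d)$). For every $\varepsilon>0$ let $u^\varepsilon\in H^1_{\rho^\varepsilon}(\mathbb{R}^d)$ be the unique solution of $$\sigma\int_{\mathbb{R}^d}\nabla u^\varepsilon\cdot\nabla\psi\,\rho^\varepsilon\,dx+\eta\int_{\mathbb{R}^d}u^\varepsilon\psi\,\rho^\varepsilon\,dx=\int_{\mathbb{R}^d}f\psi\,\rho^\varepsilon\,dx\qquad\text{for all }\psi\in H^1_{\rho^\varepsilon}(\mathbb{R}^d),$$ and let $u^0\in H^1_{\rho^0}(\mathbb{R}^d)$ be the unique solution of $$\int_{\mathbb{R}^d}\Sigma\nabla u^0\cdot\nabla\psi\,\rho^0\,dx+\eta\int_{\mathbb{R}^d}u^0\psi\,\rho^0\,dx=\int_{\mathbb{R}^d}f\psi\,\rho^0\,dx\qquad\text{for all }\psi\in H^1_{\rho^0}(\mathbb{R}^d).$$ Then, as $\varepsilon\to0$: (i) $u^\varepsilon\to u^0$ strongly in $L^2_{\rho^0}(\mathbb{R}^d)$; (ii) $u^\varepsilon\rightharpoonup u^0$ weakly in $H^1_{\rho^0}(\mathbb{R}^d)$.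
   Context: Let $d\ge1$, $\sigma>0$, $L>0$, $Y=[0,L]^d$, and $V,p\colon\mathbb{R}^d\to\mathbb{R}$. Assumption (A): $p\in C^\infty(\mathbb{R}^d)$ is $L$-periodic in all directions; $V\in C^\infty(\mathbb{R}^d)$ is polynomially bounded from above and is bounded from below; and there exist $a,b>0$ such that $-\nabla V(x)\cdot x\le a-b|x|^2$ for all $x\in\mathbb{R}^d$. Assumption (B): there exists $\beta>2$ such that $\lim_{|x|\to\infty}\left(\frac1\beta|\nabla V(x)|^2-\Delta V(x)\right)=+\infty$ and $\lim_{|x|\to\infty}|\nabla V(x)|=+\infty$. For $\varepsilon>0$ define the probability densities $$\rho^\varepsilon(x)=\frac{1}{C_{\rho^\varepsilon}}e^{-\frac1\sigma(V(x)+p(x/\varepsilon))},\qquad \rho^0(x)=\frac1{C_{\rho^0}}e^{-\frac1\sigma V(x)},$$ with $C_{\rho^\varepsilon},C_{\rho^0}$ the normalizing constants over $\mathbb{R}^d$. For a probability density $\rho$ on $\mathbb{R}^d$, $L^2_\rho(\mathbb{R}^d)$ is the space of measurable $u$ with $\|u\|_{L^2_\rho}^2=\int u^2\rho\,dx<\infty$, and $H^1_\rho(\mathbb{R}^d)$ is the space of measurable weakly differentiable $u$ with $\|u\|_{H^1_\rho}^2=\int u^2\rho\,dx+\int|\nabla u|^2\rho\,dx<\infty$. The spaces $L^2_{\rho^\varepsilon}$ and $L^2_{\rho^0}$ (resp. $H^1_{\rho^\varepsilon}$ and $H^1_{\rho^0}$) coincide as sets, with equivalent norms. Homogenized coefficients: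 $\mu(y)=\frac1{C_\mu}e^{-\frac1\sigma p(y)}$ with $C_\mu=\int_Ye^{-\frac1\sigma p(y)}dy$. Let $\Phi\colon Y\to\mathbb{R}^d$ be the unique solution, with periodic boundary conditions, of the cell problem $-\sigma\Delta\Phi(y)+\nabla\Phi(y)\nabla p(y)=-\nabla p(y)$, $y\in Y$, with $\int_Y\Phi(y)\mu(y)\,dy=0$ (here $\nabla\Phi$ is the Jacobian matrix and $\Delta\Phi$ the componentwise Laplacian). Then $K=\int_Y(I+\nabla\Phi(y))\mu(y)\,dy=\int_Y(I+\nabla\Phi(y))(I+\nabla\Phi(y))^\top\mu(y)\,dy$ is symmetric positive definite, and $\Sigma=\sigma K$. The two problems are the weak formulations of $-\mathcal L^\varepsilon u^\varepsilon+\eta u^\varepsilon=f$ and $-\mathcal L^0u^0+\eta u^0=f$, where $\mathcal L^\varepsilon u=-\left(\nabla V(x)+\frac1\varepsilon\nabla p(\frac x\varepsilon)\right)\cdot\nabla u+\sigma\Delta u$ and $\mathcal L^0u=-K\nabla V\cdot\nabla u+\Sigma:\nabla^2u$. *)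

theory Defs
  imports "HOL-Analysis.Analysis"
begin

section \<open>Classical calculus\<close>

definition partial :: "'n \<Rightarrow> (real^'n::finite \<Rightarrow> real) \<Rightarrow> real^'n \<Rightarrow> real" where
  "partial i f x = frechet_derivative f (at x) (axis i 1)"

definition grad :: "(real^'n::finite \<Rightarrow> real) \<Rightarrow> real^'n \<Rightarrow> real^'n" where
  "grad f x = (\<chi> i. partial i f x)"

definition laplacian :: "(real^'n::finite \<Rightarrow> real) \<Rightarrow> real^'n \<Rightarrow> real" where
  "laplacian f x = (\<Sum>i\<in>UNIV. partial i (partial i f) x)"

primrec Ck :: "nat \<Rightarrow> (real^'n::finite \<Rightarrow> real) \<Rightarrow> bool" where
  "Ck 0 f \<longleftrightarrow> continuous_on UNIV f"
| "Ck (Suc k) f \<longleftrightarrow> (\<forall>x. f differentiable (at x)) \<and> (\<forall>i. Ck k (partial i f))"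

definition smooth :: "(real^'n::finite \<Rightarrow> real) \<Rightarrow> bool" where
  "smooth f \<longleftrightarrow> (\<forall>k. Ck k f)"

definition periodic :: "real \<Rightarrow> (real^'n::finite \<Rightarrow> 'b) \<Rightarrow> bool" where
  "periodic L f \<longleftrightarrow> (\<forall>x i. f (x + axis i L) = f x)"

section \<open>Weak derivatives and weighted spaces\<close>

definition test_function :: "(real^'n::finite \<Rightarrow> real) \<Rightarrow> bool" where
  "test_function \<phi> \<longleftrightarrow> smooth \<phi> \<and> compact (closure {x. \<phi> x \<noteq> 0})"

definition locally_integrable :: "(real^'n::finite \<Rightarrow> 'b::euclidean_space) \<Rightarrow> bool" where
  "locally_integrable f \<longleftrightarrow> (\<forall>S. compact S \<longrightarrow> set_integrable lebesgue S f)"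

definition has_weak_grad :: "(real^'n::finite \<Rightarrow> real) \<Rightarrow> (real^'n \<Rightarrow> real^'n) \<Rightarrow> bool" where
  "has_weak_grad u g \<longleftrightarrow> locally_integrable u \<and> locally_integrable g \<and>
     (\<forall>\<phi>. test_function \<phi> \<longrightarrow>
        (LINT x|lebesgue. u x *\<^sub>R grad \<phi> x) = - (LINT x|lebesgue. \<phi> x *\<^sub>R g x))"

text \<open>A weak gradient is determined only up to null sets; \<open>wgrad u\<close> is an arbitrary
  representative, and is used only under integrals.\<close>

definition wgrad :: "(real^'n::finite \<Rightarrow> real) \<Rightarrow> real^'n \<Rightarrow> real^'n" where
  "wgrad u = (SOME g. has_weak_grad u g)"

text \<open>Elements of \<open>L2 \<rho>\<close> and \<open>H1 \<rho>\<close> are functions, not classes modulo null sets.\<close>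

definition L2 :: "(real^'n::finite \<Rightarrow> real) \<Rightarrow> (real^'n \<Rightarrow> real) set" where
  "L2 \<rho> = {u. u \<in> borel_measurable lebesgue \<and> integrable lebesgue (\<lambda>x. (u x)\<^sup>2 * \<rho> x)}"

definition L2_norm :: "(real^'n::finite \<Rightarrow> real) \<Rightarrow> (real^'n \<Rightarrow> real) \<Rightarrow> real" where
  "L2_norm \<rho> u = sqrt (LINT x|lebesgue. (u x)\<^sup>2 * \<rho> x)"

definition H1 :: "(real^'n::finite \<Rightarrow> real) \<Rightarrow> (real^'n \<Rightarrow> real) set" where
  "H1 \<rho> = {u \<in> L2 \<rho>. (\<exists>g. has_weak_grad u g) \<and>
                     integrable lebesgue (\<lambda>x. (norm (wgrad u x))\<^sup>2 * \<rho> x)}"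

definition H1_inner ::
  "(real^'n::finite \<Rightarrow> real) \<Rightarrow> (real^'n \<Rightarrow> real) \<Rightarrow> (real^'n \<Rightarrow> real) \<Rightarrow> real" where
  "H1_inner \<rho> u v = (LINT x|lebesgue. u x * v x * \<rho> x)
                   + (LINT x|lebesgue. (wgrad u x \<bullet> wgrad v x) * \<rho> x)"

text \<open>Integrals of non-integrable functions are \<open>0\<close> by convention, so both notions of
  convergence include membership in the space.\<close>

definition L2_strong_conv ::
  "(real^'n::finite \<Rightarrow> real) \<Rightarrow> ('i \<Rightarrow> real^'n \<Rightarrow> real) \<Rightarrow> (real^'n \<Rightarrow> real) \<Rightarrow> 'i filter \<Rightarrow> bool" where
  "L2_strong_conv \<rho> u v F \<longleftrightarrow> v \<in> L2 \<rho> \<and> (\<forall>\<^sub>F \<epsilon> in F. u \<epsilon> \<in> L2 \<rho>) \<and>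
     ((\<lambda>\<epsilon>. L2_norm \<rho> (\<lambda>x. u \<epsilon> x - v x)) \<longlongrightarrow> 0) F"

definition H1_weak_conv ::
  "(real^'n::finite \<Rightarrow> real) \<Rightarrow> ('i \<Rightarrow> real^'n \<Rightarrow> real) \<Rightarrow> (real^'n \<Rightarrow> real) \<Rightarrow> 'i filter \<Rightarrow> bool" where
  "H1_weak_conv \<rho> u v F \<longleftrightarrow> v \<in> H1 \<rho> \<and> (\<forall>\<^sub>F \<epsilon> in F. u \<epsilon> \<in> H1 \<rho>) \<and>
     (\<forall>\<psi> \<in> H1 \<rho>. ((\<lambda>\<epsilon>. H1_inner \<rho> (u \<epsilon>) \<psi>) \<longlongrightarrow> H1_inner \<rho> v \<psi>) F)"

section \<open>Assumptions on the potentials\<close>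

definition assumption_A ::
  "real \<Rightarrow> (real^'n::finite \<Rightarrow> real) \<Rightarrow> (real^'n \<Rightarrow> real) \<Rightarrow> bool" where
  "assumption_A L V p \<longleftrightarrow>
     smooth p \<and> periodic L p \<and>
     smooth V \<and> (\<exists>C m. \<forall>x. V x \<le> C * (1 + norm x ^ m)) \<and> (\<exists>c. \<forall>x. c \<le> V x) \<and>
     (\<exists>a>0. \<exists>b>0. \<forall>x. - (grad V x \<bullet> x) \<le> a - b * (norm x)\<^sup>2)"

definition assumption_B :: "(real^'n::finite \<Rightarrow> real) \<Rightarrow> bool" where
  "assumption_B V \<longleftrightarrow>
     (\<exists>\<beta>>2. filterlim (\<lambda>x. 1 / \<beta> * (norm (grad V x))\<^sup>2 - laplacian V x) at_top at_infinity) \<and>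
     filterlim (\<lambda>x. norm (grad V x)) at_top at_infinity"

section \<open>Densities and homogenized coefficients\<close>

definition gibbs :: "real \<Rightarrow> (real^'n::finite \<Rightarrow> real) \<Rightarrow> real^'n \<Rightarrow> real" where
  "gibbs \<sigma> U x = exp (- (1 / \<sigma>) * U x) / (LINT z|lebesgue. exp (- (1 / \<sigma>) * U z))"

definition rho_eps ::
  "real \<Rightarrow> (real^'n::finite \<Rightarrow> real) \<Rightarrow> (real^'n \<Rightarrow> real) \<Rightarrow> real \<Rightarrow> real^'n \<Rightarrow> real" where
  "rho_eps \<sigma> V p \<epsilon> = gibbs \<sigma> (\<lambda>x. V x + p ((1 / \<epsilon>) *\<^sub>R x))"

definition rho0 :: "real \<Rightarrow> (real^'n::finite \<Rightarrow> real) \<Rightarrow> real^'n \<Rightarrow> real" where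
  "rho0 \<sigma> V = gibbs \<sigma> V"

definition cell :: "real \<Rightarrow> (real^'n::finite) set" where
  "cell L = cbox 0 (vec L)"

definition mu :: "real \<Rightarrow> real \<Rightarrow> (real^'n::finite \<Rightarrow> real) \<Rightarrow> real^'n \<Rightarrow> real" where
  "mu \<sigma> L p y = exp (- (1 / \<sigma>) * p y) / (LINT z:cell L|lebesgue. exp (- (1 / \<sigma>) * p z))"

text \<open>The corrector is represented by its \<open>L\<close>-periodic extension to the whole space, of class
  \<open>C\<^sup>2\<close>; this encodes the periodic boundary conditions.\<close>

definition cell_solution ::
  "real \<Rightarrow> real \<Rightarrow> (real^'n::finite \<Rightarrow> real) \<Rightarrow> (real^'n \<Rightarrow> real^'n) \<Rightarrow> bool" where
  "cell_solution \<sigma> L p \<Phi> \<longleftrightarrow>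
     (\<forall>i. Ck 2 (\<lambda>y. \<Phi> y $ i)) \<and> periodic L \<Phi> \<and>
     (\<forall>y\<in>cell L. - (\<sigma> *\<^sub>R (\<chi> i. laplacian (\<lambda>z. \<Phi> z $ i) y)) + jacobian \<Phi> (at y) *v grad p y
                   = - grad p y) \<and>
     (LINT y:cell L|lebesgue. mu \<sigma> L p y *\<^sub>R \<Phi> y) = 0"

definition K_matrix ::
  "real \<Rightarrow> real \<Rightarrow> (real^'n::finite \<Rightarrow> real) \<Rightarrow> (real^'n \<Rightarrow> real^'n) \<Rightarrow> real^'n^'n" where
  "K_matrix \<sigma> L p \<Phi> = (LINT y:cell L|lebesgue. mu \<sigma> L p y *\<^sub>R (mat 1 + jacobian \<Phi> (at y)))"

definition Sigma_matrix ::
  "real \<Rightarrow> real \<Rightarrow> (real^'n::finite \<Rightarrow> real) \<Rightarrow> (real^'n \<Rightarrow> real^'n) \<Rightarrow> real^'n^'n" where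
  "Sigma_matrix \<sigma> L p \<Phi> = \<sigma> *\<^sub>R K_matrix \<sigma> L p \<Phi>"

section \<open>Weak formulations\<close>

definition multiscale_solution ::
  "real \<Rightarrow> real \<Rightarrow> (real^'n::finite \<Rightarrow> real) \<Rightarrow> (real^'n \<Rightarrow> real) \<Rightarrow> (real^'n \<Rightarrow> real) \<Rightarrow> bool" where
  "multiscale_solution \<sigma> \<eta> \<rho> f u \<longleftrightarrow> u \<in> H1 \<rho> \<and>
     (\<forall>\<psi>\<in>H1 \<rho>. \<sigma> * (LINT x|lebesgue. (wgrad u x \<bullet> wgrad \<psi> x) * \<rho> x)
                 + \<eta> * (LINT x|lebesgue. u x * \<psi> x * \<rho> x)
               = (LINT x|lebesgue. f x * \<psi> x * \<rho> x))"

definition homogenized_solution ::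
  "real^'n^'n \<Rightarrow> real \<Rightarrow> (real^'n::finite \<Rightarrow> real) \<Rightarrow> (real^'n \<Rightarrow> real) \<Rightarrow> (real^'n \<Rightarrow> real) \<Rightarrow> bool" where
  "homogenized_solution S \<eta> \<rho> f u \<longleftrightarrow> u \<in> H1 \<rho> \<and>
     (\<forall>\<psi>\<in>H1 \<rho>. (LINT x|lebesgue. ((S *v wgrad u x) \<bullet> wgrad \<psi> x) * \<rho> x)
                 + \<eta> * (LINT x|lebesgue. u x * \<psi> x * \<rho> x)
               = (LINT x|lebesgue. f x * \<psi> x * \<rho> x))"

end

theory Submission
  imports Defs
begin

text \<open>
Write \<open>w = exp (- V / \<sigma>)\<close> and \<open>m = exp (- p / \<sigma>)\<close>. Up to constant factors, which cancel in the weak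
formulations, the two densities are \<open>m (x / \<epsilon>) * w x\<close> and \<open>w x\<close>. The solution \<open>u \<epsilon>\<close> is compared with
the two-scale expansion \<open>W x = v x + \<epsilon> * (\<Sum>k. \<Phi>\<^sub>k (x / \<epsilon>) * \<partial>\<^sub>k v x)\<close>, where \<open>v\<close> is a test function close to \<open>u0\<close>
in the weighted Sobolev space; such \<open>v\<close> exist by \<open>test_dense_H1\<close>. Since \<open>v\<close> is smooth with bounded
support, the expansion can be differentiated classically.

Up to an error of order \<open>\<epsilon>\<close>, the flux \<open>m (x / \<epsilon>) * \<nabla>W\<close> is \<open>\<Sum>k. \<partial>\<^sub>k v * A\<^sub>k (x / \<epsilon>)\<close> with the periodic vector fields
\<open>A\<^sub>k = m * (e\<^sub>k + \<nabla>\<Phi>\<^sub>k)\<close>. The cell problem says that every \<open>A\<^sub>k\<close> is divergence free, so an integration by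
parts removes the gradient from the function \<open>\<psi>\<close> against which the equation is tested, without
producing a factor \<open>1 / \<epsilon>\<close> (\<open>flux_by_parts\<close>, \<open>expansion_form\<close>). What is left are integrals of
\<open>h * \<psi> * g (x / \<epsilon>) * w\<close> with \<open>h\<close> fixed and square integrable and \<open>g\<close> continuous and periodic. They tend to the
same integrals with \<open>g\<close> replaced by its mean, uniformly for \<open>\<psi>\<close> in the unit ball of the Sobolev space
(\<open>oscillation_to_mean\<close>): averaging over translations by a cell of size \<open>\<epsilon>\<close> makes a mean-zero \<open>g\<close>
disappear at the cost of the \<open>L\<^sup>1\<close> modulus of continuity of \<open>h * \<psi> * w\<close>. The mean of \<open>A\<^sub>k\<close> is the \<open>k\<close>-th
row of \<open>K\<close> times the mean of \<open>m\<close>, and \<open>K\<close> is symmetric (\<open>flux_mean_symmetric\<close>). Hence the residual of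
\<open>W\<close> in the \<open>\<epsilon>\<close>-problem is asymptotically the residual of \<open>v\<close> in the homogenized problem times the mean of
\<open>m\<close>, and the latter is small because \<open>v\<close> is close to \<open>u0\<close> (\<open>expansion_residual\<close>).

Coercivity turns the bound on the residual into a bound on \<open>u \<epsilon> - W\<close> (\<open>energy_estimate\<close>), and \<open>W\<close> tends
to \<open>v\<close> in \<open>L\<^sup>2\<close>, which gives the strong convergence. The gradients of \<open>u \<epsilon>\<close> are bounded by the energy
estimate; tested against the gradient of a test function they can be integrated by parts, so the
weak convergence follows from the strong one by density (\<open>weak_gradient_convergence\<close>).
\<close>

section \<open>Iterated partial derivatives and a smooth bump profile\<close>

lemma partial_eq:
  assumes "(f has_derivative D) (at x)"
  shows "partial i f x = D (axis i 1)"
  using frechet_derivative_at[OF assms] by (simp add: partial_def)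

lemma has_derivative_grad:
  fixes f :: "real^'n::finite \<Rightarrow> real"
  assumes "f differentiable (at x)"
  shows "(f has_derivative (\<lambda>h. grad f x \<bullet> h)) (at x)"
proof -
  let ?D = "frechet_derivative f (at x)"
  have D: "(f has_derivative ?D) (at x)"
    using assms frechet_derivative_works by blast
  have lin: "linear ?D" using D has_derivative_linear by blast
  have "?D h = grad f x \<bullet> h" for h
  proof -
    have "?D h = ?D (\<Sum>i\<in>UNIV. (h $ i) *\<^sub>R axis i 1)"
      using basis_expansion[of h] by (simp add: scalar_mult_eq_scaleR)
    also have "\<dots> = (\<Sum>i\<in>UNIV. h $ i * ?D (axis i 1))"
      using lin by (simp add: linear_sum linear_scale)
    also have "\<dots> = grad f x \<bullet> h"
      by (simp add: grad_def inner_vec_def partial_def mult.commute)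
    finally show ?thesis .
  qed
  then have "?D = (\<lambda>h. grad f x \<bullet> h)" by auto
  then show ?thesis using D by simp
qed

lemma partial_add:
  assumes "f differentiable (at x)" "g differentiable (at x)"
  shows "partial i (\<lambda>x. f x + g x) x = partial i f x + partial i g x"
  using partial_eq[OF has_derivative_add[OF has_derivative_grad[OF assms(1)] has_derivative_grad[OF assms(2)]]]
  by (simp add: grad_def inner_axis)

lemma partial_mult:
  fixes f g :: "real^'n::finite \<Rightarrow> real"
  assumes "f differentiable (at x)" "g differentiable (at x)"
  shows "partial i (\<lambda>x. f x * g x) x = f x * partial i g x + partial i f x * g x"
  using partial_eq[OF has_derivative_mult[OF has_derivative_grad[OF assms(1)] has_derivative_grad[OF assms(2)]]]
  by (simp add: grad_def inner_axis)

lemma partial_const [simp]: "partial i (\<lambda>x. c) x = 0"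
proof -
  have "((\<lambda>x. c) has_derivative (\<lambda>_. 0)) (at x)" by simp
  from partial_eq[OF this] show ?thesis .
qed

lemma partial_compose:
  fixes f :: "real^'n::finite \<Rightarrow> real" and h :: "real \<Rightarrow> real"
  assumes "f differentiable (at x)" "(h has_real_derivative h') (at (f x))"
  shows "partial i (\<lambda>x. h (f x)) x = h' * partial i f x"
    and "(\<lambda>x. h (f x)) differentiable (at x)"
proof -
  have "((\<lambda>x. h (f x)) has_derivative (\<lambda>k. h' * (grad f x \<bullet> k))) (at x)"
    using has_derivative_compose[OF has_derivative_grad[OF assms(1)], of h "(*) h'"] assms(2)
    by (simp add: has_field_derivative_def)
  then show "partial i (\<lambda>x. h (f x)) x = h' * partial i f x" "(\<lambda>x. h (f x)) differentiable (at x)"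
    using partial_eq by (fastforce simp: grad_def inner_axis differentiable_def)+
qed

lemma partial_affine:
  fixes f :: "real^'n::finite \<Rightarrow> real"
  assumes "f differentiable (at (a + c *\<^sub>R x))"
  shows "partial i (\<lambda>x. f (a + c *\<^sub>R x)) x = c * partial i f (a + c *\<^sub>R x)"
    and "(\<lambda>x. f (a + c *\<^sub>R x)) differentiable (at x)"
proof -
  have "((\<lambda>x. a + c *\<^sub>R x) has_derivative (\<lambda>h. c *\<^sub>R h)) (at x)"
    by (auto intro!: derivative_eq_intros)
  from has_derivative_compose[OF this has_derivative_grad[OF assms]]
  have "((\<lambda>x. f (a + c *\<^sub>R x)) has_derivative (\<lambda>h. grad f (a + c *\<^sub>R x) \<bullet> (c *\<^sub>R h))) (at x)" .
  then show "partial i (\<lambda>x. f (a + c *\<^sub>R x)) x = c * partial i f (a + c *\<^sub>R x)"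
    "(\<lambda>x. f (a + c *\<^sub>R x)) differentiable (at x)"
    using partial_eq by (fastforce simp: grad_def inner_axis differentiable_def)+
qed

lemma Ck_SucD:
  assumes "Ck (Suc k) f"
  shows "f differentiable (at x)" "Ck k (partial i f)"
  using assms by auto

lemma Ck_Suc_imp: "Ck (Suc k) f \<Longrightarrow> Ck k f"
proof (induction k arbitrary: f)
  case 0
  then show ?case
    by (simp add: continuous_on_eq_continuous_at differentiable_imp_continuous_within)
qed auto

lemma Ck_mono: "j \<le> k \<Longrightarrow> Ck k f \<Longrightarrow> Ck j f"
  by (induction k rule: dec_induct) (auto dest: Ck_Suc_imp simp del: Ck.simps)

lemma Ck_continuous: "Ck k f \<Longrightarrow> continuous_on UNIV f"
  using Ck_mono[of 0 k f] by simp

lemma Ck_const: "Ck k (\<lambda>x. c)"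
proof (induction k arbitrary: c)
  case (Suc k)
  have "partial i (\<lambda>x. c) = (\<lambda>x. 0)" for i :: 'a by auto
  then show ?case using Suc by simp
qed auto

lemma Ck_add: "Ck k f \<Longrightarrow> Ck k g \<Longrightarrow> Ck k (\<lambda>x. f x + g x)"
proof (induction k arbitrary: f g)
  case 0 then show ?case by (auto intro: continuous_intros)
next
  case (Suc k)
  have "partial i (\<lambda>x. f x + g x) = (\<lambda>x. partial i f x + partial i g x)" for i
    using Suc.prems by (intro ext partial_add) auto
  then show ?case using Suc by auto
qed

lemma Ck_mult: "Ck k f \<Longrightarrow> Ck k g \<Longrightarrow> Ck k (\<lambda>x. f x * g x)"
proof (induction k arbitrary: f g)
  case 0 then show ?case by (auto intro: continuous_intros)
next
  case (Suc k)
  have "partial i (\<lambda>x. f x * g x) = (\<lambda>x. f x * partial i g x + partial i f x * g x)" for i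
    using Suc.prems by (intro ext partial_mult) auto
  moreover have "Ck k (\<lambda>x. f x * partial i g x + partial i f x * g x)" for i
    using Suc.prems by (intro Ck_add Suc.IH) (auto intro: Ck_Suc_imp simp del: Ck.simps simp: Ck_SucD)
  ultimately show ?case using Suc.prems by auto
qed

lemma Ck_sum: "(\<And>i. i \<in> I \<Longrightarrow> Ck k (f i)) \<Longrightarrow> Ck k (\<lambda>x. \<Sum>i\<in>I. f i x)"
  by (induction I rule: infinite_finite_induct) (auto intro: Ck_const Ck_add)

lemma Ck_component: "Ck k (\<lambda>x. x $ i)"
proof (cases k)
  case (Suc j)
  have d: "((\<lambda>x. x $ i) has_derivative (\<lambda>h. h $ i)) (at x)" for x :: "real^'a"
    by (intro bounded_linear_imp_has_derivative bounded_linear_vec_nth)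
  have "partial j (\<lambda>x::real^'a. x $ i) = (\<lambda>x. axis j 1 $ i)" for j
    using partial_eq[OF d] by auto
  then show ?thesis using d Suc by (auto simp: Ck_const differentiable_def)
qed (auto intro: continuous_intros)

lemma Ck_affine: "Ck k f \<Longrightarrow> Ck k (\<lambda>x. f (a + c *\<^sub>R x))"
proof (induction k arbitrary: f)
  case 0 then show ?case
    by (auto intro!: continuous_intros continuous_on_compose2[of UNIV f])
next
  case (Suc k)
  have "partial i (\<lambda>x. f (a + c *\<^sub>R x)) = (\<lambda>x. c * partial i f (a + c *\<^sub>R x))" for i
    using Suc.prems by (intro ext partial_affine(1)) auto
  moreover have "(\<lambda>x. f (a + c *\<^sub>R x)) differentiable (at x)" for x
    using Suc.prems by (intro partial_affine(2)) auto
  moreover have "Ck k (\<lambda>x. c * partial i f (a + c *\<^sub>R x))" for i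
    using Ck_SucD(2)[OF Suc.prems] by (intro Ck_mult Ck_const Suc.IH)
  ultimately show ?case by simp
qed

lemma Ck_exp: "Ck k f \<Longrightarrow> Ck k (\<lambda>x. exp (f x))"
proof (induction k arbitrary: f)
  case 0 then show ?case by (auto intro: continuous_intros)
next
  case (Suc k)
  have d: "partial i (\<lambda>x. exp (f x)) = (\<lambda>x. exp (f x) * partial i f x)" for i
    using Suc.prems by (intro ext partial_compose(1) DERIV_exp) auto
  have "(\<lambda>x. exp (f x)) differentiable (at x)" for x
    using Suc.prems by (intro partial_compose(2)[where h=exp, OF _ DERIV_exp]) auto
  then show ?case unfolding Ck.simps(2) d
    using Ck_SucD(2)[OF Suc.prems] Ck_Suc_imp[OF Suc.prems] Suc.IH by (auto intro!: Ck_mult)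
qed

text \<open>The profile \<open>exp (- 1 / t)\<close>, extended by \<open>0\<close>, is the case \<open>P = 1\<close>. With the polynomial factors the
family is closed under differentiation, so that smoothness can be proved by induction for all \<open>P\<close> at
once.\<close>

definition flat :: "real poly \<Rightarrow> real \<Rightarrow> real" where
  "flat P t = (if t > 0 then poly P (1/t) * exp (- (1/t)) else 0)"

lemma poly_times_exp_minus_tendsto_0: "((\<lambda>s. poly P s * exp (- s)) \<longlongrightarrow> 0) (at_top :: real filter)"
proof -
  have "((\<lambda>s. \<Sum>i\<le>degree P. coeff P i * (s ^ i / exp s)) \<longlongrightarrow> (\<Sum>i\<le>degree P. coeff P i * 0)) at_top"
    by (intro tendsto_intros tendsto_power_div_exp_0)
  then show ?thesis
    by (simp add: poly_altdef sum_distrib_right exp_minus divide_inverse mult.assoc)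
qed

lemma flat_DERIV: "(flat P has_real_derivative flat ([:0,0,1:] * (P - pderiv P)) t) (at t)"
proof -
  consider "t < 0" | "t = 0" | "t > 0" by linarith
  then show ?thesis
  proof cases
    case 1
    have "((\<lambda>_. 0) has_real_derivative 0) (at t)" by simp
    moreover have "\<forall>\<^sub>F s in nhds t. flat P s = 0"
      using eventually_nhds_in_open[of "{..<0}" t] 1 by (auto elim!: eventually_mono simp: flat_def)
    ultimately show ?thesis
      using 1 by (subst DERIV_cong_ev[OF refl _ refl]) (auto simp: flat_def)
  next
    case 3
    have "((\<lambda>t. poly P (1/t) * exp (- (1/t))) has_real_derivative
        flat ([:0,0,1:] * (P - pderiv P)) t) (at t)"
      using 3 by (auto intro!: derivative_eq_intros simp: flat_def field_simps power2_eq_square)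
    moreover have "\<forall>\<^sub>F s in nhds t. flat P s = poly P (1/s) * exp (- (1/s))"
      using eventually_nhds_in_open[of "{0<..}" t] 3 by (auto elim!: eventually_mono simp: flat_def)
    ultimately show ?thesis
      by (subst DERIV_cong_ev[OF refl _ refl]) 
  next
    case 2
    have r: "((\<lambda>s. flat P s / s) \<longlongrightarrow> 0) (at_right 0)"
    proof -
      have "((\<lambda>s. poly (pCons 0 P) (inverse s) * exp (- inverse s)) \<longlongrightarrow> 0) (at_right 0)"
        by (rule filterlim_compose[OF poly_times_exp_minus_tendsto_0 filterlim_inverse_at_top_right])
      moreover have "\<forall>\<^sub>F s in at_right 0. poly (pCons 0 P) (inverse s) * exp (- inverse s) = flat P s / s"
        by (rule eventually_at_rightI[of 0 1]) (simp_all add: flat_def inverse_eq_divide)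
      ultimately show ?thesis by (rule Lim_transform_eventually)
    qed
    have l: "((\<lambda>s. flat P s / s) \<longlongrightarrow> 0) (at_left 0)"
      by (intro tendsto_eventually eventually_at_leftI[of "-1"]) (simp_all add: flat_def)
    have "((\<lambda>s. flat P s / s) \<longlongrightarrow> 0) (at 0)" using l r filterlim_at_split by blast
    then show ?thesis using 2 by (simp add: has_field_derivative_iff flat_def)
  qed
qed

lemma Ck_flat: "Ck k f \<Longrightarrow> Ck k (\<lambda>x. flat P (f x))"
proof (induction k arbitrary: P)
  case 0
  have "continuous_on UNIV (flat P)" by (meson DERIV_continuous_on flat_DERIV has_field_derivative_at_within)
  then show ?case using 0 by (auto intro!: continuous_on_compose2[of UNIV "flat P"])
next
  case (Suc k)
  have d: "partial i (\<lambda>x. flat P (f x)) = (\<lambda>x. flat ([:0,0,1:] * (P - pderiv P)) (f x) * partial i f x)" for i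
    using Suc.prems by (intro ext partial_compose(1) flat_DERIV) auto
  have d2: "(\<lambda>x. flat P (f x)) differentiable (at x)" for x
    using Suc.prems by (intro partial_compose(2)[where h="flat P", OF _ flat_DERIV]) auto
  show ?case unfolding Ck.simps(2) d(1)
    using d2 Ck_SucD(2)[OF Suc.prems] Ck_Suc_imp[OF Suc.prems] Suc.IH by (auto intro!: Ck_mult)
qed

section \<open>Test functions and weak gradients\<close>

text \<open>Vanishing outside some ball. On a Euclidean space this is compactness of the closed support, in a form that
passes directly to products, sums and derivatives.\<close>

definition csupp :: "('a::real_normed_vector \<Rightarrow> 'b::zero) \<Rightarrow> bool" where
  "csupp f \<longleftrightarrow> (\<exists>R. \<forall>x. norm x > R \<longrightarrow> f x = 0)"

lemma csuppI: "(\<And>x. norm x > R \<Longrightarrow> f x = 0) \<Longrightarrow> csupp f"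
  by (auto simp: csupp_def)

lemma csuppE:
  assumes "csupp f"
  obtains R where "R > 0" "\<And>x. norm x > R \<Longrightarrow> f x = 0"
  using assms that[of "max 1 _"] unfolding csupp_def by (metis less_max_iff_disj max.strict_boundedE max.strict_coboundedI1 zero_less_one)

lemma csupp_weaken: "csupp f \<Longrightarrow> (\<And>x. f x = 0 \<Longrightarrow> g x = 0) \<Longrightarrow> csupp g"
  by (auto simp: csupp_def)

lemma csupp_weaken2:
  assumes "csupp f" "csupp g" "\<And>x. f x = 0 \<Longrightarrow> g x = 0 \<Longrightarrow> h x = 0"
  shows "csupp h"
proof -
  obtain R S where "\<And>x. norm x > R \<Longrightarrow> f x = 0" "\<And>x. norm x > S \<Longrightarrow> g x = 0"
    using assms by (auto simp: csupp_def)
  then show ?thesis using assms(3) by (intro csuppI[of "max R S"]) auto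
qed

lemma csupp_sum: "(\<And>i. i \<in> I \<Longrightarrow> csupp (f i)) \<Longrightarrow> csupp (\<lambda>x. \<Sum>i\<in>I. f i x)"
proof (induction I rule: infinite_finite_induct)
  case (insert i I)
  show ?case by (rule csupp_weaken2[of "f i" "\<lambda>x. \<Sum>i\<in>I. f i x"]) (use insert in auto)
qed (auto simp: csupp_def)

lemma test_function_iff: "test_function \<phi> \<longleftrightarrow> smooth \<phi> \<and> csupp \<phi>"
proof -
  have "(\<forall>x. \<phi> x \<noteq> 0 \<longrightarrow> norm x \<le> R) = (\<forall>x. norm x > R \<longrightarrow> \<phi> x = 0)" for R
    by (meson linorder_not_le)
  then show ?thesis
    by (simp add: test_function_def csupp_def compact_closure bounded_iff)
qed

lemma test_functionD:
  assumes "test_function \<phi>"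
  shows "Ck k \<phi>" "csupp \<phi>" "continuous_on UNIV \<phi>" "\<phi> differentiable (at x)"
  using assms Ck_SucD[of 0 \<phi>] Ck_continuous[of 0 \<phi>]
  by (auto simp: test_function_iff smooth_def simp del: Ck.simps)

lemma csupp_grad: assumes "csupp f" shows "csupp (grad f)"
proof -
  obtain R where R: "R > 0" "\<And>x. norm x > R \<Longrightarrow> f x = 0" using assms csuppE by metis
  show ?thesis
  proof (rule csuppI)
    fix x :: "real^'a" assume x: "R < norm x"
    have "open {x::real^'a. norm x > R}" by (intro open_Collect_less continuous_intros)
    then have "(f has_derivative (\<lambda>_. 0)) (at x)"
      using has_derivative_transform_within_open[of "\<lambda>_. 0" "\<lambda>_. 0" x UNIV "{x. norm x > R}" f] x R(2) by auto
    then have "partial i f x = 0" for i using partial_eq by fastforce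
    then show "grad f x = 0" by (simp add: grad_def vec_eq_iff)
  qed
qed

lemma csupp_partial: "csupp f \<Longrightarrow> csupp (partial i f)"
  by (rule csupp_weaken[OF csupp_grad]) (auto simp: grad_def vec_eq_iff)

lemma smooth_partial: "smooth f \<Longrightarrow> smooth (partial i f)"
  unfolding smooth_def using Ck_SucD(2) by blast

lemma test_function_partial: "test_function \<phi> \<Longrightarrow> test_function (partial i \<phi>)"
  by (simp add: test_function_iff csupp_partial smooth_partial)

lemma test_function_mult: "test_function \<phi> \<Longrightarrow> smooth f \<Longrightarrow> test_function (\<lambda>x. f x * \<phi> x)"
  by (auto simp: test_function_iff smooth_def intro: Ck_mult csupp_weaken)

lemma continuous_imp_measurable_lebesgue:
  fixes f :: "'a::euclidean_space \<Rightarrow> 'b::euclidean_space"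
  shows "continuous_on UNIV f \<Longrightarrow> f \<in> borel_measurable lebesgue"
  by (simp add: borel_measurable_continuous_onI measurable_completion)

lemma csupp_bounded:
  fixes f :: "'a::euclidean_space \<Rightarrow> 'b::euclidean_space"
  assumes "continuous_on UNIV f" "csupp f"
  obtains B where "B > 0" "\<And>x. norm (f x) \<le> B"
proof -
  obtain R where R: "R > 0" "\<And>x. norm x > R \<Longrightarrow> f x = 0" using assms csuppE by metis
  have "compact (f ` cball 0 R)"
    by (intro compact_continuous_image compact_cball continuous_on_subset[OF assms(1)]) auto
  then obtain B where B: "B > 0" "\<And>y. y \<in> f ` cball 0 R \<Longrightarrow> norm y \<le> B"
    using compact_imp_bounded bounded_pos by metis
  show ?thesis
  proof (rule that[OF B(1)])
    fix x show "norm (f x) \<le> B"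
      using B R(2)[of x] by (cases "norm x > R") (auto simp: less_imp_le)
  qed
qed

lemma integrable_csupp:
  fixes f :: "'a::euclidean_space \<Rightarrow> 'b::euclidean_space"
  assumes "continuous_on UNIV f" "csupp f"
  shows "integrable lebesgue f"
proof -
  obtain R where R: "R > 0" "\<And>x. norm x > R \<Longrightarrow> f x = 0" using assms csuppE by metis
  have "integrable lborel (\<lambda>x. indicator (cball 0 R) x *\<^sub>R f x)"
    by (intro borel_integrable_compact compact_cball continuous_on_subset[OF assms(1)]) auto
  also have "(\<lambda>x. indicator (cball 0 R) x *\<^sub>R f x) = f"
    using R(2) by (force simp: indicator_def)
  finally show ?thesis
    using assms(1) by (simp add: integrable_completion borel_measurable_continuous_onI)
qed

lemma locally_integrable_ball:
  "locally_integrable f \<longleftrightarrow> (\<forall>R. set_integrable lebesgue (cball 0 R) f)"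
proof
  assume *: "\<forall>R. set_integrable lebesgue (cball 0 R) f"
  show "locally_integrable f"
    unfolding locally_integrable_def
  proof (intro allI impI)
    fix S :: "(real^'a) set" assume S: "compact S"
    then obtain R where "S \<subseteq> cball 0 R"
      using bounded_subset_ballD[OF compact_imp_bounded[OF S], of 0] ball_subset_cball by (metis order_trans)
    then show "set_integrable lebesgue S f"
      using * S by (meson set_integrable_subset lmeasurable_compact fmeasurableD)
  qed
qed (auto simp: locally_integrable_def)

lemma locally_integrable_measurable:
  assumes "locally_integrable f"
  shows "f \<in> borel_measurable lebesgue"
proof (rule borel_measurable_LIMSEQ_metric)
  show "(\<lambda>x. indicator (cball 0 (real n)) x *\<^sub>R f x) \<in> borel_measurable lebesgue" for n
    using assms by (intro borel_measurable_integrable) (simp add: locally_integrable_ball set_integrable_def)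
  fix x :: "real^'a"
  obtain N where N: "norm x \<le> real N" using real_arch_simple by blast
  have "\<forall>\<^sub>F n in sequentially. indicator (cball 0 (real n)) x *\<^sub>R f x = f x"
    by (rule eventually_mono[OF eventually_ge_at_top[of N]]) (use N in auto)
  then show "(\<lambda>n. indicator (cball 0 (real n)) x *\<^sub>R f x) \<longlonglongrightarrow> f x"
    by (rule tendsto_eventually)
qed

lemma integrable_local_mult:
  fixes g :: "real^'n::finite \<Rightarrow> 'b::euclidean_space"
  assumes "locally_integrable g" "continuous_on UNIV \<phi>" "csupp \<phi>"
  shows "integrable lebesgue (\<lambda>x. \<phi> x *\<^sub>R g x)"
proof -
  obtain R where R: "R > 0" "\<And>x. norm x > R \<Longrightarrow> \<phi> x = 0" using assms csuppE by metis
  obtain B where B: "B > 0" "\<And>x. norm (\<phi> x) \<le> B" using assms csupp_bounded by metis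
  have "integrable lebesgue (\<lambda>x. B * norm (indicator (cball 0 R) x *\<^sub>R g x))"
    using assms(1) by (intro integrable_mult_right integrable_norm) (auto simp: locally_integrable_ball set_integrable_def)
  then show ?thesis
  proof (rule Bochner_Integration.integrable_bound)
    show "(\<lambda>x. \<phi> x *\<^sub>R g x) \<in> borel_measurable lebesgue"
      using assms by (intro borel_measurable_scaleR locally_integrable_measurable continuous_imp_measurable_lebesgue)
    show "AE x in lebesgue. norm (\<phi> x *\<^sub>R g x) \<le> norm (B * norm (indicator (cball 0 R) x *\<^sub>R g x))"
      using R B by (intro AE_I2) (auto simp: indicator_def abs_mult mult_right_mono not_le)
  qed
qed

lemma integrable_local_multR:
  fixes u :: "real^'n::finite \<Rightarrow> real" and G :: "real^'n \<Rightarrow> 'b::euclidean_space"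
  assumes "locally_integrable u" "continuous_on UNIV G" "csupp G"
  shows "integrable lebesgue (\<lambda>x. u x *\<^sub>R G x)"
proof -
  have "integrable lebesgue (\<lambda>x. norm (G x) *\<^sub>R u x)"
    using assms by (intro integrable_local_mult continuous_intros) (auto intro: csupp_weaken)
  then show ?thesis
  proof (rule Bochner_Integration.integrable_bound)
    show "(\<lambda>x. u x *\<^sub>R G x) \<in> borel_measurable lebesgue"
      by (intro borel_measurable_scaleR locally_integrable_measurable continuous_imp_measurable_lebesgue assms)
  qed (simp add: abs_mult mult.commute)
qed

lemma continuous_imp_locally_integrable:
  fixes f :: "real^'n::finite \<Rightarrow> 'b::euclidean_space"
  assumes "continuous_on UNIV f" shows "locally_integrable f"
proof -
  have "integrable lborel (\<lambda>x. indicator (cball 0 R) x *\<^sub>R f x)" for R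
    by (intro borel_integrable_compact compact_cball continuous_on_subset[OF assms(1)]) auto
  moreover have "(\<lambda>x. indicator (cball 0 R) x *\<^sub>R f x) \<in> borel_measurable lborel" for R
    by (intro borel_measurable_scaleR borel_measurable_indicator) (auto intro!: borel_measurable_continuous_onI assms)
  ultimately show ?thesis
    by (auto simp: locally_integrable_ball set_integrable_def integrable_completion)
qed

lemma locally_integrable_nth:
  assumes "locally_integrable g" shows "locally_integrable (\<lambda>x. g x $ i)"
proof -
  have "integrable lebesgue (\<lambda>x. (indicator S x *\<^sub>R g x) $ i)" if "compact S" for S
    using assms that by (intro integrable_bounded_linear[OF bounded_linear_vec_nth])
      (auto simp: locally_integrable_def set_integrable_def)
  then show ?thesis by (auto simp: locally_integrable_def set_integrable_def)
qed

lemma continuous_on_vec_lambda: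
  "(\<And>i. continuous_on S (f i)) \<Longrightarrow> continuous_on S (\<lambda>x. \<chi> i. f i x)"
  by (auto simp: continuous_on_def intro: tendsto_vec_lambda vec_tendstoI)

lemma grad_continuous: "Ck 1 f \<Longrightarrow> continuous_on UNIV (grad f)"
  unfolding grad_def by (intro continuous_on_vec_lambda) auto

text \<open>The vector-valued integrals of the definition exist because test functions are bounded with bounded
support; hence the identity can be read in each component.\<close>

lemma has_weak_grad_iff:
  "has_weak_grad u g \<longleftrightarrow> locally_integrable u \<and> locally_integrable g \<and>
     (\<forall>\<phi> i. test_function \<phi> \<longrightarrow>
        (LINT x|lebesgue. u x * partial i \<phi> x) = - (LINT x|lebesgue. \<phi> x * g x $ i))"
proof -
  have "((LINT x|lebesgue. u x *\<^sub>R grad \<phi> x) = - (LINT x|lebesgue. \<phi> x *\<^sub>R g x)) \<longleftrightarrow>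
     (\<forall>i. (LINT x|lebesgue. u x * partial i \<phi> x) = - (LINT x|lebesgue. \<phi> x * g x $ i))"
    if u: "locally_integrable u" and g: "locally_integrable g" and \<phi>: "test_function \<phi>" for \<phi>
  proof -
    have 1: "(LINT x|lebesgue. u x *\<^sub>R grad \<phi> x) $ i = (LINT x|lebesgue. u x * partial i \<phi> x)" for i
      using integral_bounded_linear[OF bounded_linear_vec_nth
          integrable_local_multR[OF u grad_continuous csupp_grad], of \<phi> i] test_functionD[OF \<phi>]
      by (simp add: grad_def)
    have 2: "(LINT x|lebesgue. \<phi> x *\<^sub>R g x) $ i = (LINT x|lebesgue. \<phi> x * g x $ i)" for i
      using integral_bounded_linear[OF bounded_linear_vec_nth
          integrable_local_mult[OF g], of \<phi> i] test_functionD[OF \<phi>] by simp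
    show ?thesis by (simp add: vec_eq_iff 1 2)
  qed
  then show ?thesis unfolding has_weak_grad_def by blast
qed

lemma DERIV_line:
  assumes "Ck 1 F"
  shows "((\<lambda>t. F (x + t *\<^sub>R v)) has_real_derivative grad F (x + t *\<^sub>R v) \<bullet> v) (at t)"
proof -
  have "((\<lambda>t. x + t *\<^sub>R v) has_derivative (\<lambda>h. h *\<^sub>R v)) (at t)"
    by (auto intro!: derivative_eq_intros)
  moreover have "(F has_derivative (\<lambda>h. grad F (x + t *\<^sub>R v) \<bullet> h)) (at (x + t *\<^sub>R v))"
    using assms by (intro has_derivative_grad) auto
  ultimately have "((\<lambda>t. F (x + t *\<^sub>R v)) has_derivative (\<lambda>h. grad F (x + t *\<^sub>R v) \<bullet> (h *\<^sub>R v))) (at t)"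
    by (rule has_derivative_compose)
  then show ?thesis by (simp add: has_field_derivative_def mult.commute fun_eq_iff cong: if_cong) (metis mult.commute ext)
qed

lemma lebesgue_integral_lborel:
  fixes f :: "'a::euclidean_space \<Rightarrow> 'b::euclidean_space"
  shows "f \<in> borel_measurable borel \<Longrightarrow> integral\<^sup>L lebesgue f = integral\<^sup>L lborel f"
  by (simp add: integral_completion)

lemma lborel_integral_translate:
  fixes f :: "'a::euclidean_space \<Rightarrow> 'b::euclidean_space"
  assumes "f \<in> borel_measurable borel"
  shows "(LINT x|lborel. f (x + v)) = (LINT x|lborel. f x)"
proof -
  have "(LINT x|lborel. f x) = (LINT x|distr lborel borel ((+) v). f x)"
    by (simp add: lborel_distr_plus)
  also have "\<dots> = (LINT x|lborel. f (v + x))" using assms by (subst integral_distr) auto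
  finally show ?thesis by (simp add: add.commute)
qed

text \<open>By translation invariance all difference quotients of \<open>F\<close> have integral \<open>0\<close>. They converge to the
partial derivative and, by the mean value theorem, are dominated by a constant on a fixed ball.\<close>

lemma integral_partial_zero:
  assumes F: "Ck 1 F" "csupp F"
  shows "(LINT x|lebesgue. partial i F x) = 0"
proof -
  define e where "e = (axis i 1 :: real^'a)"
  have cF: "continuous_on UNIV F" and cG: "continuous_on UNIV (grad F)" using F Ck_continuous grad_continuous by blast+
  obtain R where R: "R > 0" "\<And>x. norm x > R \<Longrightarrow> F x = 0" using F csuppE by metis
  obtain B where B: "B > 0" "\<And>x. norm (grad F x) \<le> B" using cG csupp_grad[OF F(2)] csupp_bounded by metis
  have ne: "norm e = 1" by (simp add: e_def norm_axis_1)
  define s where "s n x = real (Suc n) * (F (x + (1 / real (Suc n)) *\<^sub>R e) - F x)" for n x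
  have mF: "F \<in> borel_measurable borel" using cF borel_measurable_continuous_onI by blast
  have cs: "continuous_on UNIV (s n)" for n
    unfolding s_def by (auto intro!: continuous_intros continuous_on_compose2[OF cF])
  have sbound: "norm (s n x) \<le> indicator (cball 0 (R+1)) x *\<^sub>R B" for n x
  proof -
    define t where "t = 1 / real (Suc n)"
    have t: "0 < t" "t \<le> 1" by (auto simp: t_def)
    obtain z where z: "F (x + t *\<^sub>R e) - F (x + 0 *\<^sub>R e) = (t - 0) * (grad F (x + z *\<^sub>R e) \<bullet> e)"
      using MVT2[OF t(1) DERIV_line[OF F(1)]] by blast
    have "\<bar>grad F (x + z *\<^sub>R e) \<bullet> e\<bar> \<le> B"
      using Cauchy_Schwarz_ineq2[of "grad F (x + z *\<^sub>R e)" e] B(2)[of "x + z *\<^sub>R e"] ne by simp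
    moreover have "s n x = grad F (x + z *\<^sub>R e) \<bullet> e"
      using z t by (simp add: s_def t_def)
    moreover have "s n x = 0" if "x \<notin> cball 0 (R+1)"
    proof -
      have "norm (x + t *\<^sub>R e) \<ge> norm x - norm (t *\<^sub>R e)" by (metis add.commute norm_diff_ineq)
      then have "norm (x + t *\<^sub>R e) > R" using that t ne by (simp add: dist_norm)
      then show ?thesis using R that by (simp add: s_def t_def dist_norm)
    qed
    ultimately show ?thesis by (auto simp: indicator_def)
  qed
  have lim: "(\<lambda>n. s n x) \<longlonglongrightarrow> partial i F x" for x
  proof -
    have "((\<lambda>t. (F (x + t *\<^sub>R e) - F (x + 0 *\<^sub>R e)) / t) \<longlongrightarrow> grad F (x + 0 *\<^sub>R e) \<bullet> e) (at 0)"
      using DERIV_line[OF F(1), of x e 0] by (simp add: has_field_derivative_iff)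
    moreover have "filterlim (\<lambda>n. 1 / real (Suc n)) (at 0) sequentially"
      using LIMSEQ_Suc[OF lim_1_over_n] by (intro filterlim_atI) (auto simp: field_simps)
    ultimately have "(\<lambda>n. (F (x + (1 / real (Suc n)) *\<^sub>R e) - F (x + 0 *\<^sub>R e)) / (1 / real (Suc n)))
        \<longlonglongrightarrow> grad F (x + 0 *\<^sub>R e) \<bullet> e"
      by (rule filterlim_compose)
    then show ?thesis by (simp add: s_def e_def inner_axis grad_def mult.commute)
  qed
  have int0: "(LINT x|lebesgue. s n x) = 0" for n
  proof -
    have i: "integrable lborel F"
      using integrable_csupp[OF cF F(2)] mF by (simp add: integrable_completion)
    have i2: "integrable lborel (\<lambda>x. F (x + (1 / real (Suc n)) *\<^sub>R e))"
    proof -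
      let ?G = "\<lambda>x. F (x + (1 / real (Suc n)) *\<^sub>R e)"
      have c: "continuous_on UNIV ?G" by (auto intro!: continuous_intros continuous_on_compose2[OF cF])
      moreover have "csupp ?G"
      proof (rule csuppI[of "R+1"])
        fix x :: "real^'a" assume "norm x > R + 1"
        moreover have "norm (x + (1 / real (Suc n)) *\<^sub>R e) \<ge> norm x - norm ((1 / real (Suc n)) *\<^sub>R e)"
          by (metis add.commute norm_diff_ineq)
        moreover have "norm ((1 / real (Suc n)) *\<^sub>R e) \<le> 1" using ne by simp
        ultimately show "?G x = 0" using R(2) by (smt (verit))
      qed
      ultimately show ?thesis using integrable_csupp[of ?G] 
        by (simp add: integrable_completion borel_measurable_continuous_onI)
    qed
    have "(LINT x|lebesgue. s n x) = (LINT x|lborel. s n x)"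
      using cs by (intro lebesgue_integral_lborel borel_measurable_continuous_onI)
    also have "\<dots> = 0"
      unfolding s_def using i i2 lborel_integral_translate[OF mF] by simp
    finally show ?thesis .
  qed
  have "(\<lambda>n. LINT x|lebesgue. s n x) \<longlonglongrightarrow> (LINT x|lebesgue. partial i F x)"
  proof (rule integral_dominated_convergence)
    show "partial i F \<in> borel_measurable lebesgue"
      using F by (intro continuous_imp_measurable_lebesgue) auto
    show "s n \<in> borel_measurable lebesgue" for n using cs continuous_imp_measurable_lebesgue by blast
    show "integrable lebesgue (\<lambda>x. indicator (cball 0 (R+1)) x *\<^sub>R B)"
      using lmeasurable_iff_integrable lmeasurable_cball by (intro integrable_scaleR_left) blast
  qed (use lim sbound in auto)
  then show ?thesis by (simp add: int0 LIMSEQ_const_iff)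
qed

lemma integral_by_parts:
  assumes "Ck 1 F" "Ck 1 G" "csupp G"
  shows "(LINT x|lebesgue. F x * partial i G x) = - (LINT x|lebesgue. partial i F x * G x)"
proof -
  have "(\<lambda>x. partial i (\<lambda>x. F x * G x) x) = (\<lambda>x. F x * partial i G x + partial i F x * G x)"
    using assms by (intro ext partial_mult) auto
  moreover have "(LINT x|lebesgue. partial i (\<lambda>x. F x * G x) x) = 0"
    using assms by (intro integral_partial_zero Ck_mult) (auto intro: csupp_weaken)
  moreover have "integrable lebesgue (\<lambda>x. F x * partial i G x)" "integrable lebesgue (\<lambda>x. partial i F x * G x)"
    using assms csupp_partial[of G i] Ck_continuous[of 1 F] Ck_continuous[of 1 G]
    by (auto intro!: integrable_csupp continuous_intros) (auto intro: csupp_weaken)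
  ultimately show ?thesis by simp
qed

lemma has_weak_grad_C1:
  assumes "Ck 1 F" shows "has_weak_grad F (grad F)"
  unfolding has_weak_grad_iff
proof (intro conjI allI impI)
  show "locally_integrable F" "locally_integrable (grad F)"
    using assms Ck_continuous grad_continuous continuous_imp_locally_integrable by blast+
  fix \<phi> :: "real^'a \<Rightarrow> real" and i assume "test_function \<phi>"
  then show "(LINT x|lebesgue. F x * partial i \<phi> x) = - (LINT x|lebesgue. \<phi> x * grad F x $ i)"
    using integral_by_parts[OF assms test_functionD(1,2)] by (simp add: grad_def mult.commute)
qed

text \<open>Normalized to the value \<open>1\<close> at the origin, so that \<open>bump (x / n)\<close> tends to \<open>1\<close> as \<open>n\<close> grows and can serve as
a cut-off.\<close>

definition bump :: "real^'n::finite \<Rightarrow> real" where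
  "bump x = exp 1 * flat 1 (1 - x \<bullet> x)"

lemma Ck_inner_self: "Ck k (\<lambda>x. x \<bullet> x)"
  unfolding inner_vec_def by (auto intro!: Ck_sum Ck_mult Ck_component)

lemma bump_zero: "norm x \<ge> 1 \<Longrightarrow> bump x = 0"
  by (simp add: bump_def flat_def dot_square_norm abs_square_less_1 not_less)

lemma bump_at_0 [simp]: "bump 0 = 1"
  by (simp add: bump_def flat_def flip: exp_add)

lemma bump_nonneg: "bump x \<ge> 0"
  by (simp add: bump_def flat_def)

lemma bump_le_1: "bump x \<le> 1"
proof -
  have "exp 1 * exp (- (1 / (1 - x \<bullet> x))) \<le> 1" if "x \<bullet> x < 1"
  proof -
    have "1 / (1 - x \<bullet> x) \<ge> 1" using that by (simp add: field_simps)
    then show ?thesis by (simp flip: exp_add)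
  qed
  then show ?thesis by (auto simp: bump_def flat_def)
qed

lemma test_function_bump: "test_function bump"
  unfolding test_function_iff smooth_def
proof (intro conjI allI)
  fix k
  have "Ck k (\<lambda>x::real^'a. 1 + (-1) * (x \<bullet> x))" by (intro Ck_add Ck_mult Ck_const Ck_inner_self)
  then show "Ck k (bump :: real^'a \<Rightarrow> real)"
    unfolding bump_def using Ck_flat[of k "\<lambda>x::real^'a. 1 - x \<bullet> x" 1] by (auto intro!: Ck_mult Ck_const)
  show "csupp (bump :: real^'a \<Rightarrow> real)" by (rule csuppI[of 1]) (simp add: bump_zero)
qed

section \<open>Mollification and uniqueness of weak gradients\<close>

lemma test_function_affine:
  assumes "test_function \<phi>" "c \<noteq> 0"
  shows "test_function (\<lambda>x. \<phi> (a + c *\<^sub>R x))"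
  unfolding test_function_iff smooth_def
proof (intro conjI allI)
  show "Ck k (\<lambda>x. \<phi> (a + c *\<^sub>R x))" for k
    using assms by (intro Ck_affine) (auto intro: test_functionD)
  obtain R where R: "R > 0" "\<And>x. norm x > R \<Longrightarrow> \<phi> x = 0"
    using test_functionD(2)[OF assms(1)] csuppE by metis
  show "csupp (\<lambda>x. \<phi> (a + c *\<^sub>R x))"
  proof (rule csuppI[of "(R + norm a) / \<bar>c\<bar>"])
    fix x :: "real^'a" assume "norm x > (R + norm a) / \<bar>c\<bar>"
    then have "R + norm a < norm (c *\<^sub>R x)" using assms(2) by (simp add: field_simps)
    also have "norm (c *\<^sub>R x) \<le> norm (a + c *\<^sub>R x) + norm a"
      using norm_triangle_ineq4[of "a + c *\<^sub>R x" a] by simp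
    finally show "\<phi> (a + c *\<^sub>R x) = 0" using R(2) by simp
  qed
qed

definition convolve :: "(real^'n::finite \<Rightarrow> real) \<Rightarrow> (real^'n \<Rightarrow> real) \<Rightarrow> real^'n \<Rightarrow> real" where
  "convolve \<phi> v x = (LINT y|lebesgue. \<phi> (x - y) * v y)"

lemma integrable_bounded_mult:
  fixes k v :: "'a::euclidean_space \<Rightarrow> real"
  assumes "integrable lebesgue v" "k \<in> borel_measurable lebesgue" "\<And>x. \<bar>k x\<bar> \<le> B"
  shows "integrable lebesgue (\<lambda>x. k x * v x)"
proof (rule Bochner_Integration.integrable_bound)
  show "integrable lebesgue (\<lambda>x. B * v x)" using assms by simp
  show "(\<lambda>x. k x * v x) \<in> borel_measurable lebesgue" using assms by auto
  show "AE x in lebesgue. norm (k x * v x) \<le> norm (B * v x)"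
    using assms(3) by (intro AE_I2) (simp add: abs_mult mult_right_mono order_trans[OF assms(3)])
qed

lemma convolve_integrable:
  fixes \<phi> v :: "'a::euclidean_space \<Rightarrow> real"
  assumes "integrable lebesgue v" "continuous_on UNIV \<phi>" "csupp \<phi>"
  shows "integrable lebesgue (\<lambda>y. \<phi> (x - y) * v y)"
proof -
  obtain B where B: "B > 0" "\<And>x. norm (\<phi> x) \<le> B" using csupp_bounded[OF assms(2,3)] by metis
  show ?thesis
    using assms B(2) by (intro integrable_bounded_mult[where B=B] continuous_imp_measurable_lebesgue)
      (auto intro!: continuous_intros continuous_on_compose2[OF assms(2)])
qed

text \<open>A remainder that is quadratic uniformly in \<open>z\<close> allows a convolution to be differentiated under the
integral sign in one step.\<close>

lemma taylor_bound:
  assumes \<phi>: "test_function \<phi>"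
  obtains C where "C > 0" "\<And>z h. \<bar>\<phi> (z + h) - \<phi> z - grad \<phi> z \<bullet> h\<bar> \<le> C * (norm h)\<^sup>2"
proof -
  have "\<exists>B. B > 0 \<and> (\<forall>x. norm (grad (partial i \<phi>) x) \<le> B)" for i
  proof -
    have t: "test_function (partial i \<phi>)" using \<phi> by (rule test_function_partial)
    show ?thesis
      using csupp_bounded[OF grad_continuous[OF test_functionD(1)[OF t]] csupp_grad[OF test_functionD(2)[OF t]]] by metis
  qed
  then obtain B where B: "\<And>i. B i > 0" "\<And>i x. norm (grad (partial i \<phi>) x) \<le> B i" by metis
  have lip: "\<bar>partial i \<phi> (z + t *\<^sub>R h) - partial i \<phi> z\<bar> \<le> B i * norm h" if t: "0 < t" "t < 1" for i z h t
  proof -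
    have C1: "Ck 1 (partial i \<phi>)" using test_functionD(1) test_function_partial \<phi> by blast
    obtain s where s: "partial i \<phi> (z + t *\<^sub>R h) - partial i \<phi> (z + 0 *\<^sub>R h) = (t - 0) * (grad (partial i \<phi>) (z + s *\<^sub>R h) \<bullet> h)"
      using MVT2[OF t(1) DERIV_line[OF C1]] by blast
    have "\<bar>grad (partial i \<phi>) (z + s *\<^sub>R h) \<bullet> h\<bar> \<le> B i * norm h"
      using Cauchy_Schwarz_ineq2[of "grad (partial i \<phi>) (z + s *\<^sub>R h)" h] B(2)[of i "z + s *\<^sub>R h"]
      by (meson mult_right_mono norm_ge_zero order_trans)
    then have "t * \<bar>grad (partial i \<phi>) (z + s *\<^sub>R h) \<bullet> h\<bar> \<le> 1 * (B i * norm h)"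
      using t by (intro mult_mono) auto
    then show ?thesis using s t by (simp add: abs_mult)
  qed
  show ?thesis
  proof (rule that[of "\<Sum>i\<in>UNIV. B i"])
    show "(\<Sum>i\<in>UNIV. B i) > 0" using B(1) by (intro sum_pos) auto
    fix z h
    obtain t where t: "0 < t" "t < 1" "\<phi> (z + 1 *\<^sub>R h) - \<phi> (z + 0 *\<^sub>R h) = (1 - 0) * (grad \<phi> (z + t *\<^sub>R h) \<bullet> h)"
      using MVT2[OF zero_less_one DERIV_line[OF test_functionD(1)[OF \<phi>, of 1]], of z h] by blast
    have "\<bar>\<phi> (z + h) - \<phi> z - grad \<phi> z \<bullet> h\<bar> = \<bar>(grad \<phi> (z + t *\<^sub>R h) - grad \<phi> z) \<bullet> h\<bar>"
      using t(3) by (simp add: inner_diff_left)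
    also have "\<dots> \<le> norm (grad \<phi> (z + t *\<^sub>R h) - grad \<phi> z) * norm h" by (rule Cauchy_Schwarz_ineq2)
    also have "\<dots> \<le> (\<Sum>i\<in>UNIV. B i * norm h) * norm h"
    proof (intro mult_right_mono order_trans[OF norm_le_l1_cart] sum_mono)
      fix i show "\<bar>(grad \<phi> (z + t *\<^sub>R h) - grad \<phi> z) $ i\<bar> \<le> B i * norm h"
        using lip[OF t(1,2), of i z h] by (simp add: grad_def)
    qed auto
    finally show "\<bar>\<phi> (z + h) - \<phi> z - grad \<phi> z \<bullet> h\<bar> \<le> (\<Sum>i\<in>UNIV. B i) * (norm h)\<^sup>2"
      by (simp add: sum_distrib_right power2_eq_square mult.assoc)
  qed
qed

lemma convolve_derivative:
  assumes v: "integrable lebesgue v" and \<phi>: "test_function \<phi>"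
  shows "(convolve \<phi> v has_derivative (\<lambda>h. (\<chi> i. convolve (partial i \<phi>) v x) \<bullet> h)) (at x)"
proof -
  obtain C where C: "C > 0" "\<And>z h. \<bar>\<phi> (z + h) - \<phi> z - grad \<phi> z \<bullet> h\<bar> \<le> C * (norm h)\<^sup>2"
    using taylor_bound[OF \<phi>] by blast
  define I where "I = (LINT y|lebesgue. \<bar>v y\<bar>)"
  let ?D = "\<lambda>h. (\<chi> i. convolve (partial i \<phi>) v x) \<bullet> h"
  have i0: "integrable lebesgue (\<lambda>y. \<phi> (z - y) * v y)" for z
    using convolve_integrable[OF v test_functionD(3)[OF \<phi>] test_functionD(2)[OF \<phi>]] .
  have i1: "integrable lebesgue (\<lambda>y. partial i \<phi> (z - y) * v y)" for z i
    using convolve_integrable[OF v] test_functionD(2,3)[OF test_function_partial[OF \<phi>]] by blast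
  have bound: "norm (convolve \<phi> v (x + h) - convolve \<phi> v x - ?D h) \<le> C * I * (norm h)\<^sup>2" for h
  proof -
    have g: "(\<lambda>y. (\<Sum>i\<in>UNIV. partial i \<phi> (x - y) * v y * h $ i)) = (\<lambda>y. (grad \<phi> (x - y) \<bullet> h) * v y)"
      by (auto simp: inner_vec_def grad_def sum_distrib_left sum_distrib_right mult_ac)
    have "?D h = (LINT y|lebesgue. (grad \<phi> (x - y) \<bullet> h) * v y)"
      unfolding g[symmetric] using i1 by (simp add: inner_vec_def convolve_def)
    moreover have ig: "integrable lebesgue (\<lambda>y. (grad \<phi> (x - y) \<bullet> h) * v y)"
      unfolding g[symmetric] using i1 by (intro Bochner_Integration.integrable_sum integrable_mult_left) 
    ultimately have "convolve \<phi> v (x + h) - convolve \<phi> v x - ?D h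
        = (LINT y|lebesgue. \<phi> (x + h - y) * v y - \<phi> (x - y) * v y - (grad \<phi> (x - y) \<bullet> h) * v y)"
      using i0 by (simp add: convolve_def)
    also have "norm \<dots> \<le> (LINT y|lebesgue. C * (norm h)\<^sup>2 * \<bar>v y\<bar>)"
    proof (rule Bochner_Integration.integral_norm_bound_integral)
      show "integrable lebesgue (\<lambda>y. C * (norm h)\<^sup>2 * \<bar>v y\<bar>)" using v by auto
      fix y
      have "\<phi> (x + h - y) * v y - \<phi> (x - y) * v y - (grad \<phi> (x - y) \<bullet> h) * v y
          = (\<phi> ((x - y) + h) - \<phi> (x - y) - grad \<phi> (x - y) \<bullet> h) * v y"
        by (simp add: algebra_simps)
      then show "norm (\<phi> (x + h - y) * v y - \<phi> (x - y) * v y - (grad \<phi> (x - y) \<bullet> h) * v y) \<le> C * (norm h)\<^sup>2 * \<bar>v y\<bar>"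
        using C(2)[of "x - y" h] by (simp only: real_norm_def abs_mult) (intro mult_right_mono, auto)
    qed (use i0 ig in auto)
    finally show ?thesis by (simp add: I_def mult_ac)
  qed
  show ?thesis
    unfolding has_derivative_at
  proof
    show "bounded_linear ?D" by (rule bounded_linear_inner_right)
    have "((\<lambda>h::real^'a. C * I * norm h) \<longlongrightarrow> C * I * norm (0::real^'a)) (at 0)"
      by (intro tendsto_intros)
    then show "(\<lambda>h. norm (convolve \<phi> v (x + h) - convolve \<phi> v x - ?D h) / norm h) \<midarrow>0\<rightarrow> 0"
    proof (rule tendsto_0_le[where K=1, OF tendsto_eq_rhs])
      have "norm (convolve \<phi> v (x + h) - convolve \<phi> v x - ?D h) / norm h \<le> C * I * norm h" for h
      proof (cases "h = 0")
        case False
        then show ?thesis using bound[of h] by (simp add: divide_le_eq power2_eq_square mult_ac)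
      qed simp
      then show "\<forall>\<^sub>F h in at 0. norm (norm (convolve \<phi> v (x + h) - convolve \<phi> v x - ?D h) / norm h) \<le> norm (C * I * norm h) * 1"
        using C(1) by (intro always_eventually) (auto simp: I_def abs_mult intro: order_trans)
    qed simp
  qed
qed

lemma partial_convolve:
  assumes "integrable lebesgue v" "test_function \<phi>"
  shows "partial i (convolve \<phi> v) = convolve (partial i \<phi>) v"
  using partial_eq[OF convolve_derivative[OF assms]] by (auto simp: inner_axis)

lemma Ck_convolve:
  assumes "integrable lebesgue v" "test_function \<phi>"
  shows "Ck k (convolve \<phi> v)"
  using assms(2)
proof (induction k arbitrary: \<phi>)
  case 0
  have "convolve \<phi> v differentiable at x" for x
    using convolve_derivative[OF assms(1) 0] differentiable_def by blast
  then show ?case by (simp add: continuous_on_eq_continuous_at differentiable_imp_continuous_within)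
next
  case (Suc k)
  have "convolve \<phi> v differentiable at x" for x
    using convolve_derivative[OF assms(1) Suc.prems] differentiable_def by blast
  then show ?case
    using Suc by (auto simp: partial_convolve[OF assms(1)] test_function_partial)
qed

lemma convolve_zero_outside:
  assumes "\<And>x. norm x > R \<Longrightarrow> v x = 0" "\<And>x. norm x > S \<Longrightarrow> \<phi> x = 0" "norm x > R + S"
  shows "convolve \<phi> v x = 0"
proof -
  have "\<phi> (x - y) * v y = 0" for y
    using assms norm_triangle_ineq4[of x y] norm_triangle_sub[of x y] 
    by (cases "norm y > R") (auto intro!: assms(2))
  then show ?thesis unfolding convolve_def by (simp only: integral_zero)
qed

lemma test_function_convolve:
  assumes "integrable lebesgue v" "test_function \<phi>" "csupp v"
  shows "test_function (convolve \<phi> v)"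
proof -
  obtain R S where "\<And>x. norm x > R \<Longrightarrow> v x = 0" "\<And>x. norm x > S \<Longrightarrow> \<phi> x = 0"
    using test_functionD(2)[OF assms(2)] assms(3) by (auto simp: csupp_def)
  then show ?thesis
    using Ck_convolve[OF assms(1,2)] unfolding test_function_iff smooth_def
    by (auto intro!: csuppI[of "R + S"] convolve_zero_outside)
qed

text \<open>Dividing by the integral of the scaled bump normalizes without computing that integral.\<close>

definition mollifier :: "real \<Rightarrow> real^'n::finite \<Rightarrow> real" where
  "mollifier \<delta> x = bump ((1/\<delta>) *\<^sub>R x) / (LINT z|lebesgue. bump ((1/\<delta>) *\<^sub>R z :: real^'n))"

lemma integral_pos_continuous:
  fixes f :: "'a::euclidean_space \<Rightarrow> real"
  assumes "continuous_on UNIV f" "csupp f" "\<And>x. f x \<ge> 0" "f a > 0"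
  shows "(LINT x|lebesgue. f x) > 0"
proof -
  have i: "integrable lebesgue f" using assms integrable_csupp by blast
  have "(LINT x|lebesgue. f x) \<noteq> 0"
  proof
    assume "(LINT x|lebesgue. f x) = 0"
    then have ae: "AE x in lebesgue. f x = 0"
      using integral_nonneg_eq_0_iff_AE[OF i] assms(3) by simp
    have "open (f -` {0<..})" using assms(1) by (simp add: open_vimage)
    moreover have "a \<in> f -` {0<..}" using assms(4) by simp
    moreover have "negligible (f -` {0<..})"
    proof (rule negligible_subset)
      show "negligible {x. f x \<noteq> 0}"
        using ae unfolding eventually_ae_filter by (auto simp: negligible_iff_null_sets intro: negligible_subset[unfolded negligible_iff_null_sets])
    qed auto
    ultimately show False using open_not_negligible by blast
  qed
  moreover have "(LINT x|lebesgue. f x) \<ge> 0" using assms(3) by simp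
  ultimately show ?thesis by linarith
qed

lemma mollifier_props:
  assumes "\<delta> > 0"
  shows "test_function (mollifier \<delta> :: real^'n::finite \<Rightarrow> real)"
    and "\<And>x. mollifier \<delta> (x :: real^'n) \<ge> 0" and "\<And>x. norm (x :: real^'n) > \<delta> \<Longrightarrow> mollifier \<delta> x = 0"
    and "(LINT z|lebesgue. mollifier \<delta> (z :: real^'n)) = 1" and "\<And>x. mollifier \<delta> (- x :: real^'n) = mollifier \<delta> x"
proof -
  let ?b = "\<lambda>x::real^'n. bump ((1/\<delta>) *\<^sub>R x)"
  define Z where "Z = (LINT z|lebesgue. ?b z)"
  have t: "test_function ?b" using test_function_affine[OF test_function_bump, of "1/\<delta>" 0] assms by simp
  have Z: "Z > 0" unfolding Z_def
    using test_functionD(2,3)[OF t] by (intro integral_pos_continuous[where a=0]) (auto simp: bump_nonneg)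
  have m: "mollifier \<delta> = (\<lambda>x. (1/Z) * ?b x)" by (auto simp: mollifier_def Z_def)
  show "test_function (mollifier \<delta> :: real^'n \<Rightarrow> real)"
    unfolding m by (rule test_function_mult[OF t]) (auto simp: smooth_def Ck_const)
  show "mollifier \<delta> x \<ge> 0" for x :: "real^'n" unfolding m using Z by (simp add: bump_nonneg)
  show "mollifier \<delta> x = 0" if "norm x > \<delta>" for x :: "real^'n"
    using that assms unfolding m by (simp add: bump_zero)
  show "(LINT z|lebesgue. mollifier \<delta> (z :: real^'n)) = 1" unfolding m using Z by (simp add: Z_def)
  show "mollifier \<delta> (- x) = mollifier \<delta> x" for x :: "real^'n" by (simp add: mollifier_def bump_def)
qed

lemma mollifier_shift_integral:
  assumes "\<delta> > 0"
  shows "(LINT y|lebesgue. mollifier \<delta> (x - y)) = 1" "integrable lebesgue (\<lambda>y. mollifier \<delta> (x - y))"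
proof -
  let ?m = "mollifier \<delta> :: real^'a \<Rightarrow> real"
  note t = mollifier_props(1)[OF assms]
  have b: "?m \<in> borel_measurable borel" 
    using test_functionD(3)[OF t] borel_measurable_continuous_onI by blast
  have "(\<lambda>y. ?m (x - y)) = (\<lambda>y. ?m (y + (- x)))" using mollifier_props(5)[OF assms] by (metis minus_diff_eq diff_conv_add_uminus)
  moreover have "(LINT y|lebesgue. ?m (y + (- x))) = (LINT y|lborel. ?m (y + (-x)))"
    using b by (intro lebesgue_integral_lborel) auto
  ultimately show "(LINT y|lebesgue. ?m (x - y)) = 1"
    using lborel_integral_translate[OF b, of "-x"] mollifier_props(4)[OF assms, where 'n='a] lebesgue_integral_lborel[OF b] by simp
  have "test_function (\<lambda>y. ?m (x - y))" using test_function_affine[OF t, of "-1" x] by simp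
  then show "integrable lebesgue (\<lambda>y. ?m (x - y))"
    using test_functionD(2,3) integrable_csupp by blast
qed

lemma convolve_mollifier_uniform:
  assumes c: "continuous_on UNIV c" "csupp c" and \<tau>: "\<tau> > 0"
  obtains \<delta>0 where "\<delta>0 > 0" "\<And>\<delta> x. 0 < \<delta> \<Longrightarrow> \<delta> < \<delta>0 \<Longrightarrow> \<bar>convolve (mollifier \<delta>) c x - c x\<bar> \<le> \<tau>"
proof -
  obtain R where R: "R > 0" "\<And>x. norm x > R \<Longrightarrow> c x = 0" using c csuppE by metis
  have "uniformly_continuous_on (cball 0 (R+1)) c"
    by (intro compact_uniformly_continuous continuous_on_subset[OF c(1)]) auto
  then obtain d where d: "d > 0" "\<And>x y. norm x \<le> R+1 \<Longrightarrow> norm y \<le> R+1 \<Longrightarrow> dist x y < d \<Longrightarrow> dist (c x) (c y) < \<tau>"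
    unfolding uniformly_continuous_on_def using \<tau> by (metis mem_cball_0)
  have u: "\<bar>c y - c x\<bar> \<le> \<tau>" if "dist x y < min d 1" for x y
  proof (cases "norm x \<le> R + 1 \<and> norm y \<le> R + 1")
    case True
    then show ?thesis using d(2)[of x y] that by (auto simp: dist_real_def)
  next
    case False
    then have "norm x > R" "norm y > R" using that norm_triangle_ineq2[of x y] norm_triangle_ineq2[of y x]
      by (auto simp: dist_norm norm_minus_commute)
    then show ?thesis using R \<tau> by simp
  qed
  show ?thesis
  proof (rule that[of "min d 1"])
    fix \<delta> :: real and x :: "real^'a" assume \<delta>: "0 < \<delta>" "\<delta> < min d 1"
    note t = mollifier_props(1)[OF \<delta>(1), where 'n='a]
    have i: "integrable lebesgue (\<lambda>y. mollifier \<delta> (x - y) * c y)"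
      using convolve_integrable[OF integrable_csupp[OF c]] test_functionD(2,3)[OF t] by blast
    have i2: "integrable lebesgue (\<lambda>y. mollifier \<delta> (x - y) * c x)" 
      using mollifier_shift_integral(2)[OF \<delta>(1), of x] by simp
    have "convolve (mollifier \<delta>) c x - c x = (LINT y|lebesgue. mollifier \<delta> (x - y) * c y - mollifier \<delta> (x - y) * c x)"
      using i i2 mollifier_shift_integral(1)[OF \<delta>(1), of x] by (simp add: convolve_def)
    also have "norm \<dots> \<le> (LINT y|lebesgue. mollifier \<delta> (x - y) * \<tau>)"
    proof (rule Bochner_Integration.integral_norm_bound_integral)
      fix y show "norm (mollifier \<delta> (x - y) * c y - mollifier \<delta> (x - y) * c x) \<le> mollifier \<delta> (x - y) * \<tau>"
      proof (cases "norm (x - y) > \<delta>")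
        case False
        then have "\<bar>c y - c x\<bar> \<le> \<tau>" using \<delta> by (intro u) (auto simp: dist_norm)
        then have "mollifier \<delta> (x - y) * \<bar>c y - c x\<bar> \<le> mollifier \<delta> (x - y) * \<tau>"
          using mollifier_props(2)[OF \<delta>(1)] by (intro mult_left_mono)
        then show ?thesis using mollifier_props(2)[OF \<delta>(1), of "x - y"]
          by (simp add: abs_mult flip: right_diff_distrib)
      qed (simp add: mollifier_props(3)[OF \<delta>(1)])
    qed (use i i2 mollifier_shift_integral(2)[OF \<delta>(1), of x] in auto)
    finally show "\<bar>convolve (mollifier \<delta>) c x - c x\<bar> \<le> \<tau>" using mollifier_shift_integral(1)[OF \<delta>(1), of x] by simp
  qed (use d in auto)
qed

lemma continuous_approx_test:
  assumes c: "continuous_on UNIV c" "\<And>x. norm x > R \<Longrightarrow> c x = 0" and \<tau>: "\<tau> > 0"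
  obtains t where "test_function t" "\<And>x. norm x > R + 1 \<Longrightarrow> t x = 0" "\<And>x. \<bar>t x - c x\<bar> \<le> \<tau>"
proof -
  have cs: "csupp c" using c(2) csuppI by blast
  obtain \<delta>0 where \<delta>0: "\<delta>0 > 0" "\<And>\<delta> x. 0 < \<delta> \<Longrightarrow> \<delta> < \<delta>0 \<Longrightarrow> \<bar>convolve (mollifier \<delta>) c x - c x\<bar> \<le> \<tau>"
    using convolve_mollifier_uniform[OF c(1) cs \<tau>] by metis
  define \<delta> where "\<delta> = min 1 (\<delta>0/2)"
  have \<delta>: "0 < \<delta>" "\<delta> < \<delta>0" "\<delta> \<le> 1" using \<delta>0(1) by (auto simp: \<delta>_def)
  show ?thesis
  proof (rule that)
    show "test_function (convolve (mollifier \<delta>) c)"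
      using test_function_convolve[OF integrable_csupp[OF c(1) cs] mollifier_props(1)[OF \<delta>(1)] cs] .
    show "convolve (mollifier \<delta>) c x = 0" if "norm x > R + 1" for x
      by (rule convolve_zero_outside[OF c(2) mollifier_props(3)[OF \<delta>(1)]]) (use that \<delta> in auto)
  qed (use \<delta>0(2) \<delta> in auto)
qed

text \<open>A Lebesgue measurable function is almost everywhere a limit of continuous functions. These are clipped
to \<open>[- N, N]\<close>, multiplied by a continuous cut-off around the ball of radius \<open>R\<close>, and then replaced by
test functions at distance at most \<open>1 / (n + 1)\<close>, which accounts for the bounds \<open>N + 1\<close> and \<open>R + 2\<close>.\<close>

lemma measurable_approx_test:
  fixes v :: "real^'n::finite \<Rightarrow> real"
  assumes v: "v \<in> borel_measurable lebesgue" "\<And>x. \<bar>v x\<bar> \<le> N" "\<And>x. norm x > R \<Longrightarrow> v x = 0"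
  obtains t where "\<And>n. test_function (t n)" "\<And>n x. \<bar>t n x\<bar> \<le> N + 1"
    "\<And>n x. norm x > R + 2 \<Longrightarrow> t n x = 0" "AE x in lebesgue. (\<lambda>n. t n x) \<longlonglongrightarrow> v x"
proof -
  have N: "N \<ge> 0" using v(2)[of 0] by linarith
  obtain A g where A: "negligible A" and g: "\<And>n. continuous_on UNIV (g n)"
    "\<And>x. x \<notin> A \<Longrightarrow> (\<lambda>n. g n x) \<longlonglongrightarrow> v x"
    using lebesgue_measurable_imp_measurable_on[OF v(1), of UNIV] unfolding measurable_on_def by auto
  define \<kappa> where "\<kappa> x = max 0 (min 1 (R + 1 - norm x))" for x :: "real^'n"
  define c where "c n x = \<kappa> x * max (- N) (min N (g n x))" for n x
  have \<kappa>: "0 \<le> \<kappa> x" "\<kappa> x \<le> 1" "norm x > R + 1 \<Longrightarrow> \<kappa> x = 0" "norm x \<le> R \<Longrightarrow> \<kappa> x = 1" for x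
    by (auto simp: \<kappa>_def)
  have cc: "continuous_on UNIV (c n)" for n
    unfolding c_def \<kappa>_def by (intro continuous_intros g)
  have cb: "\<bar>c n x\<bar> \<le> N" for n x
  proof -
    have "\<kappa> x * \<bar>max (- N) (min N (g n x))\<bar> \<le> 1 * N" using \<kappa> N by (intro mult_mono) auto
    then show ?thesis using \<kappa>(1) by (simp add: c_def abs_mult)
  qed
  have clim: "(\<lambda>n. c n x) \<longlonglongrightarrow> v x" if "x \<notin> A" for x
  proof -
    have "(\<lambda>n. c n x) \<longlonglongrightarrow> \<kappa> x * max (- N) (min N (v x))"
      unfolding c_def by (intro tendsto_intros g that)
    moreover have "\<kappa> x * max (- N) (min N (v x)) = v x"
      using v(2)[of x] v(3)[of x] \<kappa>(4)[of x] by (cases "norm x \<le> R") auto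
    ultimately show ?thesis by simp
  qed
  have "\<exists>t. test_function t \<and> (\<forall>x. norm x > R + 1 + 1 \<longrightarrow> t x = 0) \<and> (\<forall>x. \<bar>t x - c n x\<bar> \<le> 1 / real (Suc n))" for n
    by (rule continuous_approx_test[OF cc[of n], of "R+1" "1 / real (Suc n)"]) (auto simp: c_def \<kappa>)
  then obtain t where t: "\<And>n. test_function (t n)" "\<And>n x. norm x > R + 1 + 1 \<Longrightarrow> t n x = 0"
    "\<And>n x. \<bar>t n x - c n x\<bar> \<le> 1 / real (Suc n)" by metis
  show ?thesis
  proof (rule that)
    show "\<bar>t n x\<bar> \<le> N + 1" for n x
    proof -
      have "1 / real (Suc n) \<le> 1" by simp
      then show ?thesis using t(3)[of n x] cb[of n x] by linarith
    qed
    have "(\<lambda>n. t n x) \<longlonglongrightarrow> v x" if "x \<notin> A" for x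
    proof -
      have "(\<lambda>n. t n x - c n x) \<longlonglongrightarrow> 0"
        by (rule tendsto_0_le[OF LIMSEQ_Suc[OF lim_1_over_n[where 'a=real]], where K=1]) (use t(3) in auto)
      from tendsto_add[OF this clim[OF that]] show ?thesis by simp
    qed
    then have "{x. \<not> ((\<lambda>n. t n x) \<longlonglongrightarrow> v x)} \<subseteq> A" by auto
    then show "AE x in lebesgue. (\<lambda>n. t n x) \<longlonglongrightarrow> v x"
      using A by (intro AE_I'[of A]) (auto simp: negligible_iff_null_sets)
  qed (use t in auto)
qed

text \<open>Test functions approximating \<open>sgn g\<close> on a ball show that the integral of \<open>\<bar>g\<bar>\<close> over that ball is
\<open>0\<close>.\<close>

lemma fundamental_lemma:
  fixes g :: "real^'n::finite \<Rightarrow> real"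
  assumes g: "locally_integrable g" and 0: "\<And>\<phi>. test_function \<phi> \<Longrightarrow> (LINT x|lebesgue. \<phi> x * g x) = 0"
  shows "AE x in lebesgue. g x = 0"
proof -
  have gm: "g \<in> borel_measurable lebesgue" using g locally_integrable_measurable by blast
  have gi: "integrable lebesgue (\<lambda>x. indicator (cball 0 R) x * g x)" for R
    using g by (auto simp: locally_integrable_ball set_integrable_def)
  have "AE x in lebesgue. indicator (cball 0 (real k)) x * \<bar>g x\<bar> = 0" for k
  proof -
    define v where "v x = indicator (cball 0 (real k)) x * sgn (g x)" for x
    have vm: "v \<in> borel_measurable lebesgue" unfolding v_def using gm by (intro borel_measurable_times borel_measurable_indicator) auto
    obtain t where t: "\<And>n. test_function (t n)" "\<And>n x. \<bar>t n x\<bar> \<le> 1 + 1"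
      "\<And>n x. norm x > real k + 2 \<Longrightarrow> t n x = 0" "AE x in lebesgue. (\<lambda>n. t n x) \<longlonglongrightarrow> v x"
      by (rule measurable_approx_test[OF vm, of 1 "real k"]) (auto simp: v_def indicator_def sgn_real_def)
    have "(\<lambda>n. LINT x|lebesgue. t n x * g x) \<longlonglongrightarrow> (LINT x|lebesgue. v x * g x)"
    proof (rule integral_dominated_convergence[where w="\<lambda>x. 2 * \<bar>indicator (cball 0 (real k + 2)) x * g x\<bar>"])
      show "(\<lambda>x. t n x * g x) \<in> borel_measurable lebesgue" for n
        using test_functionD(3)[OF t(1)] gm continuous_imp_measurable_lebesgue by (intro borel_measurable_times) auto
      show "AE x in lebesgue. (\<lambda>n. t n x * g x) \<longlonglongrightarrow> v x * g x"
        using t(4) by eventually_elim (intro tendsto_intros)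
      show "AE x in lebesgue. norm (t n x * g x) \<le> 2 * \<bar>indicator (cball 0 (real k + 2)) x * g x\<bar>" for n
        using t(2)[of n] t(3)[where n=n] by (intro AE_I2) (auto simp: indicator_def abs_mult not_le intro!: mult_right_mono)
    qed (use vm gm gi in auto)
    then have "(LINT x|lebesgue. v x * g x) = 0"
      by (simp add: 0[OF t(1)] LIMSEQ_const_iff)
    moreover have v: "v x * g x = indicator (cball 0 (real k)) x * \<bar>g x\<bar>" for x
      by (auto simp: v_def indicator_def abs_sgn mult.commute)
    moreover have "integrable lebesgue (\<lambda>x. indicator (cball 0 (real k)) x * \<bar>g x\<bar>)"
      using integrable_abs[OF gi[of "real k"]] by (simp add: abs_mult)
    ultimately show ?thesis
      using integral_nonneg_eq_0_iff_AE[of lebesgue "\<lambda>x. indicator (cball 0 (real k)) x * \<bar>g x\<bar>"] by simp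
  qed
  then have "AE x in lebesgue. \<forall>k. indicator (cball 0 (real k)) x * \<bar>g x\<bar> = 0"
    unfolding AE_all_countable by blast
  then show ?thesis
  proof eventually_elim
    case (elim x)
    obtain k where "norm x \<le> real k" using real_arch_simple by blast
    then show ?case using elim[rule_format, of k] by simp
  qed
qed

lemma weak_grad_unique:
  assumes "has_weak_grad u g" "has_weak_grad u h"
  shows "AE x in lebesgue. g x = h x"
proof -
  have "AE x in lebesgue. g x $ i - h x $ i = 0" for i
  proof (rule fundamental_lemma)
    have l: "locally_integrable g" "locally_integrable h" using assms by (auto simp: has_weak_grad_def)
    show "locally_integrable (\<lambda>x. g x $ i - h x $ i)"
      using locally_integrable_nth[OF l(1)] locally_integrable_nth[OF l(2)]
      by (auto simp: locally_integrable_def set_integrable_def right_diff_distrib)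
    fix \<phi> :: "real^'a \<Rightarrow> real" assume \<phi>: "test_function \<phi>"
    have "integrable lebesgue (\<lambda>x. \<phi> x * g x $ i)" "integrable lebesgue (\<lambda>x. \<phi> x * h x $ i)"
      using integrable_local_mult[OF locally_integrable_nth[OF l(1)] test_functionD(3,2)[OF \<phi>]]
        integrable_local_mult[OF locally_integrable_nth[OF l(2)] test_functionD(3,2)[OF \<phi>]] by auto
    moreover have "(LINT x|lebesgue. \<phi> x * g x $ i) = (LINT x|lebesgue. \<phi> x * h x $ i)"
      using assms \<phi> by (auto simp: has_weak_grad_iff)
    ultimately show "(LINT x|lebesgue. \<phi> x * (g x $ i - h x $ i)) = 0"
      by (simp add: right_diff_distrib)
  qed
  then have "AE x in lebesgue. \<forall>i. g x $ i - h x $ i = 0" by (simp add: AE_all_countable)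
  then show ?thesis by eventually_elim (simp add: vec_eq_iff)
qed

section \<open>Square integrability with respect to a positive weight\<close>

definition sqint :: "(real^'n::finite \<Rightarrow> real) \<Rightarrow> (real^'n \<Rightarrow> 'b::euclidean_space) \<Rightarrow> bool" where
  "sqint w U \<longleftrightarrow> U \<in> borel_measurable lebesgue \<and> integrable lebesgue (\<lambda>x. (norm (U x))\<^sup>2 * w x)"

definition wnorm :: "(real^'n::finite \<Rightarrow> real) \<Rightarrow> (real^'n \<Rightarrow> 'b::euclidean_space) \<Rightarrow> real" where
  "wnorm w U = sqrt (LINT x|lebesgue. (norm (U x))\<^sup>2 * w x)"

text \<open>A continuous positive weight is bounded above and below on every ball. So it does not affect local
properties, and functions with bounded support can be approximated as if the weight were \<open>1\<close>.\<close>

locale weight =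
  fixes w :: "real^'n::finite \<Rightarrow> real"
  assumes w_cont: "continuous_on UNIV w" and w_pos: "\<And>x. w x > 0"
begin

lemma w_nonneg: "w x \<ge> 0" using w_pos[of x] by simp

lemma w_meas: "w \<in> borel_measurable lebesgue"
  using w_cont continuous_imp_measurable_lebesgue by blast

lemma wnorm_nonneg: "wnorm w U \<ge> 0"
  by (simp add: wnorm_def w_nonneg)

lemma wnorm_square: "(wnorm w U)\<^sup>2 = (LINT x|lebesgue. (norm (U x))\<^sup>2 * w x)"
  by (simp add: wnorm_def w_nonneg)

lemma sqint_dominate:
  assumes U: "sqint w U" and V: "V \<in> borel_measurable lebesgue" "\<And>x. norm (V x) \<le> B * norm (U x)" and B: "B \<ge> 0"
  shows "sqint w V" "wnorm w V \<le> B * wnorm w U"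
proof -
  have le: "(norm (V x))\<^sup>2 * w x \<le> B\<^sup>2 * ((norm (U x))\<^sup>2 * w x)" for x
  proof -
    have "(norm (V x))\<^sup>2 \<le> (B * norm (U x))\<^sup>2" using V(2) by (intro power_mono) auto
    from mult_right_mono[OF this w_nonneg[of x]] show ?thesis by (simp add: power_mult_distrib mult.assoc)
  qed
  have iU: "integrable lebesgue (\<lambda>x. B\<^sup>2 * ((norm (U x))\<^sup>2 * w x))" using U by (simp add: sqint_def)
  have iV: "integrable lebesgue (\<lambda>x. (norm (V x))\<^sup>2 * w x)"
  proof (rule Bochner_Integration.integrable_bound[OF iU])
    show "(\<lambda>x. (norm (V x))\<^sup>2 * w x) \<in> borel_measurable lebesgue" using V(1) w_meas by measurable
  qed (use le w_nonneg in \<open>auto simp: abs_mult\<close>)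
  then show "sqint w V" using V(1) by (simp add: sqint_def)
  have "(wnorm w V)\<^sup>2 \<le> (LINT x|lebesgue. B\<^sup>2 * ((norm (U x))\<^sup>2 * w x))"
    unfolding wnorm_square using iU iV le by (intro integral_mono) auto
  also have "\<dots> = (B * wnorm w U)\<^sup>2" by (simp add: wnorm_square power_mult_distrib)
  finally show "wnorm w V \<le> B * wnorm w U"
    by (rule power2_le_imp_le) (simp add: B wnorm_nonneg)
qed

lemma sqint_cong_AE:
  assumes "sqint w U" "V \<in> borel_measurable lebesgue" "AE x in lebesgue. U x = V x"
  shows "sqint w V"
proof -
  have "integrable lebesgue (\<lambda>x. (norm (U x))\<^sup>2 * w x) \<longleftrightarrow> integrable lebesgue (\<lambda>x. (norm (V x))\<^sup>2 * w x)"
  proof (rule integrable_cong_AE)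
    show "AE x in lebesgue. (norm (U x))\<^sup>2 * w x = (norm (V x))\<^sup>2 * w x"
      using assms(3) by eventually_elim simp
    have [measurable]: "U \<in> borel_measurable lebesgue" "V \<in> borel_measurable lebesgue" "w \<in> borel_measurable lebesgue"
      using assms w_meas by (auto simp: sqint_def)
    show "(\<lambda>x. (norm (U x))\<^sup>2 * w x) \<in> borel_measurable lebesgue" "(\<lambda>x. (norm (V x))\<^sup>2 * w x) \<in> borel_measurable lebesgue"
      by measurable
  qed
  then show ?thesis using assms by (simp add: sqint_def)
qed

lemma sqint_scale: "sqint w U \<Longrightarrow> sqint w (\<lambda>x. c *\<^sub>R U x)"
  by (rule sqint_dominate(1)[where B="\<bar>c\<bar>"]) (auto simp: sqint_def)

lemma sqint_add:
  assumes U: "sqint w U" and V: "sqint w V"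
  shows "sqint w (\<lambda>x. U x + V x)"
proof -
  have [measurable]: "U \<in> borel_measurable lebesgue" "V \<in> borel_measurable lebesgue" "w \<in> borel_measurable lebesgue"
    using assms w_meas by (auto simp: sqint_def)
  have "integrable lebesgue (\<lambda>x. 2 * ((norm (U x))\<^sup>2 * w x) + 2 * ((norm (V x))\<^sup>2 * w x))"
    using assms by (simp add: sqint_def)
  then have "integrable lebesgue (\<lambda>x. (norm (U x + V x))\<^sup>2 * w x)"
  proof (rule Bochner_Integration.integrable_bound)
    have "(norm (U x + V x))\<^sup>2 * w x \<le> 2 * ((norm (U x))\<^sup>2 * w x) + 2 * ((norm (V x))\<^sup>2 * w x)" for x
    proof -
      have "(norm (U x + V x))\<^sup>2 \<le> (norm (U x) + norm (V x))\<^sup>2" by (intro power_mono norm_triangle_ineq) auto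
      also have "\<dots> \<le> 2 * (norm (U x))\<^sup>2 + 2 * (norm (V x))\<^sup>2"
        using sum_squares_bound[of "norm (U x)" "norm (V x)"] by (simp add: power2_sum)
      finally show ?thesis using mult_right_mono[OF _ w_nonneg[of x]] by (fastforce simp: algebra_simps)
    qed
    then show "AE x in lebesgue. norm ((norm (U x + V x))\<^sup>2 * w x) \<le> norm (2 * ((norm (U x))\<^sup>2 * w x) + 2 * ((norm (V x))\<^sup>2 * w x))"
      using w_nonneg by (intro AE_I2) (simp add: abs_mult)
  qed measurable
  then show ?thesis by (simp add: sqint_def)
qed

lemma sqint_diff: "sqint w U \<Longrightarrow> sqint w V \<Longrightarrow> sqint w (\<lambda>x. U x - V x)"
  using sqint_add[of U "\<lambda>x. (-1) *\<^sub>R V x"] sqint_scale[of V "-1"] by simp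

lemma sqint_zero: "sqint w (\<lambda>x. 0)" by (simp add: sqint_def)

lemma sqint_sum: "(\<And>i. i \<in> I \<Longrightarrow> sqint w (U i)) \<Longrightarrow> sqint w (\<lambda>x. \<Sum>i\<in>I. U i x)"
  by (induction I rule: infinite_finite_induct) (auto intro: sqint_add sqint_zero)

lemma sqint_inner:
  assumes U: "sqint w U" and V: "sqint w V"
  shows "integrable lebesgue (\<lambda>x. (U x \<bullet> V x) * w x)"
proof -
  have [measurable]: "U \<in> borel_measurable lebesgue" "V \<in> borel_measurable lebesgue" "w \<in> borel_measurable lebesgue"
    using assms w_meas by (auto simp: sqint_def)
  have "integrable lebesgue (\<lambda>x. (norm (U x))\<^sup>2 * w x + (norm (V x))\<^sup>2 * w x)"
    using assms by (simp add: sqint_def)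
  then show ?thesis
  proof (rule Bochner_Integration.integrable_bound)
    have "\<bar>U x \<bullet> V x\<bar> * w x \<le> (norm (U x))\<^sup>2 * w x + (norm (V x))\<^sup>2 * w x" for x
    proof -
      have "\<bar>U x \<bullet> V x\<bar> \<le> norm (U x) * norm (V x)" by (rule Cauchy_Schwarz_ineq2)
      also have "\<dots> \<le> (norm (U x))\<^sup>2 + (norm (V x))\<^sup>2"
        using sum_squares_bound[of "norm (U x)" "norm (V x)"]
          mult_nonneg_nonneg[OF norm_ge_zero norm_ge_zero, of "U x" "V x"] by linarith
      finally show ?thesis using mult_right_mono[OF _ w_nonneg[of x]] by (fastforce simp: algebra_simps)
    qed
    then show "AE x in lebesgue. norm ((U x \<bullet> V x) * w x) \<le> norm ((norm (U x))\<^sup>2 * w x + (norm (V x))\<^sup>2 * w x)"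
      using w_nonneg by (intro AE_I2) (simp add: abs_mult)
  qed measurable
qed

text \<open>Integrating \<open>2 * \<bar>U \<bullet> V\<bar> \<le> s * \<bar>U\<bar>\<^sup>2 + \<bar>V\<bar>\<^sup>2 / s\<close> and choosing \<open>s\<close> close to the quotient of the norms.\<close>

lemma weighted_Cauchy_Schwarz:
  assumes U: "sqint w U" and V: "sqint w V"
  shows "\<bar>LINT x|lebesgue. (U x \<bullet> V x) * w x\<bar> \<le> wnorm w U * wnorm w V"
proof -
  let ?A = "wnorm w U" and ?B = "wnorm w V"
  have A: "?A \<ge> 0" and B: "?B \<ge> 0" using wnorm_nonneg by auto
  have young: "\<bar>LINT x|lebesgue. (U x \<bullet> V x) * w x\<bar> \<le> (s * ?A\<^sup>2 + ?B\<^sup>2 / s) / 2" if s: "s > 0" for s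
  proof -
    have i: "integrable lebesgue (\<lambda>x. (s * ((norm (U x))\<^sup>2 * w x) + ((norm (V x))\<^sup>2 * w x) / s) / 2)"
      using assms by (simp add: sqint_def)
    have "norm (LINT x|lebesgue. (U x \<bullet> V x) * w x) \<le> (LINT x|lebesgue. (s * ((norm (U x))\<^sup>2 * w x) + ((norm (V x))\<^sup>2 * w x) / s) / 2)"
    proof (rule Bochner_Integration.integral_norm_bound_integral[OF sqint_inner[OF U V] i])
      fix x
      have "2 * (norm (U x) * norm (V x)) \<le> s * (norm (U x))\<^sup>2 + (norm (V x))\<^sup>2 / s"
      proof -
        have "0 \<le> (s * norm (U x) - norm (V x))\<^sup>2 / s" using s by simp
        also have "\<dots> = s * (norm (U x))\<^sup>2 + (norm (V x))\<^sup>2 / s - 2 * (norm (U x) * norm (V x))"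
          using s by (simp add: power2_eq_square field_simps)
        finally show ?thesis by simp
      qed
      moreover have "2 * p \<le> t \<Longrightarrow> q \<le> p \<Longrightarrow> q \<le> t / 2" for p q t :: real by linarith
      ultimately have "\<bar>U x \<bullet> V x\<bar> \<le> (s * (norm (U x))\<^sup>2 + (norm (V x))\<^sup>2 / s) / 2"
        using Cauchy_Schwarz_ineq2[of "U x" "V x"] by blast
      from mult_right_mono[OF this w_nonneg[of x]]
      show "norm ((U x \<bullet> V x) * w x) \<le> (s * ((norm (U x))\<^sup>2 * w x) + ((norm (V x))\<^sup>2 * w x) / s) / 2"
        using w_nonneg[of x] by (simp add: abs_mult algebra_simps add_divide_distrib)
    qed
    also have "\<dots> = (s * ?A\<^sup>2 + ?B\<^sup>2 / s) / 2"
      using assms unfolding wnorm_square by (simp add: sqint_def)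
    finally show ?thesis by simp
  qed
  show ?thesis
  proof (rule field_le_epsilon)
    fix e :: real assume e: "e > 0"
    define t where "t = e / (?A + ?B + 1)"
    have t: "t > 0" using e A B by (simp add: t_def)
    \<comment> \<open>The best parameter is \<open>?B / ?A\<close>; the shift by \<open>t\<close> covers vanishing norms.\<close>
    let ?s = "(?B + t) / (?A + t)"
    have s: "?s > 0" using t A B by simp
    have 1: "?s * ?A\<^sup>2 \<le> (?B + t) * ?A"
    proof -
      have "?A / (?A + t) \<le> 1" using t A by simp
      then have "(?B + t) * ?A * (?A / (?A + t)) \<le> (?B + t) * ?A * 1"
        using t A B by (intro mult_left_mono) auto
      then show ?thesis by (simp add: power2_eq_square mult_ac)
    qed
    have 2: "?B\<^sup>2 / ?s \<le> (?A + t) * ?B"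
    proof -
      have "?B / (?B + t) \<le> 1" using t B by simp
      then have "(?A + t) * ?B * (?B / (?B + t)) \<le> (?A + t) * ?B * 1"
        using t A B by (intro mult_left_mono) auto
      then show ?thesis by (simp add: power2_eq_square mult_ac)
    qed
    have "\<bar>LINT x|lebesgue. (U x \<bullet> V x) * w x\<bar> \<le> ((?B + t) * ?A + (?A + t) * ?B) / 2"
      by (rule order_trans[OF young[OF s] divide_right_mono[OF add_mono[OF 1 2]]]) simp
    also have "\<dots> = ?A * ?B + t * (?A + ?B) / 2" by (simp add: algebra_simps)
    also have "t * (?A + ?B) / 2 \<le> e"
    proof -
      have "t * (?A + ?B) \<le> t * (?A + ?B + 1)" using t by simp
      also have "\<dots> = e" using A B by (simp add: t_def)
      finally show ?thesis using e by linarith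
    qed
    finally show "\<bar>LINT x|lebesgue. (U x \<bullet> V x) * w x\<bar> \<le> ?A * ?B + e" by linarith
  qed
qed

lemma wnorm_triangle:
  assumes U: "sqint w U" and V: "sqint w V"
  shows "wnorm w (\<lambda>x. U x + V x) \<le> wnorm w U + wnorm w V"
proof (rule power2_le_imp_le)
  have e: "(norm (U x + V x))\<^sup>2 * w x = (norm (U x))\<^sup>2 * w x + 2 * ((U x \<bullet> V x) * w x) + (norm (V x))\<^sup>2 * w x" for x
    by (simp add: power2_norm_eq_inner inner_add_left inner_add_right inner_commute algebra_simps)
  have "(wnorm w (\<lambda>x. U x + V x))\<^sup>2 = (wnorm w U)\<^sup>2 + 2 * (LINT x|lebesgue. (U x \<bullet> V x) * w x) + (wnorm w V)\<^sup>2"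
    unfolding wnorm_square e using assms sqint_inner[OF U V] by (simp add: sqint_def)
  also have "\<dots> \<le> (wnorm w U + wnorm w V)\<^sup>2"
    using weighted_Cauchy_Schwarz[OF U V] by (simp add: power2_sum)
  finally show "(wnorm w (\<lambda>x. U x + V x))\<^sup>2 \<le> (wnorm w U + wnorm w V)\<^sup>2" .
qed (simp add: wnorm_nonneg)

lemma wnorm_scale: "wnorm w (\<lambda>x. c *\<^sub>R U x) = \<bar>c\<bar> * wnorm w U"
proof -
  have "(\<lambda>x. (norm (c *\<^sub>R U x))\<^sup>2 * w x) = (\<lambda>x. c\<^sup>2 * ((norm (U x))\<^sup>2 * w x))"
    by (simp add: power_mult_distrib mult.assoc)
  then show ?thesis by (simp add: wnorm_def real_sqrt_mult)
qed

lemma wnorm_minus_commute: "wnorm w (\<lambda>x. U x - V x) = wnorm w (\<lambda>x. V x - U x)"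
  by (simp add: wnorm_def norm_minus_commute)

lemma wnorm_diff_triangle:
  assumes U: "sqint w U" and V: "sqint w V" and Z: "sqint w Z"
  shows "wnorm w (\<lambda>x. U x - Z x) \<le> wnorm w (\<lambda>x. U x - V x) + wnorm w (\<lambda>x. V x - Z x)"
  using wnorm_triangle[OF sqint_diff[OF U V] sqint_diff[OF V Z]] by simp

lemma wnorm_sum:
  "(\<And>i. i \<in> I \<Longrightarrow> sqint w (U i)) \<Longrightarrow> wnorm w (\<lambda>x. \<Sum>i\<in>I. U i x) \<le> (\<Sum>i\<in>I. wnorm w (U i))"
proof (induction I rule: infinite_finite_induct)
  case (insert i I)
  have "wnorm w (\<lambda>x. U i x + (\<Sum>i\<in>I. U i x)) \<le> wnorm w (U i) + wnorm w (\<lambda>x. \<Sum>i\<in>I. U i x)"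
    by (rule wnorm_triangle) (auto intro!: insert sqint_sum)
  then show ?case using insert by auto
qed (auto simp: wnorm_def)

lemma sqint_nth: 
  assumes "sqint w (G :: real^'n \<Rightarrow> real^'m::finite)" shows "sqint w (\<lambda>x. G x $ i)"
proof -
  have "(\<lambda>x. G x $ i) \<in> borel_measurable lebesgue"
    using assms unfolding sqint_def
    by (auto intro!: borel_measurable_continuous_on[of "\<lambda>x. x $ i"] continuous_intros)
  then show ?thesis
    by (rule sqint_dominate(1)[OF assms, where B=1]) (auto simp: component_le_norm_cart)
qed

lemma sqint_axis: assumes "sqint w f" shows "sqint w (\<lambda>x. f x *\<^sub>R (c::'m::euclidean_space))"
  by (rule sqint_dominate(1)[OF assms, where B="norm c"]) (use assms in \<open>auto simp: sqint_def mult.commute\<close>)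

lemma vec_expand: "(G::real^'m::finite) = (\<Sum>i\<in>UNIV. (G $ i) *\<^sub>R axis i 1)"
  using basis_expansion[of G] by (simp add: scalar_mult_eq_scaleR)

lemma wnorm_vec_le:
  assumes "\<And>i. sqint w (\<lambda>x. G x $ i)"
  shows "wnorm w (G :: real^'n \<Rightarrow> real^'m::finite) \<le> (\<Sum>i\<in>UNIV. wnorm w (\<lambda>x. G x $ i))"
proof -
  have "wnorm w (\<lambda>x. \<Sum>i\<in>UNIV. (G x $ i) *\<^sub>R axis i (1::real)) \<le> (\<Sum>i\<in>UNIV. wnorm w (\<lambda>x. (G x $ i) *\<^sub>R axis i (1::real) :: real^'m))"
    by (intro wnorm_sum sqint_axis assms)
  also have "\<dots> = (\<Sum>i\<in>UNIV. wnorm w (\<lambda>x. G x $ i))"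
    by (intro sum.cong refl) (simp add: wnorm_def norm_axis_1)
  finally show ?thesis by (simp only: vec_expand[symmetric])
qed

lemma sqint_csupp:
  assumes "continuous_on UNIV U" "csupp U" shows "sqint w U"
proof -
  have "integrable lebesgue (\<lambda>x. (norm (U x))\<^sup>2 * w x)"
    using assms w_cont by (intro integrable_csupp continuous_intros) (auto intro: csupp_weaken)
  then show ?thesis using assms continuous_imp_measurable_lebesgue by (auto simp: sqint_def)
qed

lemma w_bounds_ball:
  obtains a b where "a > 0" "b > 0" "\<And>x. norm x \<le> R \<Longrightarrow> a \<le> w x" "\<And>x. norm x \<le> R \<Longrightarrow> w x \<le> b"
proof (cases "R \<ge> 0")
  case True
  have c: "compact (cball (0::real^'n) R)" "cball (0::real^'n) R \<noteq> {}" "continuous_on (cball 0 R) w"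
    using True continuous_on_subset[OF w_cont] by auto
  obtain p where "\<And>y. y \<in> cball 0 R \<Longrightarrow> w p \<le> w y" using continuous_attains_inf[OF c] by blast
  moreover obtain q where "\<And>y. y \<in> cball 0 R \<Longrightarrow> w y \<le> w q" using continuous_attains_sup[OF c] by blast
  ultimately show ?thesis using that[of "w p" "w q"] w_pos by auto
next
  case False
  then show ?thesis using that[of 1 1] by (smt (verit) norm_ge_zero)
qed

text \<open>On a ball the weight is bounded below, and \<open>\<bar>U\<bar> \<le> 1 + \<bar>U\<bar>\<^sup>2\<close>.\<close>

lemma sqint_locally_integrable:
  assumes "sqint w U" shows "locally_integrable U"
  unfolding locally_integrable_ball set_integrable_def
proof
  fix R
  obtain a b where a: "a > 0" "\<And>x. norm x \<le> R \<Longrightarrow> a \<le> w x" using w_bounds_ball[of R] by metis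
  have "integrable lebesgue (\<lambda>x. indicator (cball 0 R) x * 1 + (1/a) * ((norm (U x))\<^sup>2 * w x))"
  proof (rule Bochner_Integration.integrable_add)
    show "integrable lebesgue (\<lambda>x::real^'n. indicator (cball 0 R) x * (1::real))"
      using lmeasurable_iff_integrable[of "cball (0::real^'n) R"] lmeasurable_cball by simp
    show "integrable lebesgue (\<lambda>x. (1/a) * ((norm (U x))\<^sup>2 * w x))"
      using assms unfolding sqint_def by (intro integrable_mult_right) blast
  qed
  then show "integrable lebesgue (\<lambda>x. indicator (cball 0 R) x *\<^sub>R U x)"
  proof (rule Bochner_Integration.integrable_bound)
    show "(\<lambda>x. indicator (cball 0 R) x *\<^sub>R U x) \<in> borel_measurable lebesgue"
      using assms by (intro borel_measurable_scaleR borel_measurable_indicator) (auto simp: sqint_def)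
    show "AE x in lebesgue. norm (indicator (cball 0 R) x *\<^sub>R U x) \<le> norm (indicator (cball 0 R) x * 1 + (1/a) * ((norm (U x))\<^sup>2 * w x))"
    proof (rule AE_I2)
      fix x
      show "norm (indicator (cball 0 R) x *\<^sub>R U x) \<le> norm (indicator (cball 0 R) x * 1 + (1/a) * ((norm (U x))\<^sup>2 * w x))"
      proof (cases "norm x \<le> R")
        case True
        have "norm (U x) \<le> 1 + (norm (U x))\<^sup>2"
          using zero_le_power2[of "norm (U x) - 1"] norm_ge_zero[of "U x"] unfolding power2_diff one_power2 mult_1_right
          by linarith
        also have "(norm (U x))\<^sup>2 * a \<le> (norm (U x))\<^sup>2 * w x" using a(2)[OF True] by (intro mult_left_mono) auto
        then have "(norm (U x))\<^sup>2 \<le> (1/a) * ((norm (U x))\<^sup>2 * w x)" using a(1) by (simp add: field_simps)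
        finally show ?thesis using True a(1) w_nonneg[of x] by simp
      qed simp
    qed
  qed
qed

lemma wnorm_tendsto_0:
  assumes U: "\<And>n. U n \<in> borel_measurable lebesgue" "\<And>n x. norm (U n x) \<le> norm (G x)" "sqint w G"
    "AE x in lebesgue. (\<lambda>n. U n x) \<longlonglongrightarrow> 0"
  shows "(\<lambda>n::nat. wnorm w (U n)) \<longlonglongrightarrow> 0"
proof -
  have "(\<lambda>n. LINT x|lebesgue. (norm (U n x))\<^sup>2 * w x) \<longlonglongrightarrow> (LINT x|(lebesgue::(real^'n) measure). 0)"
  proof (rule integral_dominated_convergence[where w="\<lambda>x. (norm (G x))\<^sup>2 * w x"])
    show "(\<lambda>x. (norm (U n x))\<^sup>2 * w x) \<in> borel_measurable lebesgue" for n using U(1) w_meas by measurable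
    show "AE x in lebesgue. norm ((norm (U n x))\<^sup>2 * w x) \<le> (norm (G x))\<^sup>2 * w x" for n
      using U(2) w_nonneg by (intro AE_I2) (auto simp: abs_mult intro!: mult_right_mono power_mono)
    show "AE x in lebesgue. (\<lambda>n. (norm (U n x))\<^sup>2 * w x) \<longlonglongrightarrow> 0"
      using U(4)
    proof eventually_elim
      case (elim x)
      have "(\<lambda>n. (norm (U n x))\<^sup>2 * w x) \<longlonglongrightarrow> 0\<^sup>2 * w x"
        by (intro tendsto_intros tendsto_norm_zero elim)
      then show ?case by simp
    qed
  qed (use U(3) in \<open>auto simp: sqint_def\<close>)
  then have "(\<lambda>n. sqrt (LINT x|lebesgue. (norm (U n x))\<^sup>2 * w x)) \<longlonglongrightarrow> sqrt 0"
    by (intro tendsto_real_sqrt) simp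
  then show ?thesis by (simp add: wnorm_def)
qed

lemma test_dense_L2_bounded:
  fixes v :: "real^'n \<Rightarrow> real"
  assumes v: "v \<in> borel_measurable lebesgue" "\<And>x. \<bar>v x\<bar> \<le> N" "\<And>x. norm x > R \<Longrightarrow> v x = 0" and d: "d > 0"
  shows "\<exists>\<phi>. test_function \<phi> \<and> wnorm w (\<lambda>x. v x - \<phi> x) < d"
proof -
  obtain t where t: "\<And>n. test_function (t n)" "\<And>n x. \<bar>t n x\<bar> \<le> N + 1"
    "\<And>n x. norm x > R + 2 \<Longrightarrow> t n x = 0" "AE x in lebesgue. (\<lambda>n. t n x) \<longlonglongrightarrow> v x"
    using measurable_approx_test[OF v] by blast
  have N: "N \<ge> 0" using v(2)[of 0] by linarith
  have "(\<lambda>n. wnorm w (\<lambda>x. v x - t n x)) \<longlonglongrightarrow> 0"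
  proof (rule wnorm_tendsto_0[where G="\<lambda>x. indicator (cball 0 (R+2)) x * (2 * N + 1)"])
    show "(\<lambda>x. v x - t n x) \<in> borel_measurable lebesgue" for n
      using v(1) test_functionD(3)[OF t(1)] continuous_imp_measurable_lebesgue by (intro borel_measurable_diff) auto
    show "norm (v x - t n x) \<le> norm (indicator (cball 0 (R+2)) x * (2 * N + 1))" for n x
    proof (cases "norm x > R + 2")
      case True
      then show ?thesis using v(3)[of x] t(3)[of x n] by simp
    next
      case False
      then show ?thesis using v(2)[of x] t(2)[of n x] N by (auto simp: indicator_def)
    qed
    show "AE x in lebesgue. (\<lambda>n. v x - t n x) \<longlonglongrightarrow> 0"
      using t(4) by eventually_elim (rule tendsto_eq_intros | simp)+
    obtain b where b: "\<And>x. norm x \<le> R+2 \<Longrightarrow> w x \<le> b" using w_bounds_ball[of "R+2"] by metis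
    have ii: "integrable lebesgue (\<lambda>x::real^'n. indicator (cball 0 (R+2)) x * ((2*N+1)\<^sup>2 * b))"
      using lmeasurable_iff_integrable[of "cball (0::real^'n) (R+2)"] lmeasurable_cball by (intro integrable_mult_left) auto
    show "sqint w (\<lambda>x. indicator (cball 0 (R+2)) x * (2 * N + 1))"
      unfolding sqint_def
    proof
      show m: "(\<lambda>x::real^'n. indicator (cball 0 (R+2)) x * (2 * N + 1)) \<in> borel_measurable lebesgue"
        by (intro borel_measurable_times borel_measurable_indicator) auto
      show "integrable lebesgue (\<lambda>x. (norm (indicator (cball 0 (R+2)) x * (2 * N + 1)))\<^sup>2 * w x)"
      proof (rule Bochner_Integration.integrable_bound[OF ii])
        show "(\<lambda>x. (norm (indicator (cball 0 (R+2)) x * (2 * N + 1)))\<^sup>2 * w x) \<in> borel_measurable lebesgue"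
          using m w_meas by measurable
        show "AE x in lebesgue. norm ((norm (indicator (cball 0 (R+2)) x * (2 * N + 1)))\<^sup>2 * w x)
           \<le> norm (indicator (cball 0 (R+2)) x * ((2*N+1)\<^sup>2 * b))"
          using b w_nonneg N by (intro AE_I2) (auto simp: indicator_def abs_mult power_mult_distrib intro!: mult_left_mono order_trans[OF _ abs_ge_self])
      qed
    qed
  qed
  from eventually_happens'[OF sequentially_bot order_tendstoD(2)[OF this d]]
  obtain n where "wnorm w (\<lambda>x. v x - t n x) < d" by blast
  then show ?thesis using t(1) by blast
qed

text \<open>Truncating both the values and the domain of \<open>u\<close> reduces to the bounded case by dominated
convergence.\<close>

lemma test_dense_L2:
  fixes u :: "real^'n \<Rightarrow> real"
  assumes u: "sqint w u" and d: "d > 0"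
  obtains \<phi> where "test_function \<phi>" "wnorm w (\<lambda>x. u x - \<phi> x) < d"
proof -
  define v where "v n x = indicator (cball 0 (real n)) x * max (- real n) (min (real n) (u x))" for n x
  have um: "u \<in> borel_measurable lebesgue" using u by (simp add: sqint_def)
  have vm: "v n \<in> borel_measurable lebesgue" for n
    unfolding v_def using um by (intro borel_measurable_times borel_measurable_indicator borel_measurable_max borel_measurable_min) auto
  have "(\<lambda>n. wnorm w (\<lambda>x. u x - v n x)) \<longlonglongrightarrow> 0"
  proof (rule wnorm_tendsto_0[OF _ _ u])
    show "(\<lambda>x. u x - v n x) \<in> borel_measurable lebesgue" for n using um vm by auto
    show "norm (u x - v n x) \<le> norm (u x)" for n x by (auto simp: v_def indicator_def max_def min_def)
    have "(\<lambda>n. u x - v n x) \<longlonglongrightarrow> 0" for x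
    proof (rule tendsto_eventually)
      obtain M where M: "max (norm x) \<bar>u x\<bar> \<le> real M" using real_arch_simple by blast
      show "\<forall>\<^sub>F n in sequentially. u x - v n x = 0"
      proof (rule eventually_mono[OF eventually_ge_at_top[of M]])
        fix n assume "n \<ge> M"
        then have "norm x \<le> real n" "\<bar>u x\<bar> \<le> real n" using M by linarith+
        then show "u x - v n x = 0" by (simp add: v_def)
      qed
    qed
    then show "AE x in lebesgue. (\<lambda>n. u x - v n x) \<longlonglongrightarrow> 0" by simp
  qed
  from eventually_happens'[OF sequentially_bot order_tendstoD(2)[OF this half_gt_zero[OF d]]]
  obtain n where n: "wnorm w (\<lambda>x. u x - v n x) < d/2" by blast
  have "\<exists>\<phi>. test_function \<phi> \<and> wnorm w (\<lambda>x. v n x - \<phi> x) < d/2"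
    by (rule test_dense_L2_bounded[OF vm, of _ "real n" "real n"]) (use d in \<open>auto simp: v_def indicator_def\<close>)
  then obtain \<phi> where p: "test_function \<phi>" "wnorm w (\<lambda>x. v n x - \<phi> x) < d/2" by blast
  have "sqint w (v n)"
    by (rule sqint_dominate(1)[OF u vm, of _ 1]) (auto simp: v_def indicator_def max_def min_def)
  moreover have "sqint w \<phi>" using p(1) test_functionD sqint_csupp by blast
  ultimately have "wnorm w (\<lambda>x. u x - \<phi> x) < d"
    using wnorm_diff_triangle[OF u, of "v n" \<phi>] n p(2) by simp
  then show ?thesis using p(1) that by blast
qed

end

section \<open>Density of test functions in the weighted Sobolev space\<close>

interpretation unweighted: weight "\<lambda>_. 1" by standard auto

lemma sqint_csupp_integrable:
  fixes v :: "real^'n::finite \<Rightarrow> 'b::euclidean_space"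
  assumes "sqint (\<lambda>_. 1) v" "csupp v"
  shows "integrable lebesgue v"
proof -
  obtain R where R: "R > 0" "\<And>x. norm x > R \<Longrightarrow> v x = 0" using assms(2) csuppE by metis
  have "integrable lebesgue (\<lambda>x. indicator (cball 0 R) x *\<^sub>R v x)"
    using unweighted.sqint_locally_integrable[OF assms(1)] by (auto simp: locally_integrable_ball set_integrable_def)
  also have "(\<lambda>x. indicator (cball 0 R) x *\<^sub>R v x) = v"
    using R(2) by (force simp: indicator_def)
  finally show ?thesis .
qed

text \<open>Jensen's inequality for the probability density \<open>mollifier \<delta> (x - y)\<close> of \<open>y\<close>: the variance of \<open>v\<close> under
this density is nonnegative.\<close>

lemma mollify_jensen:
  assumes v: "integrable lebesgue v" "sqint (\<lambda>_. 1) v" and \<delta>: "\<delta> > 0"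
  shows "(convolve (mollifier \<delta>) v x)\<^sup>2 \<le> (LINT y|lebesgue. mollifier \<delta> (x - y) * (v y)\<^sup>2)"
    and "integrable lebesgue (\<lambda>y. mollifier \<delta> (x - y) * (v y)\<^sup>2)"
proof -
  note m = test_functionD(2,3)[OF mollifier_props(1)[OF \<delta>, where 'n='a]]
  have sq: "integrable lebesgue (\<lambda>y. (v y)\<^sup>2)" using v(2) by (simp add: sqint_def)
  have i1: "integrable lebesgue (\<lambda>y. mollifier \<delta> (x - y) * v y)" using convolve_integrable[OF v(1) m(2,1)] .
  show i2: "integrable lebesgue (\<lambda>y. mollifier \<delta> (x - y) * (v y)\<^sup>2)" using convolve_integrable[OF sq m(2,1)] .
  note i0 = mollifier_shift_integral[OF \<delta>, of x]
  let ?c = "convolve (mollifier \<delta>) v x"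
  have "0 \<le> (LINT y|lebesgue. mollifier \<delta> (x - y) * (v y - ?c)\<^sup>2)"
    by (intro Bochner_Integration.integral_nonneg mult_nonneg_nonneg mollifier_props(2)[OF \<delta>]) auto
  also have "(\<lambda>y. mollifier \<delta> (x - y) * (v y - ?c)\<^sup>2)
      = (\<lambda>y. mollifier \<delta> (x - y) * (v y)\<^sup>2 - 2 * ?c * (mollifier \<delta> (x - y) * v y) + ?c\<^sup>2 * mollifier \<delta> (x - y))"
    by (auto simp: power2_diff algebra_simps)
  also have "(LINT y|lebesgue. \<dots> y) = (LINT y|lebesgue. mollifier \<delta> (x - y) * (v y)\<^sup>2) - 2 * ?c * ?c + ?c\<^sup>2"
    using i0 i1 i2 by (simp add: convolve_def)
  finally show "?c\<^sup>2 \<le> (LINT y|lebesgue. mollifier \<delta> (x - y) * (v y)\<^sup>2)" by (simp add: power2_eq_square)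
qed

text \<open>Integrating Jensen's inequality over \<open>x\<close>. Tonelli's theorem is applied to a Borel representative of
\<open>v\<close>, because a Lebesgue measurable \<open>v\<close> need not be measurable for the product of Borel sets.\<close>

lemma mollify_L2_contraction:
  assumes v: "sqint (\<lambda>_. 1) v" "csupp v" and \<delta>: "\<delta> > 0"
  shows "wnorm (\<lambda>_. 1) (convolve (mollifier \<delta>) v) \<le> wnorm (\<lambda>_. 1) v"
proof -
  let ?m = "mollifier \<delta> :: real^'a \<Rightarrow> real"
  have vi: "integrable lebesgue v" using sqint_csupp_integrable v by blast
  note mt = mollifier_props(1)[OF \<delta>, where 'n='a]
  have ct: "test_function (convolve ?m v)" using test_function_convolve[OF vi mt v(2)] .
  have mb [measurable]: "?m \<in> borel_measurable borel"
    using test_functionD(3)[OF mt] borel_measurable_continuous_onI by blast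
  have m0: "?m x \<ge> 0" for x using mollifier_props(2)[OF \<delta>] .
  have sq: "integrable lebesgue (\<lambda>y. (v y)\<^sup>2)" using v(1) by (simp add: sqint_def)
  obtain v' where v' [measurable]: "v' \<in> borel_measurable lborel" and ae: "AE y in lborel. v y = v' y"
    using completion_ex_borel_measurable_real[of v lborel] v(1) by (auto simp: sqint_def)
  have one: "(\<integral>\<^sup>+x. ennreal (?m (x - y)) \<partial>lborel) = 1" for y
  proof -
    have b: "(\<lambda>x. ?m (x - y)) = (\<lambda>x. ?m (y - x))" using mollifier_props(5)[OF \<delta>] by (metis minus_diff_eq)
    have "(\<integral>\<^sup>+x. ennreal (?m (x - y)) \<partial>lborel) = (\<integral>\<^sup>+x. ennreal (?m (y - x)) \<partial>lebesgue)"
      by (simp add: nn_integral_completion b fun_cong[OF b])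
    also have "\<dots> = ennreal (LINT x|lebesgue. ?m (y - x))"
      by (rule nn_integral_eq_integral) (use mollifier_shift_integral[OF \<delta>] m0 in auto)
    finally show ?thesis using mollifier_shift_integral[OF \<delta>, of y] by simp
  qed
  have "(\<integral>\<^sup>+x. ennreal ((convolve ?m v x)\<^sup>2) \<partial>lborel) \<le> (\<integral>\<^sup>+x. \<integral>\<^sup>+y. ennreal (?m (x - y)) * ennreal ((v' y)\<^sup>2) \<partial>lborel \<partial>lborel)"
  proof (rule nn_integral_mono)
    fix x
    have "ennreal ((convolve ?m v x)\<^sup>2) \<le> ennreal (LINT y|lebesgue. ?m (x - y) * (v y)\<^sup>2)"
      using mollify_jensen(1)[OF vi v(1) \<delta>] by (rule ennreal_leI)
    also have "\<dots> = (\<integral>\<^sup>+y. ennreal (?m (x - y) * (v y)\<^sup>2) \<partial>lebesgue)"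
      by (rule nn_integral_eq_integral[symmetric]) (use mollify_jensen(2)[OF vi v(1) \<delta>] m0 in auto)
    also have "\<dots> = (\<integral>\<^sup>+y. ennreal (?m (x - y) * (v y)\<^sup>2) \<partial>lborel)" by (rule nn_integral_completion)
    also have "\<dots> = (\<integral>\<^sup>+y. ennreal (?m (x - y)) * ennreal ((v' y)\<^sup>2) \<partial>lborel)"
      by (rule nn_integral_cong_AE) (use ae in \<open>eventually_elim, simp add: ennreal_mult m0\<close>)
    finally show "ennreal ((convolve ?m v x)\<^sup>2) \<le> (\<integral>\<^sup>+y. ennreal (?m (x - y)) * ennreal ((v' y)\<^sup>2) \<partial>lborel)" .
  qed
  also have "\<dots> = (\<integral>\<^sup>+y. \<integral>\<^sup>+x. ennreal (?m (x - y)) * ennreal ((v' y)\<^sup>2) \<partial>lborel \<partial>lborel)"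
    by (rule lborel_pair.Fubini'[symmetric]) measurable
  also have "\<dots> = (\<integral>\<^sup>+y. ennreal ((v' y)\<^sup>2) \<partial>lborel)"
    by (intro nn_integral_cong) (simp add: nn_integral_multc one)
  also have "\<dots> = (\<integral>\<^sup>+y. ennreal ((v y)\<^sup>2) \<partial>lborel)"
    by (rule nn_integral_cong_AE) (use ae in \<open>eventually_elim, simp\<close>)
  finally have le: "(\<integral>\<^sup>+x. ennreal ((convolve ?m v x)\<^sup>2) \<partial>lebesgue) \<le> (\<integral>\<^sup>+y. ennreal ((v y)\<^sup>2) \<partial>lebesgue)"
    by (simp add: nn_integral_completion)
  have "integrable lebesgue (\<lambda>x. (convolve ?m v x)\<^sup>2)"
    using unweighted.sqint_csupp[OF test_functionD(3,2)[OF ct]] by (simp add: sqint_def)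
  then have "ennreal (LINT x|lebesgue. (convolve ?m v x)\<^sup>2) \<le> ennreal (LINT x|lebesgue. (v x)\<^sup>2)"
    using le sq by (simp add: nn_integral_eq_integral)
  then have "(LINT x|lebesgue. (convolve ?m v x)\<^sup>2) \<le> (LINT x|lebesgue. (v x)\<^sup>2)"
    by (subst (asm) ennreal_le_iff) auto
  then show ?thesis by (simp add: wnorm_def)
qed

text \<open>Mollification converges uniformly on a test function close to \<open>v\<close>, and the remaining part of \<open>v\<close>
stays small by \<open>mollify_L2_contraction\<close>.\<close>

lemma mollify_L2_tendsto:
  assumes v: "sqint (\<lambda>_. 1) v" "csupp v" and \<tau>: "\<tau> > 0"
  obtains \<delta>0 where "\<delta>0 > 0" 
    "\<And>\<delta>. 0 < \<delta> \<Longrightarrow> \<delta> < \<delta>0 \<Longrightarrow> wnorm (\<lambda>_. 1) (\<lambda>x. convolve (mollifier \<delta>) v x - v x) < \<tau>"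
proof -
  obtain c where c: "test_function c" "wnorm (\<lambda>_. 1) (\<lambda>x. v x - c x) < \<tau>/4"
    using unweighted.test_dense_L2[OF v(1), of "\<tau>/4"] \<tau> by auto
  obtain R where R: "R > 0" "\<And>x. norm x > R \<Longrightarrow> c x = 0" using test_functionD(2)[OF c(1)] csuppE by metis
  define J where "J = (indicator (cball 0 (R+1)) :: real^'a \<Rightarrow> real)"
  have J: "sqint (\<lambda>_. 1) J"
    unfolding sqint_def
  proof
    show "J \<in> borel_measurable lebesgue" unfolding J_def by (intro borel_measurable_indicator) auto
    have "(\<lambda>x. (norm (J x))\<^sup>2 * 1) = J" by (auto simp: J_def indicator_def)
    then show "integrable lebesgue (\<lambda>x. (norm (J x))\<^sup>2 * 1)"
      unfolding J_def using lmeasurable_iff_integrable[of "cball (0::real^'a) (R+1)"] lmeasurable_cball by metis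
  qed
  \<comment> \<open>A uniform error \<open>s\<close> on the ball of radius \<open>R + 1\<close> costs \<open>s\<close> times the norm of its indicator \<open>J\<close>.\<close>
  define s where "s = \<tau> / (4 * (wnorm (\<lambda>_. 1) J + 1))"
  have J0: "wnorm (\<lambda>_. 1) J \<ge> 0" by (rule unweighted.wnorm_nonneg)
  have s: "s > 0" using \<tau> J0 by (simp add: s_def)
  obtain \<delta>1 where \<delta>1: "\<delta>1 > 0" "\<And>\<delta> x. 0 < \<delta> \<Longrightarrow> \<delta> < \<delta>1 \<Longrightarrow> \<bar>convolve (mollifier \<delta>) c x - c x\<bar> \<le> s"
    using convolve_mollifier_uniform[OF test_functionD(3,2)[OF c(1)] s] by metis
  show ?thesis
  proof (rule that[of "min 1 \<delta>1"])
    fix \<delta> :: real assume \<delta>: "0 < \<delta>" "\<delta> < min 1 \<delta>1"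
    let ?m = "mollifier \<delta> :: real^'a \<Rightarrow> real"
    note mt = mollifier_props(1)[OF \<delta>(1), where 'n='a]
    have sc: "sqint (\<lambda>_. 1) c" using unweighted.sqint_csupp[OF test_functionD(3,2)[OF c(1)]] .
    have vi: "integrable lebesgue v" and ci: "integrable lebesgue c"
      using sqint_csupp_integrable[OF v] sqint_csupp_integrable[OF sc test_functionD(2)[OF c(1)]] by auto
    define rr where "rr x = v x - c x" for x
    have rs: "sqint (\<lambda>_. 1) rr" unfolding rr_def using unweighted.sqint_diff[OF v(1) sc] .
    have rc: "csupp rr" unfolding rr_def by (rule csupp_weaken2[OF v(2) test_functionD(2)[OF c(1)]]) auto
    have tr: "test_function (convolve ?m rr)" "test_function (convolve ?m c)" 
      using test_function_convolve[OF sqint_csupp_integrable[OF rs rc] mt rc] test_function_convolve[OF ci mt test_functionD(2)[OF c(1)]] by auto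
    have lin: "convolve ?m v x = convolve ?m rr x + convolve ?m c x" for x
      unfolding rr_def convolve_def right_diff_distrib
      using convolve_integrable[OF vi test_functionD(3,2)[OF mt]] convolve_integrable[OF ci test_functionD(3,2)[OF mt]] by simp
    have e: "(\<lambda>x. convolve ?m v x - v x) = (\<lambda>x. (convolve ?m rr x + (convolve ?m c x - c x)) + (-1) *\<^sub>R rr x)"
      by (auto simp: lin rr_def)
    have s1: "sqint (\<lambda>_. 1) (convolve ?m rr)" using unweighted.sqint_csupp[OF test_functionD(3,2)[OF tr(1)]] .
    have s2: "sqint (\<lambda>_. 1) (\<lambda>x. convolve ?m c x - c x)"
      using unweighted.sqint_diff[OF unweighted.sqint_csupp[OF test_functionD(3,2)[OF tr(2)]] sc] .
    have "wnorm (\<lambda>_. 1) (\<lambda>x. convolve ?m c x - c x) \<le> s * wnorm (\<lambda>_. 1) J"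
    proof (rule unweighted.sqint_dominate(2)[OF J])
      show "(\<lambda>x. convolve ?m c x - c x) \<in> borel_measurable lebesgue" using s2 by (simp add: sqint_def)
      show "norm (convolve ?m c x - c x) \<le> s * norm (J x)" for x
      proof (cases "norm x > R + 1")
        case True
        have "convolve ?m c x = 0"
          by (rule convolve_zero_outside[OF R(2) mollifier_props(3)[OF \<delta>(1)]]) (use True \<delta> in auto)
        then show ?thesis using R(2)[of x] True s by simp
      next
        case False
        then show ?thesis using \<delta>1(2)[of \<delta> x] \<delta> by (simp add: J_def)
      qed
    qed (use s in auto)
    also have "s * wnorm (\<lambda>_. 1) J \<le> \<tau> / 4"
      using J0 \<tau> by (simp add: s_def field_simps)
    finally have b2: "wnorm (\<lambda>_. 1) (\<lambda>x. convolve ?m c x - c x) \<le> \<tau>/4" .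
    have b1: "wnorm (\<lambda>_. 1) (convolve ?m rr) \<le> wnorm (\<lambda>_. 1) rr" using mollify_L2_contraction[OF rs rc \<delta>(1)] .
    have b3: "wnorm (\<lambda>_. 1) rr < \<tau>/4" using c(2) by (simp add: rr_def[abs_def])
    have "wnorm (\<lambda>_. 1) (\<lambda>x. (convolve ?m rr x + (convolve ?m c x - c x)) + (-1) *\<^sub>R rr x)
       \<le> wnorm (\<lambda>_. 1) (\<lambda>x. convolve ?m rr x + (convolve ?m c x - c x)) + wnorm (\<lambda>_. 1) (\<lambda>x. (-1) *\<^sub>R rr x)"
      by (intro unweighted.wnorm_triangle unweighted.sqint_add unweighted.sqint_scale s1 s2 rs)
    also have "\<dots> \<le> wnorm (\<lambda>_. 1) (convolve ?m rr) + wnorm (\<lambda>_. 1) (\<lambda>x. convolve ?m c x - c x) + wnorm (\<lambda>_. 1) rr"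
      using unweighted.wnorm_triangle[OF s1 s2] unweighted.wnorm_scale[of "-1" rr] by simp
    finally show "wnorm (\<lambda>_. 1) (\<lambda>x. convolve ?m v x - v x) < \<tau>"
      unfolding e using b1 b2 b3 \<tau> by linarith
  qed (use \<delta>1 in auto)
qed

text \<open>For fixed \<open>x\<close> the function \<open>\<phi> (x - y)\<close> of \<open>y\<close> is a test function, so the definition of the weak
gradient moves the derivative onto \<open>v\<close>.\<close>

lemma partial_convolve_weak:
  assumes vg: "has_weak_grad v g" and v: "integrable lebesgue v" and \<phi>: "test_function \<phi>"
  shows "partial i (convolve \<phi> v) x = convolve \<phi> (\<lambda>y. g y $ i) x"
proof -
  define \<psi> where "\<psi> y = \<phi> (x + (-1) *\<^sub>R y)" for y
  have \<psi>: "test_function \<psi>" unfolding \<psi>_def using test_function_affine[OF \<phi>, of "-1" x] by simp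
  have d: "partial i \<psi> y = - partial i \<phi> (x - y)" for y
    using partial_affine(1)[OF test_functionD(4)[OF \<phi>], of i x "-1" y] by (simp add: \<psi>_def[abs_def])
  have "partial i (convolve \<phi> v) x = (LINT y|lebesgue. partial i \<phi> (x - y) * v y)"
    by (simp add: partial_convolve[OF v \<phi>] convolve_def)
  also have "\<dots> = - (LINT y|lebesgue. v y * partial i \<psi> y)" by (simp add: d mult.commute)
  also have "\<dots> = (LINT y|lebesgue. \<psi> y * g y $ i)" using vg \<psi> by (simp add: has_weak_grad_iff)
  finally show ?thesis by (simp add: \<psi>_def convolve_def)
qed

lemma locally_integrable_mult_continuous:
  assumes "locally_integrable g" "continuous_on UNIV k"
  shows "locally_integrable (\<lambda>x. k x *\<^sub>R g x)"
  unfolding locally_integrable_ball set_integrable_def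
proof
  fix R
  have "compact (k ` cball 0 R)"
    by (intro compact_continuous_image compact_cball continuous_on_subset[OF assms(2)]) auto
  then obtain B where B: "B > 0" "\<And>y. y \<in> k ` cball 0 R \<Longrightarrow> norm y \<le> B"
    using compact_imp_bounded bounded_pos by metis
  have "integrable lebesgue (\<lambda>x. B * norm (indicator (cball 0 R) x *\<^sub>R g x))"
    using assms(1) by (intro integrable_mult_right integrable_norm) (auto simp: locally_integrable_ball set_integrable_def)
  then show "integrable lebesgue (\<lambda>x. indicator (cball 0 R) x *\<^sub>R k x *\<^sub>R g x)"
  proof (rule Bochner_Integration.integrable_bound)
    show "(\<lambda>x. indicator (cball 0 R) x *\<^sub>R k x *\<^sub>R g x) \<in> borel_measurable lebesgue"
      using assms by (intro borel_measurable_scaleR borel_measurable_indicator locally_integrable_measurable continuous_imp_measurable_lebesgue) auto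
    show "AE x in lebesgue. norm (indicator (cball 0 R) x *\<^sub>R k x *\<^sub>R g x) \<le> norm (B * norm (indicator (cball 0 R) x *\<^sub>R g x))"
      using B by (intro AE_I2) (auto simp: indicator_def abs_mult intro!: mult_right_mono)
  qed
qed

lemma locally_integrable_add:
  "locally_integrable f \<Longrightarrow> locally_integrable g \<Longrightarrow> locally_integrable (\<lambda>x. f x + g x)"
  by (auto simp: locally_integrable_def set_integrable_def scaleR_add_right)

text \<open>The defining identity for \<open>u\<close> is applied to the test function \<open>k * \<phi>\<close>.\<close>

lemma has_weak_grad_mult:
  assumes ug: "has_weak_grad u g" and k: "smooth k"
  shows "has_weak_grad (\<lambda>x. k x * u x) (\<lambda>x. k x *\<^sub>R g x + u x *\<^sub>R grad k x)"
proof -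
  have l: "locally_integrable u" "locally_integrable g" using ug by (auto simp: has_weak_grad_def)
  have kc: "continuous_on UNIV k" "\<And>i. continuous_on UNIV (partial i k)" "\<And>x. k differentiable (at x)"
    using k Ck_continuous[of 0] smooth_partial[OF k] Ck_SucD(1)[of 0 k] by (auto simp: smooth_def simp del: Ck.simps)
  have comp: "locally_integrable (\<lambda>x. u x *\<^sub>R grad k x)"
    unfolding locally_integrable_ball set_integrable_def
  proof
    fix R
    have "integrable lebesgue (\<lambda>x. indicator (cball 0 R) x *\<^sub>R (norm (grad k x) *\<^sub>R u x))"
      using locally_integrable_mult_continuous[OF l(1) continuous_on_norm[OF grad_continuous[of k]]] k
      unfolding locally_integrable_ball set_integrable_def smooth_def by blast
    then show "integrable lebesgue (\<lambda>x. indicator (cball 0 R) x *\<^sub>R u x *\<^sub>R grad k x)"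
    proof (rule Bochner_Integration.integrable_bound)
      show "(\<lambda>x. indicator (cball 0 R) x *\<^sub>R u x *\<^sub>R grad k x) \<in> borel_measurable lebesgue"
        using locally_integrable_measurable[OF l(1)] continuous_imp_measurable_lebesgue[OF grad_continuous[of k]] k
        by (intro borel_measurable_scaleR borel_measurable_indicator) (simp_all only: smooth_def, auto)
    qed (auto simp: abs_mult mult_ac)
  qed
  show ?thesis
    unfolding has_weak_grad_iff
  proof (intro conjI allI impI)
    show "locally_integrable (\<lambda>x. k x * u x)" using locally_integrable_mult_continuous[OF l(1) kc(1)] by simp
    show "locally_integrable (\<lambda>x. k x *\<^sub>R g x + u x *\<^sub>R grad k x)"
      by (intro locally_integrable_add locally_integrable_mult_continuous l kc comp)
    fix \<phi> :: "real^'a \<Rightarrow> real" and i assume \<phi>: "test_function \<phi>"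
    have t: "test_function (\<lambda>x. k x * \<phi> x)" using test_function_mult[OF \<phi> k] .
    have p: "partial i (\<lambda>x. k x * \<phi> x) x = k x * partial i \<phi> x + partial i k x * \<phi> x" for x
      using partial_mult[OF kc(3) test_functionD(4)[OF \<phi>]] .
    note \<phi>c = test_functionD(2,3)[OF \<phi>]
    note p\<phi> = test_functionD(2,3)[OF test_function_partial[OF \<phi>, of i]]
    have i1: "integrable lebesgue (\<lambda>x. u x *\<^sub>R (k x * partial i \<phi> x))"
      using p\<phi> kc by (intro integrable_local_multR l continuous_intros) (auto intro: csupp_weaken)
    have i2: "integrable lebesgue (\<lambda>x. u x *\<^sub>R (partial i k x * \<phi> x))"
      using \<phi>c kc by (intro integrable_local_multR l continuous_intros) (auto intro: csupp_weaken)
    have i3: "integrable lebesgue (\<lambda>x. (k x * \<phi> x) *\<^sub>R (g x $ i))"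
      using \<phi>c kc by (intro integrable_local_mult locally_integrable_nth l continuous_intros) (auto intro: csupp_weaken)
    have "(LINT x|lebesgue. u x * partial i (\<lambda>x. k x * \<phi> x) x) = - (LINT x|lebesgue. (k x * \<phi> x) * g x $ i)"
      using ug t unfolding has_weak_grad_iff by blast
    then have "(LINT x|lebesgue. u x * (k x * partial i \<phi> x)) + (LINT x|lebesgue. u x * (partial i k x * \<phi> x))
        = - (LINT x|lebesgue. (k x * \<phi> x) * g x $ i)"
      using i1 i2 by (simp add: p distrib_left)
    moreover have "(LINT x|lebesgue. \<phi> x * (k x *\<^sub>R g x + u x *\<^sub>R grad k x) $ i)
        = (LINT x|lebesgue. (k x * \<phi> x) * g x $ i + u x * (partial i k x * \<phi> x))"
      by (intro Bochner_Integration.integral_cong refl) (simp add: grad_def algebra_simps)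
    moreover have "(LINT x|lebesgue. (k x * \<phi> x) * g x $ i + u x * (partial i k x * \<phi> x))
       = (LINT x|lebesgue. (k x * \<phi> x) * g x $ i) + (LINT x|lebesgue. u x * (partial i k x * \<phi> x))"
      using i2 i3 by simp
    ultimately show "(LINT x|lebesgue. k x * u x * partial i \<phi> x) = - (LINT x|lebesgue. \<phi> x * (k x *\<^sub>R g x + u x *\<^sub>R grad k x) $ i)"
      by (simp add: mult_ac)
  qed
qed

text \<open>Carrying a weak gradient along with the function avoids the choice in \<open>wgrad\<close>, which commutes with
algebraic operations only almost everywhere.\<close>

definition wpair :: "(real^'n::finite \<Rightarrow> real) \<Rightarrow> (real^'n \<Rightarrow> real) \<Rightarrow> (real^'n \<Rightarrow> real^'n) \<Rightarrow> bool" where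
  "wpair w u g \<longleftrightarrow> has_weak_grad u g \<and> sqint w u \<and> sqint w g"

context weight begin

lemma wnorm_le_unweighted:
  obtains B where "B > 0" "\<And>U :: real^'n \<Rightarrow> 'b::euclidean_space. sqint w U \<Longrightarrow> sqint (\<lambda>_. 1) U \<Longrightarrow>
     (\<And>x. norm x > R \<Longrightarrow> U x = 0) \<Longrightarrow> wnorm w U \<le> B * wnorm (\<lambda>_. 1) U"
proof -
  obtain b where b: "b > 0" "\<And>x. norm x \<le> R \<Longrightarrow> w x \<le> b" using w_bounds_ball[of R] by metis
  show ?thesis
  proof (rule that[of "sqrt b"])
    fix U :: "real^'n \<Rightarrow> 'b" assume U: "sqint w U" "sqint (\<lambda>_. 1) U" "\<And>x. norm x > R \<Longrightarrow> U x = 0"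
    have "(LINT x|lebesgue. (norm (U x))\<^sup>2 * w x) \<le> (LINT x|lebesgue. b * ((norm (U x))\<^sup>2 * 1))"
    proof (rule integral_mono)
      show "(norm (U x))\<^sup>2 * w x \<le> b * ((norm (U x))\<^sup>2 * 1)" for x
        using b U(3)[of x] by (cases "norm x > R") (auto simp: mult.commute[of b] intro: mult_left_mono)
    qed (use U in \<open>auto simp: sqint_def\<close>)
    then have "(LINT x|lebesgue. (norm (U x))\<^sup>2 * w x) \<le> b * (LINT x|lebesgue. (norm (U x))\<^sup>2 * 1)" by simp
    then show "wnorm w U \<le> sqrt b * wnorm (\<lambda>_. 1) U"
      unfolding wnorm_def real_sqrt_mult[symmetric] by (rule real_sqrt_le_mono)
  qed (use b in auto)
qed

lemma sqint_unweighted: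
  assumes U: "sqint w U" "csupp U"
  shows "sqint (\<lambda>_. 1) U"
proof -
  obtain R where R: "R > 0" "\<And>x. norm x > R \<Longrightarrow> U x = 0" using U(2) csuppE by metis
  obtain a where a: "a > 0" "\<And>x. norm x \<le> R \<Longrightarrow> a \<le> w x" using w_bounds_ball[of R] by metis
  have "integrable lebesgue (\<lambda>x. (1/a) * ((norm (U x))\<^sup>2 * w x))" using U by (simp add: sqint_def)
  then have "integrable lebesgue (\<lambda>x. (norm (U x))\<^sup>2)"
  proof (rule Bochner_Integration.integrable_bound)
    have [measurable]: "U \<in> borel_measurable lebesgue" using U by (simp add: sqint_def)
    show "(\<lambda>x. (norm (U x))\<^sup>2) \<in> borel_measurable lebesgue" by measurable
    have "(norm (U x))\<^sup>2 \<le> (1/a) * ((norm (U x))\<^sup>2 * w x)" for x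
    proof (cases "norm x > R")
      case False
      then have "(norm (U x))\<^sup>2 * a \<le> (norm (U x))\<^sup>2 * w x" using a by (intro mult_left_mono) auto
      then show ?thesis using a(1) by (simp add: field_simps)
    qed (use R in auto)
    then show "AE x in lebesgue. norm ((norm (U x))\<^sup>2) \<le> norm ((1/a) * ((norm (U x))\<^sup>2 * w x))"
      using a(1) w_nonneg by (intro AE_I2) simp
  qed
  then show ?thesis using U by (simp add: sqint_def)
qed

text \<open>On the ball of radius \<open>R + 1\<close>, which contains all supports, the weighted norm is bounded by a multiple
of the unweighted one, where mollification converges.\<close>

lemma test_dense_H1_csupp:
  assumes vg: "wpair w v g" and z: "csupp v" "csupp g" and d: "d > 0"
  shows "\<exists>\<phi>. test_function \<phi> \<and> wnorm w (\<lambda>x. v x - \<phi> x) < d \<and> wnorm w (\<lambda>x. g x - grad \<phi> x) < d"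
proof -
  let ?N = "real CARD('n)"
  have N: "?N \<ge> 1" by (simp add: Suc_leI)
  obtain R1 R2 where "\<And>x. norm x > R1 \<Longrightarrow> v x = 0" "\<And>x. norm x > R2 \<Longrightarrow> g x = 0" using z by (auto simp: csupp_def)
  then obtain R where R: "\<And>x. norm x > R \<Longrightarrow> v x = 0" "\<And>x. norm x > R \<Longrightarrow> g x = 0"
    by (metis max_less_iff_conj)
  obtain B where B: "B > 0" "\<And>U :: real^'n \<Rightarrow> real. sqint w U \<Longrightarrow> sqint (\<lambda>_. 1) U \<Longrightarrow>
     (\<And>x. norm x > R + 1 \<Longrightarrow> U x = 0) \<Longrightarrow> wnorm w U \<le> B * wnorm (\<lambda>_. 1) U"
    using wnorm_le_unweighted[of "R+1"] by metis
  have sv: "sqint w v" "\<And>i. sqint w (\<lambda>x. g x $ i)" using vg sqint_nth by (auto simp: wpair_def)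
  have cs: "csupp v" "\<And>i. csupp (\<lambda>x. g x $ i)" using z by (auto intro: csupp_weaken)
  have uv: "sqint (\<lambda>_. 1) v" "\<And>i. sqint (\<lambda>_. 1) (\<lambda>x. g x $ i)" using sqint_unweighted[OF sv(1) cs(1)] sqint_unweighted[OF sv(2) cs(2)] by auto
  define \<tau> where "\<tau> = d / (2 * B * ?N)"
  have \<tau>: "\<tau> > 0" using d B N by (simp add: \<tau>_def)
  obtain \<delta>0 where \<delta>0: "\<delta>0 > 0" "\<And>\<delta>. 0 < \<delta> \<Longrightarrow> \<delta> < \<delta>0 \<Longrightarrow> wnorm (\<lambda>_. 1) (\<lambda>x. convolve (mollifier \<delta>) v x - v x) < \<tau>"
    using mollify_L2_tendsto[OF uv(1) cs(1) \<tau>] by metis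
  have "\<exists>\<delta>1>0. \<forall>\<delta>. 0 < \<delta> \<and> \<delta> < \<delta>1 \<longrightarrow> wnorm (\<lambda>_. 1) (\<lambda>x. convolve (mollifier \<delta>) (\<lambda>x. g x $ i) x - g x $ i) < \<tau>" for i
    by (rule mollify_L2_tendsto[OF uv(2)[of i] cs(2)[of i] \<tau>]) blast
  then obtain \<delta>1 where \<delta>1: "\<And>i. \<delta>1 i > 0" 
    "\<And>i \<delta>. 0 < \<delta> \<Longrightarrow> \<delta> < \<delta>1 i \<Longrightarrow> wnorm (\<lambda>_. 1) (\<lambda>x. convolve (mollifier \<delta>) (\<lambda>x. g x $ i) x - g x $ i) < \<tau>" by metis
  \<comment> \<open>One mollification parameter for \<open>v\<close> and all components of \<open>g\<close>; below \<open>1\<close>, so that supports stay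
    in the ball of radius \<open>R + 1\<close>.\<close>
  define \<delta> where "\<delta> = Min (insert 1 (insert \<delta>0 (range \<delta>1))) / 2"
  have "Min (insert 1 (insert \<delta>0 (range \<delta>1))) > 0" using \<delta>0 \<delta>1 by (subst Min_gr_iff) auto
  moreover have "Min (insert 1 (insert \<delta>0 (range \<delta>1))) \<le> 1" "Min (insert 1 (insert \<delta>0 (range \<delta>1))) \<le> \<delta>0" "\<And>i. Min (insert 1 (insert \<delta>0 (range \<delta>1))) \<le> \<delta>1 i"
    by (auto intro!: Min_le simp del: Min_insert)
  ultimately have \<delta>: "0 < \<delta>" "\<delta> < 1" "\<delta> < \<delta>0" "\<And>i. \<delta> < \<delta>1 i" unfolding \<delta>_def by (smt (verit) field_sum_of_halves)+
  let ?m = "mollifier \<delta> :: real^'n \<Rightarrow> real"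
  note mt = mollifier_props(1)[OF \<delta>(1), where 'n='n]
  have vi: "integrable lebesgue v" using sqint_csupp_integrable[OF uv(1) cs(1)] .
  have gi: "integrable lebesgue (\<lambda>x. g x $ i)" for i using sqint_csupp_integrable[OF uv(2) cs(2)] .
  let ?\<phi> = "convolve ?m v"
  have \<phi>t: "test_function ?\<phi>" using test_function_convolve[OF vi mt cs(1)] .
  have est: "wnorm w (\<lambda>x. f x - convolve ?m f x) < d / ?N"
    if f: "sqint w f" "sqint (\<lambda>_. 1) f" "\<And>x. norm x > R \<Longrightarrow> f x = 0" "wnorm (\<lambda>_. 1) (\<lambda>x. convolve ?m f x - f x) < \<tau>" for f
  proof -
    have fc: "csupp f" using f(3) csuppI by blast
    have t: "test_function (convolve ?m f)" using test_function_convolve[OF sqint_csupp_integrable[OF f(2) fc] mt fc] .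
    have "wnorm w (\<lambda>x. f x - convolve ?m f x) \<le> B * wnorm (\<lambda>_. 1) (\<lambda>x. f x - convolve ?m f x)"
    proof (rule B(2))
      show "sqint w (\<lambda>x. f x - convolve ?m f x)" "sqint (\<lambda>_. 1) (\<lambda>x. f x - convolve ?m f x)"
        using sqint_diff[OF f(1) sqint_csupp] unweighted.sqint_diff[OF f(2) unweighted.sqint_csupp] test_functionD(2,3)[OF t] by auto
      show "f x - convolve ?m f x = 0" if "norm x > R + 1" for x
      proof -
        have "convolve ?m f x = 0"
          by (rule convolve_zero_outside[OF f(3) mollifier_props(3)[OF \<delta>(1)]]) (use that \<delta> in auto)
        then show ?thesis using f(3)[of x] that by simp
      qed
    qed
    also have "\<dots> < B * \<tau>" using f(4) B(1) unweighted.wnorm_minus_commute[of f "convolve ?m f"] by simp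
    also have "B * \<tau> = d / (2 * ?N)" using B(1) by (simp add: \<tau>_def)
    also have "\<dots> \<le> d / ?N" using d N by (simp add: field_simps)
    finally show ?thesis .
  qed
  have "wnorm w (\<lambda>x. v x - ?\<phi> x) < d / ?N" using est[OF sv(1) uv(1) R(1) \<delta>0(2)[OF \<delta>(1,3)]] .
  also have "d / ?N \<le> d" using d N by (simp add: field_simps)
  finally have 1: "wnorm w (\<lambda>x. v x - ?\<phi> x) < d" .
  have gc: "(\<lambda>x. (g x - grad ?\<phi> x) $ i) = (\<lambda>x. g x $ i - convolve ?m (\<lambda>x. g x $ i) x)" for i
    using vg partial_convolve_weak[OF _ vi mt] by (auto simp: grad_def wpair_def)
  have "wnorm w (\<lambda>x. g x - grad ?\<phi> x) \<le> (\<Sum>i\<in>UNIV. wnorm w (\<lambda>x. (g x - grad ?\<phi> x) $ i))"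
  proof (rule wnorm_vec_le)
    show "sqint w (\<lambda>x. (g x - grad ?\<phi> x) $ i)" for i
      unfolding gc using sv(2) test_function_convolve[OF gi mt cs(2)] test_functionD(2,3) sqint_csupp by (intro sqint_diff) blast+
  qed
  also have "\<dots> < (\<Sum>i\<in>(UNIV::'n set). d / ?N)"
  proof (intro sum_strict_mono)
    show "wnorm w (\<lambda>x. (g x - grad ?\<phi> x) $ i) < d / ?N" for i
      unfolding gc by (rule est[OF sv(2) uv(2) _ \<delta>1(2)[OF \<delta>(1) \<delta>(4)]]) (use R(2) in simp)
  qed auto
  also have "\<dots> = d" by simp
  finally show ?thesis using 1 \<phi>t by blast
qed

text \<open>Multiplication with the cut-off \<open>bump (x / (n + 1))\<close> reduces to bounded support; the additional term
\<open>u * \<nabla>bump\<close> in the gradient carries a factor \<open>1 / (n + 1)\<close>.\<close>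

lemma test_dense_H1:
  assumes ug: "wpair w u g" and d: "d > 0"
  obtains \<phi> where "test_function \<phi>" "wnorm w (\<lambda>x. u x - \<phi> x) < d" "wnorm w (\<lambda>x. g x - grad \<phi> x) < d"
proof -
  have u: "sqint w u" and g: "sqint w g" and wg: "has_weak_grad u g" using ug by (auto simp: wpair_def)
  have um: "u \<in> borel_measurable lebesgue" and gm: "g \<in> borel_measurable lebesgue" using u g by (auto simp: sqint_def)
  obtain M where M: "M > 0" "\<And>x. norm (grad bump (x::real^'n)) \<le> M"
    using csupp_bounded[OF grad_continuous csupp_grad] test_functionD(1,2)[OF test_function_bump] by metis
  define k where "k n x = bump ((1 / real (Suc n)) *\<^sub>R x)" for n and x :: "real^'n"
  have kt: "test_function (k n)" for n
    unfolding k_def using test_function_affine[OF test_function_bump, of "1 / real (Suc n)" 0] by simp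
  have kp: "grad (k n) x = (1 / real (Suc n)) *\<^sub>R grad bump ((1 / real (Suc n)) *\<^sub>R x)" for n x
    using partial_affine(1)[OF test_functionD(4)[OF test_function_bump], of _ 0 "1 / real (Suc n)" x]
    by (simp add: grad_def vec_eq_iff k_def[abs_def])
  have kl: "(\<lambda>n. k n x) \<longlonglongrightarrow> 1" for x
  proof -
    have "(\<lambda>n. (1 / real (Suc n)) *\<^sub>R x) \<longlonglongrightarrow> 0 *\<^sub>R x" by (intro tendsto_intros LIMSEQ_Suc[OF lim_1_over_n])
    then have "(\<lambda>n. bump ((1 / real (Suc n)) *\<^sub>R x)) \<longlonglongrightarrow> bump (0::real^'n)"
      using continuous_on_tendsto_compose[OF test_functionD(3)[OF test_function_bump]] by fastforce
    then show ?thesis by (simp add: k_def)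
  qed
  have kb: "0 \<le> k n x" "k n x \<le> 1" for n x by (auto simp: k_def bump_nonneg bump_le_1)
  have km: "k n \<in> borel_measurable lebesgue" for n using test_functionD(3)[OF kt] continuous_imp_measurable_lebesgue by blast
  have gkm: "grad (k n) \<in> borel_measurable lebesgue" for n
    using test_functionD(1)[OF kt] grad_continuous continuous_imp_measurable_lebesgue by blast
  define v where "v n x = k n x * u x" for n x
  define h where "h n x = k n x *\<^sub>R g x + u x *\<^sub>R grad (k n) x" for n x
  have s1: "sqint w (\<lambda>x. k n x *\<^sub>R g x)" for n
    by (rule sqint_dominate(1)[OF g, where B=1]) (use km gm kb in \<open>auto intro!: mult_left_le_one_le\<close>)
  have gk: "norm (grad (k n) x) \<le> M / real (Suc n)" for n x
    unfolding kp using M(2)[of "(1 / real (Suc n)) *\<^sub>R x"] by (simp add: divide_right_mono)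
  have s2: "sqint w (\<lambda>x. u x *\<^sub>R grad (k n) x)" and n2: "wnorm w (\<lambda>x. u x *\<^sub>R grad (k n) x) \<le> M / real (Suc n) * wnorm w u" for n
  proof -
    have "(\<lambda>x. u x *\<^sub>R grad (k n) x) \<in> borel_measurable lebesgue" using um gkm by (intro borel_measurable_scaleR)
    moreover have "norm (u x *\<^sub>R grad (k n) x) \<le> M / real (Suc n) * norm (u x)" for x
      using mult_left_mono[OF gk[of n x], of "norm (u x)"] by (simp add: mult.commute)
    moreover have "M / real (Suc n) \<ge> 0" using M(1) by simp
    ultimately show "sqint w (\<lambda>x. u x *\<^sub>R grad (k n) x)" "wnorm w (\<lambda>x. u x *\<^sub>R grad (k n) x) \<le> M / real (Suc n) * wnorm w u"
      using sqint_dominate[OF u] by blast+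
  qed
  have pair: "wpair w (v n) (h n)" for n
    unfolding wpair_def
  proof (intro conjI)
    show "has_weak_grad (v n) (h n)" unfolding v_def[abs_def] h_def[abs_def]
      using kt by (intro has_weak_grad_mult[OF wg]) (simp add: test_function_iff)
    show "sqint w (v n)" unfolding v_def
      by (rule sqint_dominate(1)[OF u, where B=1]) (use km um kb in \<open>auto simp: abs_mult intro!: mult_left_le_one_le\<close>)
    show "sqint w (h n)" unfolding h_def[abs_def] by (intro sqint_add s1 s2)
  qed
  have c1: "csupp (v n)" for n
    by (rule csupp_weaken[OF test_functionD(2)[OF kt[of n]]]) (simp add: v_def)
  have c2: "csupp (h n)" for n
    by (rule csupp_weaken2[OF test_functionD(2)[OF kt[of n]] csupp_grad[OF test_functionD(2)[OF kt[of n]]]])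
      (simp add: h_def)
  have l1: "(\<lambda>n. wnorm w (\<lambda>x. u x - v n x)) \<longlonglongrightarrow> 0"
  proof (rule wnorm_tendsto_0[OF _ _ u])
    show "(\<lambda>x. u x - v n x) \<in> borel_measurable lebesgue" for n unfolding v_def using um km by (intro borel_measurable_diff borel_measurable_times)
    show "norm (u x - v n x) \<le> norm (u x)" for n x
    proof -
      have "u x - v n x = (1 - k n x) * u x" by (simp add: v_def algebra_simps)
      then show ?thesis using kb[of n x] by (simp add: abs_mult mult_left_le_one_le)
    qed
    have "(\<lambda>n. u x - v n x) \<longlonglongrightarrow> u x - 1 * u x" for x unfolding v_def by (intro tendsto_intros kl)
    then show "AE x in lebesgue. (\<lambda>n. u x - v n x) \<longlonglongrightarrow> 0" by simp
  qed
  have l2: "(\<lambda>n. wnorm w (\<lambda>x. g x - k n x *\<^sub>R g x)) \<longlonglongrightarrow> 0"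
  proof (rule wnorm_tendsto_0[OF _ _ g])
    show "(\<lambda>x. g x - k n x *\<^sub>R g x) \<in> borel_measurable lebesgue" for n using gm km by (intro borel_measurable_diff borel_measurable_scaleR)
    show "norm (g x - k n x *\<^sub>R g x) \<le> norm (g x)" for n x
    proof -
      have "g x - k n x *\<^sub>R g x = (1 - k n x) *\<^sub>R g x" by (simp add: algebra_simps)
      then show ?thesis using kb[of n x] by (simp add: mult_left_le_one_le)
    qed
    have "(\<lambda>n. g x - k n x *\<^sub>R g x) \<longlonglongrightarrow> g x - 1 *\<^sub>R g x" for x by (intro tendsto_intros kl)
    then show "AE x in lebesgue. (\<lambda>n. g x - k n x *\<^sub>R g x) \<longlonglongrightarrow> 0" by simp
  qed
  have l3: "(\<lambda>n. M / real (Suc n) * wnorm w u) \<longlonglongrightarrow> 0"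
    using tendsto_mult_right[OF LIMSEQ_Suc[OF lim_const_over_n[of M]], of "wnorm w u"] by simp
  have d4: "d/4 > 0" using d by simp
  have "\<forall>\<^sub>F n in sequentially. wnorm w (\<lambda>x. u x - v n x) < d/4 \<and> wnorm w (\<lambda>x. g x - k n x *\<^sub>R g x) < d/4 \<and> M / real (Suc n) * wnorm w u < d/4"
    using order_tendstoD(2)[OF l1 d4] order_tendstoD(2)[OF l2 d4] order_tendstoD(2)[OF l3 d4] by eventually_elim auto
  from eventually_happens'[OF sequentially_bot this]
  obtain n where n: "wnorm w (\<lambda>x. u x - v n x) < d/4" "wnorm w (\<lambda>x. g x - k n x *\<^sub>R g x) < d/4" "M / real (Suc n) * wnorm w u < d/4" by blast
  obtain \<phi> where \<phi>: "test_function \<phi>" "wnorm w (\<lambda>x. v n x - \<phi> x) < d/4" "wnorm w (\<lambda>x. h n x - grad \<phi> x) < d/4"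
    using test_dense_H1_csupp[OF pair c1 c2 d4] by blast
  have sv: "sqint w (v n)" "sqint w (h n)" using pair by (auto simp: wpair_def)
  have s\<phi>: "sqint w \<phi>" "sqint w (grad \<phi>)"
    using test_functionD[OF \<phi>(1)] grad_continuous csupp_grad sqint_csupp by blast+
  have "wnorm w (\<lambda>x. u x - \<phi> x) < d" using wnorm_diff_triangle[OF u sv(1) s\<phi>(1)] n(1) \<phi>(2) d by linarith
  moreover have "wnorm w (\<lambda>x. g x - grad \<phi> x) < d"
  proof -
    have "wnorm w (\<lambda>x. g x - h n x) = wnorm w (\<lambda>x. (g x - k n x *\<^sub>R g x) + (-1) *\<^sub>R (u x *\<^sub>R grad (k n) x))"
      by (simp add: h_def algebra_simps)
    also have "\<dots> \<le> wnorm w (\<lambda>x. g x - k n x *\<^sub>R g x) + wnorm w (\<lambda>x. (-1) *\<^sub>R (u x *\<^sub>R grad (k n) x))"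
      by (intro wnorm_triangle sqint_diff sqint_scale g s1 s2)
    also have "wnorm w (\<lambda>x. (-1) *\<^sub>R (u x *\<^sub>R grad (k n) x)) = wnorm w (\<lambda>x. u x *\<^sub>R grad (k n) x)"
      using wnorm_scale[of "-1" "\<lambda>x. u x *\<^sub>R grad (k n) x"] by simp
    finally have "wnorm w (\<lambda>x. g x - h n x) < d/2" using n(2,3) n2[of n] by linarith
    then show ?thesis using wnorm_diff_triangle[OF g sv(2) s\<phi>(2)] \<phi>(3) d by linarith
  qed
  ultimately show ?thesis using that \<phi>(1) by blast
qed

end

section \<open>Oscillating integrals of periodic functions\<close>

lemma mem_cell: "x \<in> cell L \<longleftrightarrow> (\<forall>i. 0 \<le> x $ i \<and> x $ i \<le> L)"
  by (auto simp: cell_def mem_box_cart)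

lemma axis_zero: "axis i 0 = 0"
  by (simp add: axis_def vec_eq_iff)

lemma axis_add: "axis i (a + b) = axis i a + axis i (b::real)"
  by (simp add: axis_def vec_eq_iff)

lemma periodic_shift_nat:
  assumes "periodic L f" shows "f (x + axis i (real n * L)) = f x"
proof (induction n)
  case 0
  then show ?case by (simp add: axis_zero)
next
  case (Suc n)
  have "f ((x + axis i (real n * L)) + axis i L) = f (x + axis i (real n * L))"
    using assms unfolding periodic_def by blast
  then show ?case using Suc by (simp add: distrib_right axis_add add_ac)
qed

lemma periodic_shift_int:
  assumes "periodic L f" shows "f (x + axis i (of_int k * L)) = f x"
proof (cases "k \<ge> 0")
  case True
  then show ?thesis using periodic_shift_nat[OF assms, of x i "nat k"] by simp
next
  case False
  have "f ((x + axis i (of_int k * L)) + axis i (real (nat (-k)) * L)) = f (x + axis i (of_int k * L))"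
    by (rule periodic_shift_nat[OF assms])
  moreover have "(x + axis i (of_int k * L)) + axis i (real (nat (-k)) * L) = x"
    using False by (simp add: axis_def vec_eq_iff)
  ultimately show ?thesis by simp
qed

text \<open>The coordinates are moved into \<open>[0, L]\<close> one after the other by integer multiples of the period.\<close>

lemma periodic_cell_representative:
  fixes f :: "real^'n::finite \<Rightarrow> 'b"
  assumes "periodic L f" "L > 0"
  obtains y where "y \<in> cell L" "f y = f x"
proof -
  have "\<exists>y. f y = f x \<and> (\<forall>i\<in>S. 0 \<le> y $ i \<and> y $ i \<le> L)" if "finite S" for S :: "'n set"
    using that
  proof (induction S)
    case (insert i S)
    then obtain y where y: "f y = f x" "\<forall>i\<in>S. 0 \<le> y $ i \<and> y $ i \<le> L" by blast
    define k where "k = - \<lfloor>y $ i / L\<rfloor>"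
    define z where "z = y + axis i (of_int k * L)"
    have "of_int \<lfloor>y $ i / L\<rfloor> * L \<le> y $ i" "y $ i \<le> (of_int \<lfloor>y $ i / L\<rfloor> + 1) * L"
      using assms(2) by (simp_all add: pos_le_divide_eq[symmetric] pos_divide_le_eq[symmetric] less_imp_le)
    then have "0 \<le> z $ i \<and> z $ i \<le> L" by (simp add: z_def k_def algebra_simps)
    moreover have "z $ j = y $ j" if "j \<noteq> i" for j using that by (simp add: z_def axis_def)
    moreover have "f z = f x" using y(1) periodic_shift_int[OF assms(1)] by (simp add: z_def)
    ultimately show ?case using y(2) by (metis insertE)
  qed auto
  from this[of UNIV] that show ?thesis by (auto simp: mem_cell)
qed

lemma periodic_bounded:
  fixes f :: "real^'n::finite \<Rightarrow> 'b::real_normed_vector"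
  assumes "periodic L f" "L > 0" "continuous_on UNIV f"
  obtains B where "B > 0" "\<And>x. norm (f x) \<le> B"
proof -
  have "compact (f ` cell L)" unfolding cell_def
    by (intro compact_continuous_image compact_cbox continuous_on_subset[OF assms(3)]) auto
  then obtain B where B: "B > 0" "\<And>y. y \<in> f ` cell L \<Longrightarrow> norm y \<le> B"
    using compact_imp_bounded bounded_pos by metis
  then show ?thesis using that periodic_cell_representative[OF assms(1,2)] by (metis image_eqI)
qed

lemma periodic_translate:
  assumes "periodic L f" shows "periodic L (\<lambda>x. f (x + z))"
  using assms unfolding periodic_def by (metis add.assoc add.commute)

definition cell_integral :: "real \<Rightarrow> (real^'n::finite \<Rightarrow> real) \<Rightarrow> real" where
  "cell_integral L g = (LINT y:cell L|lebesgue. g y)"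

text \<open>Lattice translates of the half-open cell are disjoint. So shifted cells can be cut and reassembled
pointwise, whereas for the closed cell faces would be counted twice.\<close>

definition halfopen_cell :: "real \<Rightarrow> (real^'n::finite) set" where
  "halfopen_cell L = {y. \<forall>j. 0 < y $ j \<and> y $ j \<le> L}"

lemma halfopen_cell_borel [measurable]: "halfopen_cell L \<in> sets borel"
proof -
  have "halfopen_cell L = (\<Inter>j\<in>UNIV. {y::real^'a. 0 < y $ j} \<inter> {y. y $ j \<le> L})"
    by (auto simp: halfopen_cell_def)
  moreover have "{y::real^'a. 0 < y $ j} \<in> sets borel" "{y::real^'a. y $ j \<le> L} \<in> sets borel" for j
    by (auto intro!: borel_open borel_closed open_Collect_less closed_Collect_le continuous_intros)
  ultimately show ?thesis by (auto intro!: sets.countable_INT'')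
qed

lemma integrable_on_halfopen_cell:
  fixes k :: "real^'n::finite \<Rightarrow> real"
  assumes "k \<in> borel_measurable borel" "\<And>x. \<bar>k x\<bar> \<le> B"
  shows "integrable lborel (\<lambda>y. indicator (halfopen_cell L) y * k y)"
proof (rule Bochner_Integration.integrable_bound)
  have "emeasure lborel (halfopen_cell L :: (real^'n) set) \<le> emeasure lborel (cell L :: (real^'n) set)"
  proof (rule emeasure_mono)
    show "halfopen_cell L \<subseteq> (cell L :: (real^'n) set)" by (auto simp: halfopen_cell_def mem_cell less_imp_le)
  qed (simp add: cell_def)
  also have "\<dots> < \<infinity>" unfolding cell_def by (rule emeasure_lborel_cbox_finite)
  finally show "integrable lborel (\<lambda>y::real^'n. B * indicator (halfopen_cell L) y)"
    by (intro integrable_mult_right integrable_real_indicator) auto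
  show "(\<lambda>y. indicator (halfopen_cell L) y * k y) \<in> borel_measurable lborel" using assms(1) by measurable
  show "AE y in lborel. norm (indicator (halfopen_cell L) y * k y) \<le> norm (B * indicator (halfopen_cell L) y)"
    using assms(2) by (intro AE_I2) (auto simp: indicator_def intro: order_trans[OF _ abs_ge_self])
qed

lemma cell_integral_halfopen:
  assumes g: "continuous_on UNIV g"
  shows "cell_integral L g = (LINT y|lborel. indicator (halfopen_cell L) y * g y)"
proof -
  have gm [measurable]: "g \<in> borel_measurable borel" using g borel_measurable_continuous_onI by blast
  have "cell_integral L g = (LINT y|lborel. indicator (cell L) y * g y)"
    unfolding cell_integral_def set_lebesgue_integral_def by (subst lebesgue_integral_lborel) (auto simp: cell_def)
  also have "\<dots> = (LINT y|lborel. indicator (halfopen_cell L) y * g y)"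
  proof (rule integral_cong_AE)
    have "cell L - halfopen_cell L \<subseteq> cbox 0 (vec L) - box 0 (vec L :: real^'a)"
      by (auto simp: cell_def halfopen_cell_def mem_box_cart less_imp_le)
    then have "negligible (cell L - halfopen_cell L :: (real^'a) set)"
      using negligible_frontier_interval negligible_subset by blast
    moreover have "halfopen_cell L \<subseteq> (cell L :: (real^'a) set)"
      by (auto simp: mem_cell halfopen_cell_def less_imp_le)
    ultimately have "AE y in lebesgue. y \<notin> (cell L - halfopen_cell L :: (real^'a) set)"
      by (intro AE_not_in) (simp add: negligible_iff_null_sets)
    then have "AE y in lborel. y \<notin> (cell L - halfopen_cell L :: (real^'a) set)"
      by (simp add: AE_completion_iff)
    then show "AE y in lborel. indicator (cell L) y * g y = indicator (halfopen_cell L) y * g y"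
      by eventually_elim (use \<open>halfopen_cell L \<subseteq> cell L\<close> in \<open>auto simp: indicator_def\<close>)
  qed (auto simp: cell_def)
  finally show ?thesis .
qed

text \<open>Shifting the cell along an axis removes a slab at one face and adds its translate by one period at the
opposite face.\<close>

lemma cell_integral_translate_axis:
  fixes g :: "real^'n::finite \<Rightarrow> real"
  assumes g: "continuous_on UNIV g" "periodic L g" and L: "L > 0" and t: "0 \<le> t" "t \<le> L"
  shows "cell_integral L (\<lambda>y. g (y + axis i t)) = cell_integral L g"
proof -
  obtain B where B: "\<And>x. norm (g x) \<le> B" using periodic_bounded[OF g(2) L g(1)] by metis
  have gm [measurable]: "g \<in> borel_measurable borel" using g borel_measurable_continuous_onI by blast
  let ?H = "halfopen_cell L :: (real^'n) set"
  let ?A = "{y::real^'n. t < y $ i}"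
  have A [measurable]: "?A \<in> sets borel" by (auto intro!: borel_open open_Collect_less continuous_intros)
  define F where "F y = indicator ?H y * (indicator (- ?A) y * g y)" for y
  have Fm [measurable]: "F \<in> borel_measurable borel" unfolding F_def by measurable
  \<comment> \<open>The part of the shifted cell beyond \<open>L\<close> is the slab \<open>F\<close> translated by one period.\<close>
  have split: "indicator ?H (y - axis i t) * g y = indicator ?H y * (indicator ?A y * g y) + F (y + (- axis i L))" for y
  proof -
    have gp: "g (y + (- axis i L)) = g y"
      using g(2) unfolding periodic_def by (metis add.assoc add.right_neutral add_uminus_conv_diff diff_add_cancel)
    have m: "y - axis i t \<in> ?H \<longleftrightarrow> (\<forall>j. j \<noteq> i \<longrightarrow> 0 < y $ j \<and> y $ j \<le> L) \<and> t < y $ i \<and> y $ i \<le> L + t"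
     "y + (- axis i L) \<in> ?H \<longleftrightarrow> (\<forall>j. j \<noteq> i \<longrightarrow> 0 < y $ j \<and> y $ j \<le> L) \<and> L < y $ i \<and> y $ i \<le> L + L"
     "y \<in> ?H \<longleftrightarrow> (\<forall>j. j \<noteq> i \<longrightarrow> 0 < y $ j \<and> y $ j \<le> L) \<and> 0 < y $ i \<and> y $ i \<le> L"
     by (auto simp: halfopen_cell_def axis_def split: if_splits)
    have a: "y + (- axis i L) \<in> - ?A \<longleftrightarrow> y $ i \<le> L + t" by (auto simp: axis_def)
    show ?thesis unfolding F_def gp using m a t by (auto simp: indicator_def simp del: ComplD)
  qed
  have i1: "integrable lborel (\<lambda>y. indicator ?H y * (indicator ?A y * g y))" "integrable lborel F"
  proof -
    have "B \<ge> 0" using B[of 0] norm_ge_zero[of "g 0"] by linarith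
    then have "\<bar>indicator S y * g y\<bar> \<le> B" for S y using B[of y] by (simp add: indicator_def)
    then show "integrable lborel (\<lambda>y. indicator ?H y * (indicator ?A y * g y))" "integrable lborel F"
      unfolding F_def by (intro integrable_on_halfopen_cell[where B=B]; measurable)+
  qed
  have i2: "integrable lborel (\<lambda>y. F (y + (- axis i L)))"
  proof -
    have "integrable (distr lborel borel ((+) (- axis i L))) F" using i1(2) by (simp add: lborel_distr_plus)
    then have "integrable lborel (\<lambda>y. F ((- axis i L) + y))" by (subst (asm) integrable_distr_eq) auto
    then show ?thesis by (simp add: add.commute)
  qed
  have "cell_integral L (\<lambda>y. g (y + axis i t)) = (LINT y|lborel. indicator ?H y * g (y + axis i t))"
    using g(1) by (intro cell_integral_halfopen continuous_on_compose2[OF g(1)] continuous_intros) auto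
  also have "\<dots> = (LINT y|lborel. indicator ?H (y + axis i t - axis i t) * g (y + axis i t))" by simp
  also have "\<dots> = (LINT y|lborel. indicator ?H (y - axis i t) * g y)"
    by (rule lborel_integral_translate[where f="\<lambda>y. indicator ?H (y - axis i t) * g y"]) measurable
  also have "\<dots> = (LINT y|lborel. indicator ?H y * (indicator ?A y * g y)) + (LINT y|lborel. F (y + (- axis i L)))"
    unfolding split using i1(1) i2 by simp
  also have "(LINT y|lborel. F (y + (- axis i L))) = (LINT y|lborel. F y)"
    by (rule lborel_integral_translate) measurable
  also have "(LINT y|lborel. indicator ?H y * (indicator ?A y * g y)) + (LINT y|lborel. F y)
      = (LINT y|lborel. indicator ?H y * (indicator ?A y * g y) + F y)" using i1 by simp
  also have "\<dots> = (LINT y|lborel. indicator ?H y * g y)"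
    by (intro Bochner_Integration.integral_cong refl) (auto simp: F_def indicator_def)
  also have "\<dots> = cell_integral L g" using cell_integral_halfopen[OF g(1)] by simp
  finally show ?thesis .
qed

lemma cell_integral_translate:
  fixes g :: "real^'n::finite \<Rightarrow> real"
  assumes g: "continuous_on UNIV g" "periodic L g" and L: "L > 0"
  shows "cell_integral L (\<lambda>y. g (y + z)) = cell_integral L g"
proof -
  have incell: "cell_integral L (\<lambda>y. g (y + z)) = cell_integral L g" if z: "z \<in> cell L" for z
  proof -
    have "cell_integral L (\<lambda>y. g (y + (\<Sum>i\<in>S. axis i (z $ i)))) = cell_integral L g" if "finite S" for S :: "'n set"
      using that
    proof (induction S)
      case (insert i S)
      let ?g = "\<lambda>y. g (y + (\<Sum>i\<in>S. axis i (z $ i)))"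
      have "cell_integral L (\<lambda>y. ?g (y + axis i (z $ i))) = cell_integral L ?g"
      proof (rule cell_integral_translate_axis)
        show "continuous_on UNIV ?g" by (intro continuous_on_compose2[OF g(1)] continuous_intros) auto
        show "periodic L ?g" using g(2) by (rule periodic_translate)
      qed (use L z in \<open>auto simp: mem_cell\<close>)
      then show ?case using insert by (simp add: add_ac)
    qed simp
    moreover have "(\<Sum>i\<in>UNIV. axis i (z $ i)) = z"
      by (simp add: vec_eq_iff axis_def)
    ultimately show ?thesis using finite[of "UNIV::'n set"] by fastforce
  qed
  have "periodic L (\<lambda>z. cell_integral L (\<lambda>y. g (y + z)))"
    using g(2) unfolding periodic_def by (simp add: add.assoc[symmetric])
  then obtain y where "y \<in> cell L" "cell_integral L (\<lambda>x. g (x + y)) = cell_integral L (\<lambda>x. g (x + z))"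
    using periodic_cell_representative[OF _ L, of "\<lambda>z. cell_integral L (\<lambda>y. g (y + z))" z] by blast
  then show ?thesis using incell[of y] by simp
qed

text \<open>The fundamental theorem of calculus on the segment from \<open>x\<close> to \<open>x + v\<close>, followed by Tonelli's theorem
and translation invariance.\<close>

lemma L1_translation_bound:
  fixes G :: "real^'n::finite \<Rightarrow> real"
  assumes G: "Ck 1 G" "csupp G"
  shows "(LINT x|lborel. \<bar>G (x + v) - G x\<bar>) \<le> norm v * (LINT x|lborel. norm (grad G x))"
    and "integrable lborel (\<lambda>x. G (x + v))"
proof -
  have Gc: "continuous_on UNIV G" using G Ck_continuous by blast
  have gc: "continuous_on UNIV (grad G)" using G(1) grad_continuous by blast
  have Gm [measurable]: "G \<in> borel_measurable borel" and gm [measurable]: "grad G \<in> borel_measurable borel"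
    using Gc gc borel_measurable_continuous_onI by blast+
  have iG: "integrable lborel G" using integrable_csupp[OF Gc G(2)] by (simp add: integrable_completion)
  have ig: "integrable lborel (grad G)" using integrable_csupp[OF gc csupp_grad[OF G(2)]] by (simp add: integrable_completion)
  have "integrable (distr lborel borel ((+) v)) G" using iG by (simp add: lborel_distr_plus)
  then have "integrable lborel (\<lambda>y. G (v + y))" by (subst (asm) integrable_distr_eq) auto
  then show iv: "integrable lborel (\<lambda>x. G (x + v))" by (simp add: add.commute)
  define c where "c = (\<integral>\<^sup>+x. ennreal (norm (grad G x)) \<partial>lborel)"
  have cv: "(\<integral>\<^sup>+x. ennreal (norm (grad G (x + s))) \<partial>lborel) = c" for s
  proof -
    have "c = (\<integral>\<^sup>+x. ennreal (norm (grad G x)) \<partial>distr lborel borel ((+) s))"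
      by (simp add: c_def lborel_distr_plus)
    also have "\<dots> = (\<integral>\<^sup>+x. ennreal (norm (grad G (s + x))) \<partial>lborel)"
      by (subst nn_integral_distr) auto
    finally show ?thesis by (simp add: add.commute)
  qed
  have pt: "ennreal \<bar>G (x + v) - G x\<bar> \<le> (\<integral>\<^sup>+t. ennreal (indicator {0..1} t * (norm v * norm (grad G (x + t *\<^sub>R v)))) \<partial>lborel)" for x
  proof -
    have ct: "continuous_on {0..1} (\<lambda>t. grad G (x + t *\<^sub>R v))"
      by (intro continuous_on_compose2[OF gc] continuous_intros) auto
    have "(LINT t|lborel. indicator {0..1} t *\<^sub>R (grad G (x + t *\<^sub>R v) \<bullet> v)) = G (x + 1 *\<^sub>R v) - G (x + 0 *\<^sub>R v)"
    proof (rule integral_FTC_atLeastAtMost)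
      show "((\<lambda>t. G (x + t *\<^sub>R v)) has_vector_derivative grad G (x + t *\<^sub>R v) \<bullet> v) (at t within {0..1})" for t
        using DERIV_line[OF G(1)] by (simp add: has_real_derivative_iff_has_vector_derivative has_vector_derivative_at_within)
      show "continuous_on {0..1} (\<lambda>t. grad G (x + t *\<^sub>R v) \<bullet> v)" by (intro continuous_intros ct)
    qed simp
    then have "\<bar>G (x + v) - G x\<bar> = norm (LINT t|lborel. indicator {0..1} t *\<^sub>R (grad G (x + t *\<^sub>R v) \<bullet> v))" by simp
    also have "\<dots> \<le> (LINT t|lborel. indicator {0..1} t * (norm v * norm (grad G (x + t *\<^sub>R v))))"
    proof (rule Bochner_Integration.integral_norm_bound_integral)
      show "integrable lborel (\<lambda>t. indicator {0..1} t *\<^sub>R (grad G (x + t *\<^sub>R v) \<bullet> v))"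
        by (intro borel_integrable_compact continuous_intros ct) auto
      show i: "integrable lborel (\<lambda>t. indicator {0..1} t * (norm v * norm (grad G (x + t *\<^sub>R v))))"
        using borel_integrable_compact[OF compact_Icc continuous_on_mult[OF continuous_on_const[of _ "norm v"] continuous_on_norm[OF ct]]]
        by simp
      show "norm (indicator {0..1} t *\<^sub>R (grad G (x + t *\<^sub>R v) \<bullet> v)) \<le> indicator {0..1} t * (norm v * norm (grad G (x + t *\<^sub>R v)))" for t
        using Cauchy_Schwarz_ineq2[of "grad G (x + t *\<^sub>R v)" v] by (auto simp: indicator_def mult.commute)
    qed
    finally have "ennreal \<bar>G (x + v) - G x\<bar> \<le> ennreal (LINT t|lborel. indicator {0..1} t * (norm v * norm (grad G (x + t *\<^sub>R v))))"
      by (rule ennreal_leI)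
    also have "\<dots> = (\<integral>\<^sup>+t. ennreal (indicator {0..1} t * (norm v * norm (grad G (x + t *\<^sub>R v)))) \<partial>lborel)"
      using borel_integrable_compact[OF compact_Icc continuous_on_mult[OF continuous_on_const[of _ "norm v"] continuous_on_norm[OF ct]]]
      by (intro nn_integral_eq_integral[symmetric]) auto
    finally show ?thesis .
  qed
  have "(\<integral>\<^sup>+x. ennreal \<bar>G (x + v) - G x\<bar> \<partial>lborel) \<le> (\<integral>\<^sup>+x. \<integral>\<^sup>+t. ennreal (indicator {0..1} t * (norm v * norm (grad G (x + t *\<^sub>R v)))) \<partial>lborel \<partial>lborel)"
    by (rule nn_integral_mono) (rule pt)
  also have "\<dots> = (\<integral>\<^sup>+t. \<integral>\<^sup>+x. ennreal (indicator {0..1} t * (norm v * norm (grad G (x + t *\<^sub>R v)))) \<partial>lborel \<partial>lborel)"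
    by (rule lborel_pair.Fubini'[symmetric]) measurable
  also have "\<dots> = (\<integral>\<^sup>+t. ennreal (norm v) * c * indicator {0..1} (t::real) \<partial>lborel)"
  proof (rule nn_integral_cong)
    fix t :: real
    have "(\<integral>\<^sup>+x. ennreal (indicator {0..1} t * (norm v * norm (grad G (x + t *\<^sub>R v)))) \<partial>lborel)
        = (\<integral>\<^sup>+x. ennreal (indicator {0..1} t * norm v) * ennreal (norm (grad G (x + t *\<^sub>R v))) \<partial>lborel)"
      by (intro nn_integral_cong) (simp add: ennreal_mult[symmetric] mult.assoc)
    also have "\<dots> = ennreal (indicator {0..1} t * norm v) * c"
      by (subst nn_integral_cmult) (auto simp: cv)
    finally show "(\<integral>\<^sup>+x. ennreal (indicator {0..1} t * (norm v * norm (grad G (x + t *\<^sub>R v)))) \<partial>lborel) = ennreal (norm v) * c * indicator {0..1} t"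
      by (auto simp: indicator_def)
  qed
  also have "\<dots> = ennreal (norm v) * c" by (subst nn_integral_cmult_indicator) auto
  finally have "(\<integral>\<^sup>+x. ennreal \<bar>G (x + v) - G x\<bar> \<partial>lborel) \<le> ennreal (norm v) * c" .
  moreover have "(\<integral>\<^sup>+x. ennreal \<bar>G (x + v) - G x\<bar> \<partial>lborel) = ennreal (LINT x|lborel. \<bar>G (x + v) - G x\<bar>)"
    using iv iG by (intro nn_integral_eq_integral) auto
  moreover have "c = ennreal (LINT x|lborel. norm (grad G x))"
    unfolding c_def using ig by (intro nn_integral_eq_integral) auto
  ultimately have "ennreal (LINT x|lborel. \<bar>G (x + v) - G x\<bar>) \<le> ennreal (norm v * (LINT x|lborel. norm (grad G x)))"
    by (simp add: ennreal_mult)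
  then show "(LINT x|lborel. \<bar>G (x + v) - G x\<bar>) \<le> norm v * (LINT x|lborel. norm (grad G x))"
    by (subst (asm) ennreal_le_iff) auto
qed

lemma norm_cell_le: "y \<in> cell L \<Longrightarrow> norm (y::real^'n::finite) \<le> real CARD('n) * L"
proof -
  assume y: "y \<in> cell L"
  have "norm y \<le> (\<Sum>i\<in>UNIV. \<bar>y $ i\<bar>)" by (rule norm_le_l1_cart)
  also have "\<dots> \<le> (\<Sum>i\<in>(UNIV::'n set). L)" using y by (intro sum_mono) (auto simp: mem_cell)
  finally show ?thesis by simp
qed

lemma cell_volume_pos:
  assumes "L > 0" shows "measure lborel (cell L :: (real^'n::finite) set) > 0"
proof -
  show ?thesis unfolding cell_def
    by (rule content_pos_lt) (use assms in \<open>auto simp: Basis_vec_def inner_axis\<close>)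
qed

text \<open>The substitution \<open>x + \<epsilon> y\<close> leaves the integral unchanged and turns \<open>g (x / \<epsilon>)\<close> into \<open>g (x / \<epsilon> + y)\<close>, whose
integral over \<open>y\<close> in the cell is \<open>0\<close>. Averaging over \<open>y\<close>, only the increments \<open>G (x + \<epsilon> y) - G x\<close>
contribute, and these are of order \<open>\<epsilon>\<close> in \<open>L\<^sup>1\<close>.\<close>

lemma oscillating_integral_bound:
  fixes G g :: "real^'n::finite \<Rightarrow> real"
  assumes G: "Ck 1 G" "csupp G" and g: "continuous_on UNIV g" "periodic L g" "cell_integral L g = 0"
    and L: "L > 0" and B: "\<And>x. \<bar>g x\<bar> \<le> B" and e: "\<epsilon> > 0"
  shows "\<bar>LINT x|lebesgue. G x * g ((1/\<epsilon>) *\<^sub>R x)\<bar> \<le> \<epsilon> * (real CARD('n) * L * B * (LINT x|lebesgue. norm (grad G x)))"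
proof -
  have Gc: "continuous_on UNIV G" using G Ck_continuous by blast
  have gc: "continuous_on UNIV (grad G)" using G(1) grad_continuous by blast
  have Gm [measurable]: "G \<in> borel_measurable borel" and ggm [measurable]: "grad G \<in> borel_measurable borel"
   and gm [measurable]: "g \<in> borel_measurable borel"
    using Gc gc g(1) borel_measurable_continuous_onI by blast+
  have cm [measurable]: "cell L \<in> sets (borel :: (real^'n) measure)" by (simp add: cell_def)
  have B0: "B \<ge> 0" using B[of 0] by linarith
  define I where "I = (LINT x|lborel. G x * g ((1/\<epsilon>) *\<^sub>R x))"
  define vol where "vol = measure lborel (cell L :: (real^'n) set)"
  have vol: "vol > 0" unfolding vol_def by (rule cell_volume_pos[OF L])
  define N where "N = (LINT x|lborel. norm (grad G x))"
  have N: "N \<ge> 0" by (simp add: N_def)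
  obtain R where R: "R > 0" "\<And>x. norm x > R \<Longrightarrow> G x = 0" using G(2) csuppE by metis
  have iG: "integrable lborel G" using integrable_csupp[OF Gc G(2)] by (simp add: integrable_completion)
  have bm: "integrable lborel (\<lambda>x. k x * f x)" if "integrable lborel f" "k \<in> borel_measurable borel" "\<And>x. \<bar>k x\<bar> \<le> B"
    for f k :: "real^'n \<Rightarrow> real"
  proof (rule Bochner_Integration.integrable_bound)
    show "integrable lborel (\<lambda>x. B * f x)" using that by simp
    have "f \<in> borel_measurable borel" using that(1) by auto
    then show "(\<lambda>x. k x * f x) \<in> borel_measurable lborel" using that(2) by simp
    show "AE x in lborel. norm (k x * f x) \<le> norm (B * f x)"
      using that(3) B0 by (intro AE_I2) (simp add: abs_mult mult_right_mono)
  qed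
  \<comment> \<open>\<open>Q y\<close> is \<open>I\<close> after the substitution \<open>x + \<epsilon> y\<close>, except that \<open>G\<close> is still evaluated at \<open>x\<close>.\<close>
  define Q where "Q y = (LINT x|lborel. g ((1/\<epsilon>) *\<^sub>R x + y) * G x)" for y
  have near: "\<bar>I - Q y\<bar> \<le> \<epsilon> * (real CARD('n) * L * B * N)" if y: "y \<in> cell L" for y
  proof -
    have km: "(\<lambda>x. g ((1/\<epsilon>) *\<^sub>R x + y)) \<in> borel_measurable borel" by measurable
    have "I = (LINT x|lborel. G (x + \<epsilon> *\<^sub>R y) * g ((1/\<epsilon>) *\<^sub>R (x + \<epsilon> *\<^sub>R y)))"
      unfolding I_def by (rule lborel_integral_translate[symmetric]) measurable
    also have "\<dots> = (LINT x|lborel. g ((1/\<epsilon>) *\<^sub>R x + y) * G (x + \<epsilon> *\<^sub>R y))"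
      using e by (simp add: scaleR_add_right mult.commute)
    finally have "I - Q y = (LINT x|lborel. g ((1/\<epsilon>) *\<^sub>R x + y) * (G (x + \<epsilon> *\<^sub>R y) - G x))"
      unfolding Q_def right_diff_distrib
      using bm[OF iG km B] bm[OF L1_translation_bound(2)[OF G] km B] by simp
    also have "norm \<dots> \<le> (LINT x|lborel. B * \<bar>G (x + \<epsilon> *\<^sub>R y) - G x\<bar>)"
    proof (rule Bochner_Integration.integral_norm_bound_integral)
      have i: "integrable lborel (\<lambda>x. G (x + \<epsilon> *\<^sub>R y) - G x)" using L1_translation_bound(2)[OF G] iG by simp
      show "integrable lborel (\<lambda>x. g ((1/\<epsilon>) *\<^sub>R x + y) * (G (x + \<epsilon> *\<^sub>R y) - G x))" by (rule bm[OF i km B])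
      show "integrable lborel (\<lambda>x. B * \<bar>G (x + \<epsilon> *\<^sub>R y) - G x\<bar>)" using i by simp
    qed (use B in \<open>auto simp: abs_mult intro!: mult_right_mono\<close>)
    also have "\<dots> \<le> B * (norm (\<epsilon> *\<^sub>R y) * N)"
      using mult_left_mono[OF L1_translation_bound(1)[OF G, of "\<epsilon> *\<^sub>R y"] B0] by (simp add: N_def)
    also have "\<dots> \<le> B * (\<epsilon> * (real CARD('n) * L) * N)"
      using norm_cell_le[OF y] e B0 N by (intro mult_left_mono mult_right_mono) auto
    finally show ?thesis by (simp add: mult_ac)
  qed
  have "integrable lborel (\<lambda>p::(real^'n)\<times>(real^'n). indicator (cball 0 R \<times> cell L) p *\<^sub>R (G (fst p) * g ((1/\<epsilon>) *\<^sub>R fst p + snd p)))"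
  proof (rule borel_integrable_compact)
    show "compact (cball 0 R \<times> cell L :: ((real^'n)\<times>(real^'n)) set)" unfolding cell_def by (intro compact_Times compact_cbox compact_cball)
    show "continuous_on (cball 0 R \<times> cell L) (\<lambda>p::(real^'n)\<times>(real^'n). G (fst p) * g ((1/\<epsilon>) *\<^sub>R fst p + snd p))"
      by (intro continuous_intros continuous_on_compose2[OF Gc] continuous_on_compose2[OF g(1)]) auto
  qed
  moreover have "(\<lambda>p::(real^'n)\<times>(real^'n). indicator (cball 0 R \<times> cell L) p *\<^sub>R (G (fst p) * g ((1/\<epsilon>) *\<^sub>R fst p + snd p)))
     = (\<lambda>(x,y). indicator (cell L) y * (g ((1/\<epsilon>) *\<^sub>R x + y) * G x))"
    using R(2) by (force simp: indicator_def)
  ultimately have ip: "integrable (lborel \<Otimes>\<^sub>M lborel) (\<lambda>(x::real^'n,y::real^'n). indicator (cell L) y * (g ((1/\<epsilon>) *\<^sub>R x + y) * G x))"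
    by (simp add: lborel_prod)
  have "(LINT y|lborel. indicator (cell L) y * Q y) = (LINT y|lborel. LINT x|lborel. indicator (cell L) y * (g ((1/\<epsilon>) *\<^sub>R x + y) * G x))"
    unfolding Q_def by simp
  also have "\<dots> = (LINT x|lborel. LINT y|lborel. indicator (cell L) y * (g ((1/\<epsilon>) *\<^sub>R x + y) * G x))"
    by (rule lborel_pair.Fubini_integral[OF ip])
  also have "\<dots> = (LINT x|(lborel::(real^'n) measure). 0)"
  proof (rule Bochner_Integration.integral_cong[OF refl])
    fix x
    have "(LINT y|lborel. indicator (cell L) y * (g ((1/\<epsilon>) *\<^sub>R x + y) * G x)) = (LINT y|lborel. indicator (cell L) y * g (y + (1/\<epsilon>) *\<^sub>R x)) * G x"
      by (simp add: mult.assoc[symmetric] add.commute)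
    also have "(LINT y|lborel. indicator (cell L) y * g (y + (1/\<epsilon>) *\<^sub>R x)) = cell_integral L (\<lambda>y. g (y + (1/\<epsilon>) *\<^sub>R x))"
      unfolding cell_integral_def set_lebesgue_integral_def by (subst lebesgue_integral_lborel) auto
    also have "\<dots> = 0" using cell_integral_translate[OF g(1,2) L] g(3) by simp
    finally show "(LINT y|lborel. indicator (cell L) y * (g ((1/\<epsilon>) *\<^sub>R x + y) * G x)) = 0" by simp
  qed
  finally have Q0: "(LINT y|lborel. indicator (cell L) y * Q y) = 0" by simp
  have iQ: "integrable lborel (\<lambda>y. indicator (cell L) y * Q y)"
    using lborel_pair.integrable_snd[OF ip] by (simp add: Q_def)
  have ic: "integrable lborel (\<lambda>y::real^'n. indicator (cell L) y * c)" for c :: real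
    unfolding cell_def by (intro integrable_mult_left integrable_real_indicator emeasure_lborel_cbox_finite) auto
  have "vol * I = (LINT y|lborel. indicator (cell L) y * I - indicator (cell L) y * Q y)"
    using iQ ic Q0 by (simp add: vol_def)
  then have "vol * \<bar>I\<bar> = norm (LINT y|lborel. indicator (cell L) y * I - indicator (cell L) y * Q y)"
    using vol by (metis abs_mult abs_of_pos real_norm_def)
  also have "\<dots> \<le> (LINT y|lborel. indicator (cell L :: (real^'n) set) y * (\<epsilon> * (real CARD('n) * L * B * N)))"
  proof (rule Bochner_Integration.integral_norm_bound_integral)
    show "norm (indicator (cell L) y * I - indicator (cell L) y * Q y) \<le> indicator (cell L) y * (\<epsilon> * (real CARD('n) * L * B * N))" for y :: "real^'n"
      using near[of y] by (auto simp: indicator_def)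
  qed (use ic iQ in auto)
  also have "\<dots> = vol * (\<epsilon> * (real CARD('n) * L * B * N))" by (simp add: vol_def)
  finally have "\<bar>I\<bar> \<le> \<epsilon> * (real CARD('n) * L * B * N)" using vol by (simp only: mult_le_cancel_left_pos)
  moreover have "I = (LINT x|lebesgue. G x * g ((1/\<epsilon>) *\<^sub>R x))"
    unfolding I_def by (subst lebesgue_integral_lborel) auto
  moreover have "N = (LINT x|lebesgue. norm (grad G x))"
    unfolding N_def by (subst lebesgue_integral_lborel) auto
  ultimately show ?thesis by simp
qed

section \<open>Oscillating integrals with a weight, and the cell problem\<close>

lemma continuous_on_scaled: 
  "continuous_on UNIV (g :: real^'n::finite \<Rightarrow> 'b::topological_space) \<Longrightarrow> continuous_on UNIV (\<lambda>x. g (c *\<^sub>R x))"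
  by (rule continuous_on_compose2[of UNIV g]) (auto intro: continuous_intros)

locale smooth_weight = weight +
  assumes w_smooth: "smooth w"
begin

lemma test_function_sqint:
  assumes "test_function \<psi>" shows "sqint w \<psi>" "sqint w (grad \<psi>)"
  using sqint_csupp[OF test_functionD(3,2)[OF assms]]
    sqint_csupp[OF grad_continuous[OF test_functionD(1)[OF assms]] csupp_grad[OF test_functionD(2)[OF assms]]] by auto

lemma sqint_div_weight:
  assumes "continuous_on UNIV f" "csupp f" shows "sqint w (\<lambda>x. f x / w x)"
proof (rule sqint_csupp)
  show "continuous_on UNIV (\<lambda>x. f x / w x)"
    using w_cont w_pos by (intro continuous_intros assms) (auto simp: less_imp_neq[symmetric])
  show "csupp (\<lambda>x. f x / w x)" using assms(2) by (rule csupp_weaken) auto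
qed

text \<open>The bound must be uniform in \<open>\<psi>\<close>, because it will be used for
functions that depend on \<open>\<epsilon>\<close>. For a test
function in place of \<open>h\<close> the integral is of order \<open>\<epsilon>\<close> by \<open>oscillating_integral_bound\<close>; the error from
replacing \<open>h\<close> is controlled by the Cauchy-Schwarz inequality.\<close>

lemma weighted_oscillation:
  assumes h: "sqint w h" and g: "continuous_on UNIV g" "periodic L g" "cell_integral L g = 0"
    and L: "L > 0" and d: "d > 0"
  shows "\<forall>\<^sub>F \<epsilon> in at_right 0. \<forall>\<psi>. test_function \<psi> \<longrightarrow>
    \<bar>LINT x|lebesgue. h x * \<psi> x * g ((1/\<epsilon>) *\<^sub>R x) * w x\<bar> \<le> d * (wnorm w \<psi> + wnorm w (grad \<psi>))"
proof -
  obtain B where B: "B > 0" "\<And>x. norm (g x) \<le> B" using periodic_bounded[OF g(2) L g(1)] by metis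
  have "d / (2 * B) > 0" using d B by simp
  then obtain h0 where h0: "test_function h0" "wnorm w (\<lambda>x. h x - h0 x) < d / (2 * B)"
    using test_dense_L2[OF h] by blast
  define G0 where "G0 x = w x * h0 x" for x
  have G0: "test_function G0" unfolding G0_def by (rule test_function_mult[OF h0(1) w_smooth])
  define C where "C = wnorm w (\<lambda>x. norm (grad G0 x) / w x) + wnorm w h0"
  have C: "C \<ge> 0" unfolding C_def by (intro add_nonneg_nonneg wnorm_nonneg)
  \<comment> \<open>The summand \<open>1\<close> only makes \<open>K\<close> positive; \<open>K * \<epsilon>\<close> bounds the part with \<open>h0\<close> in place of \<open>h\<close>.\<close>
  define K where "K = real CARD('a) * L * B * C + 1"
  have K: "K > 0" unfolding K_def using L B C by (intro add_nonneg_pos mult_nonneg_nonneg) auto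
  have s1: "sqint w (\<lambda>x. norm (grad G0 x) / w x)"
    using sqint_div_weight[OF continuous_on_norm[OF grad_continuous[OF test_functionD(1)[OF G0]]]]
      csupp_grad[OF test_functionD(2)[OF G0]] by (metis (no_types, lifting) csupp_weaken norm_zero)
  note s0 = test_function_sqint[OF h0(1)]
  have main: "\<bar>LINT x|lebesgue. h x * \<psi> x * g ((1/\<epsilon>) *\<^sub>R x) * w x\<bar> \<le> d * (wnorm w \<psi> + wnorm w (grad \<psi>))"
    if \<psi>: "test_function \<psi>" and e: "0 < \<epsilon>" "\<epsilon> < d / (2 * K)" for \<psi> \<epsilon>
  proof -
    let ?N = "wnorm w \<psi> + wnorm w (grad \<psi>)"
    note sp = test_function_sqint[OF \<psi>]
    have n0: "wnorm w \<psi> \<ge> 0" "wnorm w (grad \<psi>) \<ge> 0" by (rule wnorm_nonneg)+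
    let ?V = "\<lambda>x. g ((1/\<epsilon>) *\<^sub>R x) * \<psi> x"
    have Vm: "?V \<in> borel_measurable lebesgue"
      by (intro continuous_imp_measurable_lebesgue continuous_intros continuous_on_scaled g test_functionD(3)[OF \<psi>])
    have Vb: "norm (?V x) \<le> B * norm (\<psi> x)" for x
      using mult_right_mono[OF B(2), of "\<bar>\<psi> x\<bar>"] by (simp add: abs_mult)
    have V: "sqint w ?V" "wnorm w ?V \<le> B * wnorm w \<psi>"
      using sqint_dominate[OF sp(1) Vm Vb] B(1) by auto
    have i1: "integrable lebesgue (\<lambda>x. ((h x - h0 x) \<bullet> ?V x) * w x)" by (rule sqint_inner[OF sqint_diff[OF h s0(1)] V(1)])
    have i2: "integrable lebesgue (\<lambda>x. (h0 x \<bullet> ?V x) * w x)" by (rule sqint_inner[OF s0(1) V(1)])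
    have "(LINT x|lebesgue. h x * \<psi> x * g ((1/\<epsilon>) *\<^sub>R x) * w x)
        = (LINT x|lebesgue. ((h x - h0 x) \<bullet> ?V x) * w x + (h0 x \<bullet> ?V x) * w x)"
      by (intro Bochner_Integration.integral_cong refl) (simp add: algebra_simps)
    also have "\<dots> = (LINT x|lebesgue. ((h x - h0 x) \<bullet> ?V x) * w x) + (LINT x|lebesgue. (h0 x \<bullet> ?V x) * w x)"
      using i1 i2 by simp
    also have "(LINT x|lebesgue. (h0 x \<bullet> ?V x) * w x) = (LINT x|lebesgue. (G0 x * \<psi> x) * g ((1/\<epsilon>) *\<^sub>R x))"
      by (intro Bochner_Integration.integral_cong refl) (simp add: G0_def mult_ac)
    finally have eq: "(LINT x|lebesgue. h x * \<psi> x * g ((1/\<epsilon>) *\<^sub>R x) * w x)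
       = (LINT x|lebesgue. ((h x - h0 x) \<bullet> ?V x) * w x) + (LINT x|lebesgue. (G0 x * \<psi> x) * g ((1/\<epsilon>) *\<^sub>R x))" .
    have b1: "\<bar>LINT x|lebesgue. ((h x - h0 x) \<bullet> ?V x) * w x\<bar> \<le> d / 2 * wnorm w \<psi>"
    proof -
      have "\<bar>LINT x|lebesgue. ((h x - h0 x) \<bullet> ?V x) * w x\<bar> \<le> wnorm w (\<lambda>x. h x - h0 x) * wnorm w ?V"
        by (rule weighted_Cauchy_Schwarz[OF sqint_diff[OF h s0(1)] V(1)])
      also have "\<dots> \<le> (d / (2 * B)) * (B * wnorm w \<psi>)"
        using h0(2) V(2) wnorm_nonneg d B by (intro mult_mono) auto
      also have "\<dots> = d / 2 * wnorm w \<psi>" using B(1) by simp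
      finally show ?thesis .
    qed
    let ?G = "\<lambda>x. G0 x * \<psi> x"
    have G: "Ck 1 ?G" "csupp ?G"
      using test_functionD(1)[OF G0] test_functionD(1)[OF \<psi>] test_functionD(2)[OF \<psi>]
      by (auto intro: Ck_mult csupp_weaken simp del: Ck.simps)
    have gradG: "grad ?G x = G0 x *\<^sub>R grad \<psi> x + \<psi> x *\<^sub>R grad G0 x" for x
      using partial_mult[OF test_functionD(4)[OF G0] test_functionD(4)[OF \<psi>]]
      by (simp add: grad_def vec_eq_iff mult.commute)
    have j1: "integrable lebesgue (\<lambda>x. ((norm (grad G0 x) / w x) \<bullet> \<bar>\<psi> x\<bar>) * w x)"
      and j1b: "\<bar>LINT x|lebesgue. ((norm (grad G0 x) / w x) \<bullet> \<bar>\<psi> x\<bar>) * w x\<bar> \<le> wnorm w (\<lambda>x. norm (grad G0 x) / w x) * wnorm w \<psi>"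
    proof -
      have a: "sqint w (\<lambda>x. \<bar>\<psi> x\<bar>)" "wnorm w (\<lambda>x. \<bar>\<psi> x\<bar>) = wnorm w \<psi>" using sp(1) by (auto simp: sqint_def wnorm_def)
      show "integrable lebesgue (\<lambda>x. ((norm (grad G0 x) / w x) \<bullet> \<bar>\<psi> x\<bar>) * w x)" by (rule sqint_inner[OF s1 a(1)])
      show "\<bar>LINT x|lebesgue. ((norm (grad G0 x) / w x) \<bullet> \<bar>\<psi> x\<bar>) * w x\<bar> \<le> wnorm w (\<lambda>x. norm (grad G0 x) / w x) * wnorm w \<psi>"
        using weighted_Cauchy_Schwarz[OF s1 a(1)] a(2) by simp
    qed
    have j2: "integrable lebesgue (\<lambda>x. (\<bar>h0 x\<bar> \<bullet> norm (grad \<psi> x)) * w x)"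
      and j2b: "\<bar>LINT x|lebesgue. (\<bar>h0 x\<bar> \<bullet> norm (grad \<psi> x)) * w x\<bar> \<le> wnorm w h0 * wnorm w (grad \<psi>)"
    proof -
      have a: "sqint w (\<lambda>x. \<bar>h0 x\<bar>)" "wnorm w (\<lambda>x. \<bar>h0 x\<bar>) = wnorm w h0" using s0(1) by (auto simp: sqint_def wnorm_def)
      have b: "sqint w (\<lambda>x. norm (grad \<psi> x))" "wnorm w (\<lambda>x. norm (grad \<psi> x)) = wnorm w (grad \<psi>)" using sp(2) by (auto simp: sqint_def wnorm_def)
      show "integrable lebesgue (\<lambda>x. (\<bar>h0 x\<bar> \<bullet> norm (grad \<psi> x)) * w x)" by (rule sqint_inner[OF a(1) b(1)])
      show "\<bar>LINT x|lebesgue. (\<bar>h0 x\<bar> \<bullet> norm (grad \<psi> x)) * w x\<bar> \<le> wnorm w h0 * wnorm w (grad \<psi>)"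
        using weighted_Cauchy_Schwarz[OF a(1) b(1)] a(2) b(2) by simp
    qed
    have "(LINT x|lebesgue. norm (grad ?G x)) \<le> (LINT x|lebesgue. ((norm (grad G0 x) / w x) \<bullet> \<bar>\<psi> x\<bar>) * w x + (\<bar>h0 x\<bar> \<bullet> norm (grad \<psi> x)) * w x)"
    proof (rule integral_mono)
      show "integrable lebesgue (\<lambda>x. norm (grad ?G x))"
        by (intro integrable_norm integrable_csupp grad_continuous csupp_grad G)
      show "norm (grad ?G x) \<le> ((norm (grad G0 x) / w x) \<bullet> \<bar>\<psi> x\<bar>) * w x + (\<bar>h0 x\<bar> \<bullet> norm (grad \<psi> x)) * w x" for x
      proof -
        have "norm (grad ?G x) \<le> \<bar>G0 x\<bar> * norm (grad \<psi> x) + \<bar>\<psi> x\<bar> * norm (grad G0 x)"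
          unfolding gradG by (rule order_trans[OF norm_triangle_ineq]) simp
        also have "\<dots> = ((norm (grad G0 x) / w x) \<bullet> \<bar>\<psi> x\<bar>) * w x + (\<bar>h0 x\<bar> \<bullet> norm (grad \<psi> x)) * w x"
          using w_pos[of x] by (simp add: G0_def abs_mult)
        finally show ?thesis .
      qed
    qed (use j1 j2 in auto)
    also have "\<dots> \<le> wnorm w (\<lambda>x. norm (grad G0 x) / w x) * wnorm w \<psi> + wnorm w h0 * wnorm w (grad \<psi>)"
      using j1 j2 j1b j2b by simp
    also have "\<dots> \<le> C * ?N"
    proof -
      have "0 \<le> wnorm w (\<lambda>x. norm (grad G0 x) / w x) * wnorm w (grad \<psi>) + wnorm w h0 * wnorm w \<psi>"
        using wnorm_nonneg n0 by (intro add_nonneg_nonneg mult_nonneg_nonneg) auto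
      then show ?thesis by (simp add: C_def algebra_simps)
    qed
    finally have gb: "(LINT x|lebesgue. norm (grad ?G x)) \<le> C * ?N" .
    have "\<bar>LINT x|lebesgue. (G0 x * \<psi> x) * g ((1/\<epsilon>) *\<^sub>R x)\<bar> \<le> \<epsilon> * (real CARD('a) * L * B * (LINT x|lebesgue. norm (grad ?G x)))"
      using B(2) by (intro oscillating_integral_bound[OF G g L _ e(1)]) simp
    also have "\<dots> \<le> \<epsilon> * (real CARD('a) * L * B * (C * ?N))"
      using e(1) L B gb by (intro mult_left_mono) auto
    also have "\<dots> \<le> \<epsilon> * (K * ?N)"
      using e(1) n0 by (intro mult_left_mono) (auto simp: K_def algebra_simps)
    also have "\<dots> \<le> (d / (2 * K)) * (K * ?N)"
      using e n0 K by (intro mult_right_mono) auto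
    also have "\<dots> = d / 2 * ?N" using K by simp
    finally have b2: "\<bar>LINT x|lebesgue. (G0 x * \<psi> x) * g ((1/\<epsilon>) *\<^sub>R x)\<bar> \<le> d / 2 * ?N" .
    have "\<bar>LINT x|lebesgue. h x * \<psi> x * g ((1/\<epsilon>) *\<^sub>R x) * w x\<bar> \<le> d / 2 * wnorm w \<psi> + d / 2 * ?N"
      unfolding eq using b1 b2 by linarith
    also have "\<dots> \<le> d * ?N" using n0 d by (simp add: algebra_simps)
    finally show ?thesis .
  qed
  have "d / (2 * K) > 0" using d K by simp
  then show ?thesis
    using main by (auto simp: eventually_at_right_field)
qed

end

lemma cell_integral_integrable:
  fixes g :: "real^'n::finite \<Rightarrow> real"
  assumes "continuous_on UNIV g"
  shows "set_integrable lebesgue (cell L) g"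
  using continuous_imp_locally_integrable[OF assms] unfolding locally_integrable_def cell_def
  using compact_cbox by blast

lemma cell_integral_linear:
  assumes "continuous_on UNIV f" "continuous_on UNIV g"
  shows "cell_integral L (\<lambda>y. f y + g y) = cell_integral L f + cell_integral L g" "cell_integral L (\<lambda>y. f y - g y) = cell_integral L f - cell_integral L g"
  using cell_integral_integrable[OF assms(1)] cell_integral_integrable[OF assms(2)] by (auto simp: cell_integral_def)

lemma cell_integral_scale: "cell_integral L (\<lambda>y. c * f y) = c * cell_integral L f"
  by (simp add: cell_integral_def)

lemma cell_integral_sum:
  assumes "\<And>i. i \<in> I \<Longrightarrow> continuous_on UNIV (f i)"
  shows "cell_integral L (\<lambda>y. \<Sum>i\<in>I. f i y) = (\<Sum>i\<in>I. cell_integral L (f i))"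
  using assms
proof (induction I rule: infinite_finite_induct)
  case (insert i I)
  then have "cell_integral L (\<lambda>y. f i y + (\<Sum>i\<in>I. f i y)) = cell_integral L (f i) + cell_integral L (\<lambda>y. \<Sum>i\<in>I. f i y)"
    by (intro cell_integral_linear(1) continuous_on_sum) auto
  then show ?case using insert by simp
qed (auto simp: cell_integral_def)

lemma cell_integral_pos:
  fixes g :: "real^'n::finite \<Rightarrow> real"
  assumes g: "continuous_on UNIV g" "\<And>y. g y > 0" and L: "L > 0"
  shows "cell_integral L g > 0"
proof -
  have c: "compact (cell L :: (real^'n) set)" "cell L \<noteq> ({} :: (real^'n) set)" "continuous_on (cell L) g"
  proof -
    have "(0 :: real^'n) \<in> cell L" using L by (simp add: mem_cell)
    then show "cell L \<noteq> ({} :: (real^'n) set)" by blast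
  qed (auto simp: cell_def intro: continuous_on_subset[OF g(1)])
  then obtain q where q: "q \<in> cell L" "\<And>y. y \<in> cell L \<Longrightarrow> g q \<le> g y" using continuous_attains_inf by metis
  have "g q * measure lborel (cell L :: (real^'n) set) = cell_integral L (\<lambda>y::real^'n. g q * 1)"
    unfolding cell_integral_def set_lebesgue_integral_def cell_def by (simp add: mult.commute)
  also have "\<dots> \<le> cell_integral L g"
    unfolding cell_integral_def using q(2) by (intro set_integral_mono cell_integral_integrable g continuous_intros) auto
  finally show ?thesis using cell_volume_pos[OF L, where 'n='n] g(2)[of q] by (smt (verit) mult_pos_pos)
qed

definition cell_mean :: "real \<Rightarrow> (real^'n::finite \<Rightarrow> real) \<Rightarrow> real" where
  "cell_mean L g = cell_integral L g / cell_integral L (\<lambda>_::real^'n. 1)"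

lemma cell_integral_minus_cell_mean:
  fixes g :: "real^'n::finite \<Rightarrow> real"
  assumes "continuous_on UNIV g" "L > 0"
  shows "cell_integral L (\<lambda>y. g y - cell_mean L g) = 0"
proof -
  have "cell_integral L (\<lambda>_::real^'n. 1) > 0" using assms by (intro cell_integral_pos) auto
  moreover have "cell_integral L (\<lambda>y::real^'n. cell_mean L g * 1) = cell_mean L g * cell_integral L (\<lambda>_::real^'n. 1)" by (rule cell_integral_scale)
  ultimately show ?thesis using cell_integral_linear(2)[OF assms(1), of "\<lambda>_. cell_mean L g"] by (simp add: cell_mean_def)
qed

lemma periodic_partial:
  assumes "Ck 1 F" "periodic L F" shows "periodic L (partial i F)"
  unfolding periodic_def
proof (intro allI)
  fix x j
  have "(\<lambda>x. F (axis j L + 1 *\<^sub>R x)) = F" using assms(2) by (auto simp: periodic_def add.commute)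
  moreover have "partial i (\<lambda>x. F (axis j L + 1 *\<^sub>R x)) x = 1 * partial i F (axis j L + 1 *\<^sub>R x)"
    using assms(1) by (intro partial_affine(1)) auto
  ultimately show "partial i F (x + axis j L) = partial i F x" by (simp add: add.commute)
qed

text \<open>The function \<open>partial i F (x / \<epsilon>)\<close> is the derivative of \<open>\<epsilon> * F (x / \<epsilon>)\<close>. Integrated against a bump it is of
order \<open>\<epsilon>\<close> by an integration by parts. But it also differs by order \<open>\<epsilon>\<close> from its mean times the
integral of the bump, so the mean vanishes.\<close>

lemma cell_integral_partial_zero:
  fixes F :: "real^'n::finite \<Rightarrow> real"
  assumes F: "Ck 1 F" "periodic L F" and L: "L > 0"
  shows "cell_integral L (partial i F) = 0"
proof -
  let ?g = "partial i F"
  define c where "c = cell_mean L ?g"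
  have gc: "continuous_on UNIV ?g" using F(1) by simp
  have gp: "periodic L ?g" using F by (rule periodic_partial)
  have Fc: "continuous_on UNIV F" using F(1) Ck_continuous by blast
  have hp: "periodic L (\<lambda>y. ?g y - c)" using gp by (auto simp: periodic_def)
  have hc: "continuous_on UNIV (\<lambda>y. ?g y - c)" by (intro continuous_intros gc)
  obtain B where B: "B > 0" "\<And>x. norm (?g x - c) \<le> B" using periodic_bounded[OF hp L hc] by metis
  obtain M where M: "M > 0" "\<And>x. norm (F x) \<le> M" using periodic_bounded[OF F(2) L Fc] by metis
  let ?b = "bump :: real^'n \<Rightarrow> real"
  note b = test_functionD[OF test_function_bump, where 'a='n]
  note pb = test_functionD[OF test_function_partial[OF test_function_bump, of i]]
  define Z where "Z = (LINT x|lebesgue. ?b x)"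
  have Z: "Z > 0" unfolding Z_def by (rule integral_pos_continuous[OF b(3,2), where a=0]) (auto simp: bump_nonneg)
  define C where "C = real CARD('n) * L * B * (LINT x|lebesgue. norm (grad ?b x)) + M * (LINT x|lebesgue. \<bar>partial i ?b x\<bar>)"
  have key: "\<bar>c\<bar> * Z \<le> \<epsilon> * C" if e: "\<epsilon> > 0" for \<epsilon>
  proof -
    have F1: "Ck 1 (\<lambda>x. \<epsilon> * F (0 + (1/\<epsilon>) *\<^sub>R x))" by (intro Ck_mult Ck_const Ck_affine F)
    have d: "partial i (\<lambda>x. \<epsilon> * F (0 + (1/\<epsilon>) *\<^sub>R x)) x = ?g ((1/\<epsilon>) *\<^sub>R x)" for x
    proof -
      have "F differentiable (at (0 + (1/\<epsilon>) *\<^sub>R x))" using F(1) by simp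
      note p = partial_affine[OF this]
      show ?thesis using partial_mult[OF _ p(2), of "\<lambda>_. \<epsilon>" i] p(1)[of i] e by simp
    qed
    have ib: "integrable lebesgue (\<lambda>x. ?b x * ?g ((1/\<epsilon>) *\<^sub>R x))"
      using b by (intro integrable_csupp continuous_intros continuous_on_scaled gc) (auto intro: csupp_weaken)
    have ib0: "integrable lebesgue ?b" using b integrable_csupp by blast
    have "\<bar>LINT x|lebesgue. ?b x * (?g ((1/\<epsilon>) *\<^sub>R x) - c)\<bar> \<le> \<epsilon> * (real CARD('n) * L * B * (LINT x|lebesgue. norm (grad ?b x)))"
      using B(2) cell_integral_minus_cell_mean[OF gc L] 
      by (intro oscillating_integral_bound[OF b(1,2) hc hp _ L _ e]) (auto simp: c_def)
    moreover have "(LINT x|lebesgue. ?b x * (?g ((1/\<epsilon>) *\<^sub>R x) - c)) = (LINT x|lebesgue. ?b x * ?g ((1/\<epsilon>) *\<^sub>R x)) - c * Z"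
      unfolding Z_def right_diff_distrib using ib ib0 by (simp add: mult.commute)
    moreover have "\<bar>LINT x|lebesgue. ?b x * ?g ((1/\<epsilon>) *\<^sub>R x)\<bar> \<le> \<epsilon> * (M * (LINT x|lebesgue. \<bar>partial i ?b x\<bar>))"
    proof -
      have i: "integrable lebesgue (\<lambda>x. \<epsilon> * F (0 + (1/\<epsilon>) *\<^sub>R x) * partial i ?b x)"
        by (intro integrable_csupp continuous_on_mult[OF Ck_continuous[OF F1]] pb csupp_weaken[OF pb(2)]) simp
      have "(LINT x|lebesgue. \<epsilon> * F (0 + (1/\<epsilon>) *\<^sub>R x) * partial i ?b x) = - (LINT x|lebesgue. ?g ((1/\<epsilon>) *\<^sub>R x) * ?b x)"
        using integral_by_parts[OF F1 b(1,2), of i] by (simp only: d)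
      then have "\<bar>LINT x|lebesgue. ?b x * ?g ((1/\<epsilon>) *\<^sub>R x)\<bar> = norm (LINT x|lebesgue. \<epsilon> * F (0 + (1/\<epsilon>) *\<^sub>R x) * partial i ?b x)"
        by (simp add: mult.commute)
      also have "\<dots> \<le> (LINT x|lebesgue. \<epsilon> * M * \<bar>partial i ?b x\<bar>)"
      proof (rule Bochner_Integration.integral_norm_bound_integral[OF i])
        show "integrable lebesgue (\<lambda>x. \<epsilon> * M * \<bar>partial i ?b x\<bar>)"
          by (intro integrable_mult_right integrable_abs integrable_csupp pb)
        show "norm (\<epsilon> * F (0 + (1/\<epsilon>) *\<^sub>R x) * partial i ?b x) \<le> \<epsilon> * M * \<bar>partial i ?b x\<bar>" for x
          using M(2)[of "(1/\<epsilon>) *\<^sub>R x"] e by (simp add: abs_mult mult_right_mono mult_left_mono)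
      qed
      finally show ?thesis by simp
    qed
    moreover have "\<bar>c\<bar> * Z = \<bar>c * Z\<bar>" using Z by (simp add: abs_mult)
    ultimately show ?thesis by (simp only: C_def distrib_left)
  qed
  have "c = 0"
  proof (rule ccontr)
    assume "c \<noteq> 0"
    then have cz: "\<bar>c\<bar> * Z > 0" using Z by simp
    have "C > 0" using key[of 1] cz by linarith
    then have "\<bar>c\<bar> * Z \<le> \<bar>c\<bar> * Z / 2" using key[of "\<bar>c\<bar> * Z / (2 * C)"] cz by simp
    then show False using cz by linarith
  qed
  moreover have "cell_integral L (\<lambda>_::real^'n. 1) > 0" using L by (intro cell_integral_pos) auto
  ultimately show ?thesis by (simp add: c_def cell_mean_def)
qed

text \<open>The \<open>j\<close>-th component of the vector field \<open>exp (- p / \<sigma>) * (e\<^sub>k + \<nabla>\<Phi>\<^sub>k)\<close>.\<close>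

definition cell_flux :: "real \<Rightarrow> (real^'n::finite \<Rightarrow> real) \<Rightarrow> (real^'n \<Rightarrow> real^'n) \<Rightarrow> 'n \<Rightarrow> 'n \<Rightarrow> real^'n \<Rightarrow> real" where
  "cell_flux \<sigma> p \<Phi> k j y = exp (- (1 / \<sigma>) * p y) * ((if k = j then 1 else 0) + partial j (\<lambda>z. \<Phi> z $ k) y)"

lemma jacobian_entry:
  assumes "\<And>k. Ck 1 (\<lambda>y. \<Phi> y $ k)"
  shows "jacobian \<Phi> (at y) $ k $ j = partial j (\<lambda>z. \<Phi> z $ k) y"
proof -
  have "(\<Phi> has_derivative (\<lambda>h. \<chi> k. grad (\<lambda>z. \<Phi> z $ k) y \<bullet> h)) (at y)"
  proof (rule iffD2[OF has_derivative_componentwise_within], rule)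
    fix b :: "real^'a" assume "b \<in> Basis"
    then obtain i where b: "b = axis i 1" by (auto simp: Basis_vec_def)
    have "((\<lambda>z. \<Phi> z $ i) has_derivative (\<lambda>h. grad (\<lambda>z. \<Phi> z $ i) y \<bullet> h)) (at y)"
      using assms by (intro has_derivative_grad) auto
    then show "((\<lambda>x. \<Phi> x \<bullet> b) has_derivative (\<lambda>h. (\<chi> k. grad (\<lambda>z. \<Phi> z $ k) y \<bullet> h) \<bullet> b)) (at y)"
      by (simp add: b inner_axis)
  qed
  from frechet_derivative_at[OF this]
  have "frechet_derivative \<Phi> (at y) = (\<lambda>h. \<chi> k. grad (\<lambda>z. \<Phi> z $ k) y \<bullet> h)" by simp
  then show ?thesis by (simp add: jacobian_def matrix_def inner_axis grad_def)
qed

locale cell_problem =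
  fixes \<sigma> L :: real and p :: "real^'n::finite \<Rightarrow> real" and \<Phi> :: "real^'n \<Rightarrow> real^'n"
  assumes \<sigma>: "\<sigma> > 0" and L: "L > 0" and p_smooth: "smooth p" and p_per: "periodic L p"
    and sol: "cell_solution \<sigma> L p \<Phi>"
begin

abbreviation m :: "real^'n \<Rightarrow> real" where "m y \<equiv> exp (- (1 / \<sigma>) * p y)"
abbreviation corrector :: "'n \<Rightarrow> real^'n \<Rightarrow> real" where "corrector k \<equiv> (\<lambda>y. \<Phi> y $ k)"
abbreviation flux :: "'n \<Rightarrow> 'n \<Rightarrow> real^'n \<Rightarrow> real" where "flux \<equiv> cell_flux \<sigma> p \<Phi>"

lemma m_Ck: "Ck k m"
  using p_smooth by (intro Ck_exp Ck_mult Ck_const) (auto simp: smooth_def)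

lemma m_cont: "continuous_on UNIV m" using m_Ck Ck_continuous by blast

lemma m_per: "periodic L m" using p_per by (simp add: periodic_def)

lemma corrector_C2: "Ck (Suc (Suc 0)) (corrector k)"
  using sol by (simp add: cell_solution_def numeral_2_eq_2 del: Ck.simps)

lemma corrector_C1: "Ck 1 (corrector k)" by (rule Ck_mono[OF _ corrector_C2]) simp

lemma corrector_cont: "continuous_on UNIV (corrector k)" using Ck_continuous[OF corrector_C1] .

lemma corrector_partial_C1: "Ck 1 (partial j (corrector k))" using Ck_SucD(2)[OF corrector_C2] by simp

lemma corrector_per: "periodic L (corrector k)" using sol by (simp add: cell_solution_def periodic_def)

lemma flux_C1: "Ck 1 (flux k j)"
  unfolding cell_flux_def[abs_def] by (intro Ck_mult m_Ck Ck_add Ck_const corrector_partial_C1)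

lemma flux_cont: "continuous_on UNIV (flux k j)" using Ck_continuous[OF flux_C1] .

lemma flux_per: "periodic L (flux k j)"
  using m_per periodic_partial[OF corrector_C1 corrector_per] by (auto simp: cell_flux_def periodic_def)

text \<open>The equation is required on one cell only; both sides are periodic.\<close>

lemma cell_equation:
  "\<sigma> * laplacian (corrector k) y = (\<Sum>j\<in>UNIV. partial j (corrector k) y * partial j p y) + partial k p y"
proof -
  define r where "r y = \<sigma> * laplacian (corrector k) y - (\<Sum>j\<in>UNIV. partial j (corrector k) y * partial j p y) - partial k p y" for y
  have "r y = 0" if "y \<in> cell L" for y
  proof -
    have "- (\<sigma> *\<^sub>R (\<chi> i. laplacian (corrector i) y)) + jacobian \<Phi> (at y) *v grad p y = - grad p y"
      using sol that unfolding cell_solution_def by blast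
    from arg_cong[OF this, of "\<lambda>v. v $ k"] show ?thesis
      by (simp add: r_def matrix_vector_mult_def jacobian_entry[OF corrector_C1] grad_def)
  qed
  moreover have "periodic L r"
  proof -
    have p1: "Ck 1 p" using p_smooth by (auto simp: smooth_def simp del: Ck.simps)
    note ps = periodic_partial[OF p1 p_per] periodic_partial[OF corrector_C1 corrector_per]
      periodic_partial[OF corrector_partial_C1 periodic_partial[OF corrector_C1 corrector_per]]
    show ?thesis using ps by (simp add: r_def laplacian_def periodic_def)
  qed
  ultimately have "r y = 0" using periodic_cell_representative[OF _ L, of r y] by metis
  then show ?thesis by (simp add: r_def)
qed

text \<open>The cell equation multiplied by \<open>exp (- p / \<sigma>) / \<sigma>\<close>.\<close>

lemma flux_divergence_free: "(\<Sum>j\<in>UNIV. partial j (flux k j) y) = 0"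
proof -
  have dp: "p differentiable (at y)" using p_smooth Ck_SucD(1)[of 0 p] by (auto simp: smooth_def simp del: Ck.simps)
  have dm: "partial j m y = - (1/\<sigma>) * partial j p y * m y" "m differentiable (at y)" for j
  proof -
    have d: "((\<lambda>t. exp (- (1 / \<sigma>) * t)) has_real_derivative - (1/\<sigma>) * m y) (at (p y))"
      using \<sigma> by (auto intro!: derivative_eq_intros)
    show "partial j m y = - (1/\<sigma>) * partial j p y * m y" using partial_compose(1)[OF dp d] by simp
    show "m differentiable (at y)" using partial_compose(2)[OF dp d] .
  qed
  have "partial j (flux k j) y = m y * partial j (partial j (corrector k)) y - (1/\<sigma>) * m y * (partial j p y * ((if k = j then 1 else 0) + partial j (corrector k) y))" for j
  proof -
    have dk: "partial j (corrector k) differentiable (at y)" using corrector_partial_C1 by simp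
    have dk2: "(\<lambda>y. (if k = j then 1 else 0) + partial j (corrector k) y) differentiable (at y)"
      "partial j (\<lambda>y. (if k = j then 1 else 0) + partial j (corrector k) y) y = partial j (partial j (corrector k)) y"
      using partial_add[OF _ dk, of "\<lambda>_. if k = j then 1 else 0" j] dk by auto
    have "partial j (flux k j) y = m y * partial j (\<lambda>y. (if k = j then 1 else 0) + partial j (corrector k) y) y
        + partial j m y * ((if k = j then 1 else 0) + partial j (corrector k) y)"
      unfolding cell_flux_def[abs_def] by (rule partial_mult[OF dm(2) dk2(1)])
    then show ?thesis by (simp only: dk2(2) dm(1)) (simp add: mult_ac)
  qed
  then have "(\<Sum>j\<in>UNIV. partial j (flux k j) y) = m y * laplacian (corrector k) y - (1/\<sigma>) * m y * (\<Sum>j\<in>UNIV. partial j p y * ((if k = j then 1 else 0) + partial j (corrector k) y))"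
    by (simp add: sum_subtractf sum_distrib_left laplacian_def)
  also have "(\<Sum>j\<in>UNIV. partial j p y * ((if k = j then 1 else 0) + partial j (corrector k) y)) = \<sigma> * laplacian (corrector k) y"
    unfolding cell_equation by (simp add: distrib_left sum.distrib mult.commute if_distrib[of "(*) _"] cong: if_cong)
  finally have e: "(\<Sum>j\<in>UNIV. partial j (flux k j) y) = m y * laplacian (corrector k) y - (1/\<sigma>) * m y * (\<sigma> * laplacian (corrector k) y)" .
  have "\<sigma> \<noteq> 0" using \<sigma> by simp
  then show ?thesis unfolding e by (simp add: field_simps)
qed

lemma K_entry: "K_matrix \<sigma> L p \<Phi> $ k $ j = cell_integral L (flux k j) / cell_integral L m"
proof -
  let ?F = "\<lambda>y. mu \<sigma> L p y *\<^sub>R (mat 1 + jacobian \<Phi> (at y)) :: real^'n^'n"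
  have ent: "?F y $ k $ j = flux k j y / cell_integral L m" for y k j
    by (simp add: mu_def cell_flux_def cell_integral_def jacobian_entry[OF corrector_C1] mat_def)
  have c: "continuous_on UNIV ?F"
  proof -
    have "?F = (\<lambda>y. \<chi> k j. flux k j y / cell_integral L m)" by (auto simp: vec_eq_iff ent simp del: vector_scaleR_component)
    moreover have "continuous_on UNIV (\<lambda>y. \<chi> k j. flux k j y / cell_integral L m)"
      using cell_integral_pos[OF m_cont _ L] flux_cont by (intro continuous_on_vec_lambda continuous_on_divide continuous_on_const) auto
    ultimately show ?thesis by (simp only:)
  qed
  have "integrable lebesgue (\<lambda>y. indicator (cell L) y *\<^sub>R ?F y)"
    using continuous_imp_locally_integrable[OF c] compact_cbox unfolding locally_integrable_def set_integrable_def cell_def by blast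
  note i = this integrable_bounded_linear[OF bounded_linear_vec_nth this]
  have "K_matrix \<sigma> L p \<Phi> $ k $ j = (LINT y|lebesgue. (indicator (cell L) y *\<^sub>R ?F y) $ k $ j)"
    unfolding K_matrix_def set_lebesgue_integral_def
    by (simp only: integral_bounded_linear[OF bounded_linear_vec_nth i(1), symmetric] integral_bounded_linear[OF bounded_linear_vec_nth i(2), symmetric])
  also have "\<dots> = (LINT y|lebesgue. indicator (cell L) y *\<^sub>R (flux k j y / cell_integral L m))"
    by (intro Bochner_Integration.integral_cong refl) (simp only: vector_scaleR_component[of "indicator _ _"] ent)
  also have "\<dots> = cell_integral L (flux k j) / cell_integral L m" by (simp add: cell_integral_def set_lebesgue_integral_def)
  finally show ?thesis .
qed

text \<open>Multiplying the divergence free field \<open>flux k\<close> by the corrector \<open>j\<close> shows that adding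
\<open>\<nabla>\<Phi>\<^sub>j \<bullet> flux k\<close> does not change the mean. The mean of \<open>flux k j\<close> is therefore that of
\<open>m * (e\<^sub>k + \<nabla>\<Phi>\<^sub>k) \<bullet> (e\<^sub>j + \<nabla>\<Phi>\<^sub>j)\<close>.\<close>

lemma flux_mean_symmetric: "cell_integral L (flux k j) = cell_integral L (flux j k)"
proof -
  have sq: "cell_integral L (flux k j) = cell_integral L (\<lambda>y. \<Sum>l\<in>UNIV. m y * ((if k = l then 1 else 0) + partial l (corrector k) y) * ((if j = l then 1 else 0) + partial l (corrector j) y))" for k j
  proof -
    have "partial l (\<lambda>y. corrector j y * flux k l y) y = corrector j y * partial l (flux k l) y + partial l (corrector j) y * flux k l y" for l y
      using corrector_C1 flux_C1 by (intro partial_mult) auto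
    then have pe: "partial l (\<lambda>y. corrector j y * flux k l y) = (\<lambda>y. corrector j y * partial l (flux k l) y + partial l (corrector j) y * flux k l y)" for l by auto
    have C1: "Ck 1 (\<lambda>y. corrector j y * flux k l y)" for l by (intro Ck_mult corrector_C1 flux_C1)
    have per: "periodic L (\<lambda>y. corrector j y * flux k l y)" for l using corrector_per[of j] flux_per[of k l] by (simp add: periodic_def)
    have "(\<Sum>l\<in>UNIV. cell_integral L (partial l (\<lambda>y. corrector j y * flux k l y))) = 0" using cell_integral_partial_zero[OF C1 per L] by simp
    then have "cell_integral L (\<lambda>y. \<Sum>l\<in>UNIV. partial l (\<lambda>y. corrector j y * flux k l y) y) = 0"
      using C1 by (subst cell_integral_sum) auto
    also have "(\<lambda>y. \<Sum>l\<in>UNIV. partial l (\<lambda>y. corrector j y * flux k l y) y) = (\<lambda>y. \<Sum>l\<in>UNIV. partial l (corrector j) y * flux k l y)"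
      unfolding pe by (simp add: sum.distrib flux_divergence_free flip: sum_distrib_left)
    finally have z: "cell_integral L (\<lambda>y. \<Sum>l\<in>UNIV. partial l (corrector j) y * flux k l y) = 0" .
    have c: "continuous_on UNIV (\<lambda>y. \<Sum>l\<in>UNIV. partial l (corrector j) y * flux k l y)"
      using Ck_continuous[OF corrector_partial_C1] flux_cont by (intro continuous_intros)
    have "cell_integral L (\<lambda>y. flux k j y + (\<Sum>l\<in>UNIV. partial l (corrector j) y * flux k l y)) = cell_integral L (flux k j)"
      using cell_integral_linear(1)[OF flux_cont c] z by simp
    moreover have "flux k j y + (\<Sum>l\<in>UNIV. partial l (corrector j) y * flux k l y)
        = (\<Sum>l\<in>UNIV. m y * ((if k = l then 1 else 0) + partial l (corrector k) y) * ((if j = l then 1 else 0) + partial l (corrector j) y))" for y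
    proof -
      have "(\<Sum>l\<in>UNIV. m y * ((if k = l then 1 else 0) + partial l (corrector k) y) * ((if j = l then 1 else 0) + partial l (corrector j) y))
        = (\<Sum>l\<in>UNIV. flux k l y * (if j = l then 1 else 0)) + (\<Sum>l\<in>UNIV. partial l (corrector j) y * flux k l y)"
        unfolding sum.distrib[symmetric] by (intro sum.cong refl) (simp add: cell_flux_def algebra_simps)
      moreover have "(\<Sum>l\<in>UNIV. flux k l y * (if j = l then 1 else 0)) = flux k j y"
        by (simp add: if_distrib[of "(*) _"] cong: if_cong)
      ultimately show ?thesis by (simp only:)
    qed
    ultimately show ?thesis by simp
  qed
  show ?thesis unfolding sq[of k j] sq[of j k] by (simp add: mult_ac)
qed

end

section \<open>The energy form and oscillating coefficients\<close>

lemma partial_scaled: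
  fixes f :: "real^'n::finite \<Rightarrow> real"
  assumes "Ck 1 f"
  shows "partial i (\<lambda>x. f (c *\<^sub>R x)) x = c * partial i f (c *\<^sub>R x)"
    and "(\<lambda>x. f (c *\<^sub>R x)) differentiable (at x)"
  using partial_affine[of f 0 c x] assms by auto

lemma Ck_scaled: "Ck k f \<Longrightarrow> Ck k (\<lambda>x. f (c *\<^sub>R x))"
  using Ck_affine[of k f 0 c] by simp

context weight begin

lemma weighted_inner_bound:
  assumes a: "continuous_on UNIV a" "\<And>x. 0 \<le> a x" "\<And>x. a x \<le> A" and U: "sqint w U" and V: "sqint w V"
  shows "integrable lebesgue (\<lambda>x. (U x \<bullet> V x) * (a x * w x))"
    and "\<bar>LINT x|lebesgue. (U x \<bullet> V x) * (a x * w x)\<bar> \<le> A * (wnorm w U * wnorm w V)"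
proof -
  have e: "(\<lambda>x. (U x \<bullet> V x) * (a x * w x)) = (\<lambda>x. ((a x *\<^sub>R U x) \<bullet> V x) * w x)" by (auto simp: mult_ac)
  have A: "A \<ge> 0" using order_trans[OF a(2,3)] .
  have am: "a \<in> borel_measurable lebesgue" using a(1) continuous_imp_measurable_lebesgue by blast
  have m: "(\<lambda>x. a x *\<^sub>R U x) \<in> borel_measurable lebesgue" using am U unfolding sqint_def by (intro borel_measurable_scaleR) auto
  have b: "norm (a x *\<^sub>R U x) \<le> A * norm (U x)" for x using a by (simp add: mult_right_mono)
  note d = sqint_dominate[OF U m b A]
  show "integrable lebesgue (\<lambda>x. (U x \<bullet> V x) * (a x * w x))" unfolding e by (rule sqint_inner[OF d(1) V])
  have "\<bar>LINT x|lebesgue. (U x \<bullet> V x) * (a x * w x)\<bar> \<le> wnorm w (\<lambda>x. a x *\<^sub>R U x) * wnorm w V"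
    unfolding e by (rule weighted_Cauchy_Schwarz[OF d(1) V])
  also have "\<dots> \<le> (A * wnorm w U) * wnorm w V" using d(2) wnorm_nonneg by (intro mult_right_mono) auto
  finally show "\<bar>LINT x|lebesgue. (U x \<bullet> V x) * (a x * w x)\<bar> \<le> A * (wnorm w U * wnorm w V)" by (simp add: mult.assoc)
qed

lemma weighted_inner_lower:
  assumes a: "continuous_on UNIV a" "\<And>x. a0 \<le> a x" "0 \<le> a0" "\<And>x. a x \<le> A" and U: "sqint w U"
  shows "a0 * (wnorm w U)\<^sup>2 \<le> (LINT x|lebesgue. (U x \<bullet> U x) * (a x * w x))"
proof -
  have a2: "0 \<le> a x" for x using a(2)[of x] a(3) by linarith
  have "a0 * (wnorm w U)\<^sup>2 = (LINT x|lebesgue. a0 * ((norm (U x))\<^sup>2 * w x))" by (simp add: wnorm_square)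
  also have "\<dots> \<le> (LINT x|lebesgue. (U x \<bullet> U x) * (a x * w x))"
  proof (rule integral_mono)
    show "integrable lebesgue (\<lambda>x. a0 * ((norm (U x))\<^sup>2 * w x))" using U by (simp add: sqint_def)
    show "integrable lebesgue (\<lambda>x. (U x \<bullet> U x) * (a x * w x))" by (rule weighted_inner_bound(1)[OF a(1) a2 a(4) U U])
    show "a0 * ((norm (U x))\<^sup>2 * w x) \<le> (U x \<bullet> U x) * (a x * w x)" for x
      using mult_right_mono[OF a(2)[of x], of "(norm (U x))\<^sup>2 * w x"] w_nonneg[of x]
      by (simp add: power2_norm_eq_inner mult_ac)
  qed
  finally show ?thesis .
qed

text \<open>Equivalent to the norm of the inner product \<open>H1_inner\<close>; as a sum it adds up with bounds for the two
parts.\<close>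

definition H1_sum_norm :: "(real^'n \<Rightarrow> real) \<Rightarrow> (real^'n \<Rightarrow> real^'n) \<Rightarrow> real" where
  "H1_sum_norm u g = wnorm w u + wnorm w g"

definition energy_form :: "real \<Rightarrow> real \<Rightarrow> (real^'n \<Rightarrow> real) \<Rightarrow> (real^'n \<Rightarrow> real) \<Rightarrow> (real^'n \<Rightarrow> real^'n) \<Rightarrow> (real^'n \<Rightarrow> real) \<Rightarrow> (real^'n \<Rightarrow> real^'n) \<Rightarrow> real" where
  "energy_form s t a u g v h = s * (LINT x|lebesgue. (g x \<bullet> h x) * (a x * w x)) + t * (LINT x|lebesgue. (u x \<bullet> v x) * (a x * w x))"

lemma energy_form_diff:
  assumes a: "continuous_on UNIV a" "\<And>x. 0 \<le> a x" "\<And>x. a x \<le> A"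
    and "sqint w u" "sqint w g" "sqint w v" "sqint w h" "sqint w u'" "sqint w g'" 
  shows "energy_form s t a (\<lambda>x. u x - u' x) (\<lambda>x. g x - g' x) v h = energy_form s t a u g v h - energy_form s t a u' g' v h"
    and "energy_form s t a v h (\<lambda>x. u x - u' x) (\<lambda>x. g x - g' x) = energy_form s t a v h u g - energy_form s t a v h u' g'"
proof -
  note i = weighted_inner_bound(1)[OF a]
  show "energy_form s t a (\<lambda>x. u x - u' x) (\<lambda>x. g x - g' x) v h = energy_form s t a u g v h - energy_form s t a u' g' v h"
    "energy_form s t a v h (\<lambda>x. u x - u' x) (\<lambda>x. g x - g' x) = energy_form s t a v h u g - energy_form s t a v h u' g'"
    unfolding energy_form_def inner_diff_left inner_diff_right left_diff_distrib
    using i[OF assms(5,7)] i[OF assms(9,7)] i[OF assms(4,6)] i[OF assms(8,6)]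
      i[OF assms(7,5)] i[OF assms(7,9)] i[OF assms(6,4)] i[OF assms(6,8)]
    by (simp_all add: right_diff_distrib)
qed

lemma energy_form_bound:
  assumes a: "continuous_on UNIV a" "\<And>x. 0 \<le> a x" "\<And>x. a x \<le> A" and st: "s \<ge> 0" "t \<ge> 0"
    and "sqint w u" "sqint w g" "sqint w v" "sqint w h"
  shows "\<bar>energy_form s t a u g v h\<bar> \<le> (s + t) * A * (H1_sum_norm u g * H1_sum_norm v h)"
proof -
  have A: "A \<ge> 0" using order_trans[OF a(2,3)] .
  note n = wnorm_nonneg[of u] wnorm_nonneg[of v] wnorm_nonneg[of g] wnorm_nonneg[of h]
  have 1: "\<bar>LINT x|lebesgue. (g x \<bullet> h x) * (a x * w x)\<bar> \<le> A * (H1_sum_norm u g * H1_sum_norm v h)"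
    by (rule order_trans[OF weighted_inner_bound(2)[OF a assms(7,9)]])
      (use A n in \<open>auto simp: H1_sum_norm_def intro!: mult_left_mono mult_mono add_nonneg_nonneg\<close>)
  have 2: "\<bar>LINT x|lebesgue. (u x \<bullet> v x) * (a x * w x)\<bar> \<le> A * (H1_sum_norm u g * H1_sum_norm v h)"
    by (rule order_trans[OF weighted_inner_bound(2)[OF a assms(6,8)]])
      (use A n in \<open>auto simp: H1_sum_norm_def intro!: mult_left_mono mult_mono add_nonneg_nonneg\<close>)
  have "\<bar>energy_form s t a u g v h\<bar> \<le> s * \<bar>LINT x|lebesgue. (g x \<bullet> h x) * (a x * w x)\<bar> + t * \<bar>LINT x|lebesgue. (u x \<bullet> v x) * (a x * w x)\<bar>"
    unfolding energy_form_def using st by (intro order_trans[OF abs_triangle_ineq]) (simp add: abs_mult)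
  also have "\<dots> \<le> s * (A * (H1_sum_norm u g * H1_sum_norm v h)) + t * (A * (H1_sum_norm u g * H1_sum_norm v h))"
    using 1 2 st by (intro add_mono mult_left_mono)
  finally show ?thesis by (simp add: algebra_simps)
qed

lemma energy_form_coercive:
  assumes a: "continuous_on UNIV a" "\<And>x. a0 \<le> a x" "0 \<le> a0" "\<And>x. a x \<le> A" and st: "s \<ge> 0" "t \<ge> 0"
    and "sqint w u" "sqint w g"
  shows "min s t * a0 / 2 * (H1_sum_norm u g)\<^sup>2 \<le> energy_form s t a u g u g"
proof -
  let ?x = "wnorm w u" and ?y = "wnorm w g"
  have "(H1_sum_norm u g)\<^sup>2 \<le> 2 * (?x\<^sup>2 + ?y\<^sup>2)"
    using sum_squares_bound[of ?x ?y] by (simp add: H1_sum_norm_def power2_sum)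
  then have "min s t * a0 / 2 * (H1_sum_norm u g)\<^sup>2 \<le> min s t * a0 / 2 * (2 * (?x\<^sup>2 + ?y\<^sup>2))"
    using st a(3) by (intro mult_left_mono) auto
  also have "\<dots> = min s t * (a0 * ?y\<^sup>2) + min s t * (a0 * ?x\<^sup>2)" by (simp add: algebra_simps)
  also have "\<dots> \<le> s * (a0 * ?y\<^sup>2) + t * (a0 * ?x\<^sup>2)"
    using a(3) by (intro add_mono mult_right_mono) auto
  also have "\<dots> \<le> energy_form s t a u g u g"
    unfolding energy_form_def using weighted_inner_lower[OF a assms(7)] weighted_inner_lower[OF a assms(8)] st by (intro add_mono mult_left_mono)
  finally show ?thesis .
qed

lemma H1_sum_norm_triangle:
  assumes "sqint w u" "sqint w g" "sqint w v" "sqint w h"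
  shows "H1_sum_norm u g \<le> H1_sum_norm (\<lambda>x. u x - v x) (\<lambda>x. g x - h x) + H1_sum_norm v h"
  using wnorm_triangle[OF sqint_diff[OF assms(1,3)] assms(3)] wnorm_triangle[OF sqint_diff[OF assms(2,4)] assms(4)]
  by (simp add: H1_sum_norm_def)

text \<open>A bound of the form on test functions extends to \<open>e\<close> itself by density, and coercivity then bounds the
norm of \<open>e\<close>.\<close>

lemma energy_estimate:
  assumes a: "continuous_on UNIV a" "\<And>x. a0 \<le> a x" "0 < a0" "\<And>x. a x \<le> A" and st: "s > 0" "t > 0"
    and eg: "wpair w e g" and \<kappa>: "\<kappa> \<ge> 0"
    and bound: "\<And>\<psi>. test_function \<psi> \<Longrightarrow> \<bar>energy_form s t a e g \<psi> (grad \<psi>)\<bar> \<le> \<kappa> * H1_sum_norm \<psi> (grad \<psi>)"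
  shows "min s t * a0 / 2 * H1_sum_norm e g \<le> \<kappa>"
proof -
  define N where "N = H1_sum_norm e g"
  define c where "c = min s t * a0 / 2"
  define C where "C = (s + t) * A"
  have a2: "0 \<le> a x" for x using a(2)[of x] a(3) by linarith
  have A: "A \<ge> 0" using order_trans[OF a2 a(4)] .
  have N: "N \<ge> 0" by (simp add: N_def H1_sum_norm_def wnorm_nonneg)
  have C: "C \<ge> 0" using st A by (simp add: C_def)
  have s: "sqint w e" "sqint w g" using eg by (auto simp: wpair_def)
  have "c * N\<^sup>2 \<le> \<kappa> * N + \<tau>" if \<tau>: "\<tau> > 0" for \<tau>
  proof -
    define X where "X = \<kappa> + C * N + 1"
    \<comment> \<open>The error of replacing \<open>e\<close> by a test function at distance \<open>d\<close> is at most \<open>2 * d * X\<close>.\<close>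
    define d where "d = \<tau> / (2 * X)"
    have pos: "X > 0" unfolding X_def using \<kappa> C N by (simp add: add_nonneg_pos)
    have d: "d > 0" using \<tau> pos by (simp add: d_def)
    obtain \<psi> where \<psi>: "test_function \<psi>" "wnorm w (\<lambda>x. e x - \<psi> x) < d" "wnorm w (\<lambda>x. g x - grad \<psi> x) < d"
      using test_dense_H1[OF eg d] by blast
    have sp: "sqint w \<psi>" "sqint w (grad \<psi>)"
      using sqint_csupp[OF test_functionD(3,2)[OF \<psi>(1)]]
        sqint_csupp[OF grad_continuous[OF test_functionD(1)[OF \<psi>(1)]] csupp_grad[OF test_functionD(2)[OF \<psi>(1)]]] by auto
    let ?N2 = "H1_sum_norm (\<lambda>x. e x - \<psi> x) (\<lambda>x. g x - grad \<psi> x)"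
    have N2: "?N2 \<le> 2 * d" using \<psi> by (simp add: H1_sum_norm_def)
    have Np: "H1_sum_norm \<psi> (grad \<psi>) \<le> N + 2 * d"
    proof -
      have "H1_sum_norm \<psi> (grad \<psi>) \<le> H1_sum_norm (\<lambda>x. \<psi> x - e x) (\<lambda>x. grad \<psi> x - g x) + H1_sum_norm e g"
        by (rule H1_sum_norm_triangle[OF sp s])
      also have "H1_sum_norm (\<lambda>x. \<psi> x - e x) (\<lambda>x. grad \<psi> x - g x) = ?N2"
        using wnorm_minus_commute[of \<psi> e] wnorm_minus_commute[of "grad \<psi>" g] by (simp add: H1_sum_norm_def)
      finally show ?thesis using N2 by (simp add: N_def)
    qed
    have "c * N\<^sup>2 \<le> energy_form s t a e g e g"
      unfolding c_def N_def using a st s by (intro energy_form_coercive) auto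
    also have "\<dots> = energy_form s t a e g \<psi> (grad \<psi>) + energy_form s t a e g (\<lambda>x. e x - \<psi> x) (\<lambda>x. g x - grad \<psi> x)"
      using energy_form_diff(2)[OF a(1) a2 a(4) s s sp] by simp
    also have "\<dots> \<le> \<kappa> * (N + 2 * d) + C * (N * (2 * d))"
    proof (rule add_mono)
      have "energy_form s t a e g \<psi> (grad \<psi>) \<le> \<kappa> * H1_sum_norm \<psi> (grad \<psi>)" using bound[OF \<psi>(1)] by linarith
      also have "\<dots> \<le> \<kappa> * (N + 2 * d)" using Np \<kappa> by (rule mult_left_mono)
      finally show "energy_form s t a e g \<psi> (grad \<psi>) \<le> \<kappa> * (N + 2 * d)" .
      have "energy_form s t a e g (\<lambda>x. e x - \<psi> x) (\<lambda>x. g x - grad \<psi> x) \<le> C * (H1_sum_norm e g * ?N2)"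
        unfolding C_def using energy_form_bound[OF a(1) a2 a(4) _ _ s sqint_diff[OF s(1) sp(1)] sqint_diff[OF s(2) sp(2)], of s t] st by auto
      also have "\<dots> \<le> C * (N * (2 * d))" using N2 N C unfolding N_def by (intro mult_left_mono)
      finally show "energy_form s t a e g (\<lambda>x. e x - \<psi> x) (\<lambda>x. g x - grad \<psi> x) \<le> C * (N * (2 * d))" .
    qed
    also have "\<dots> = \<kappa> * N + 2 * d * (\<kappa> + C * N)" by (simp add: algebra_simps)
    also have "2 * d * (\<kappa> + C * N) \<le> 2 * d * X" using d by (simp add: X_def)
    also have "\<dots> = \<tau>" using pos by (simp add: d_def)
    finally show ?thesis by simp
  qed
  then have le: "c * N\<^sup>2 \<le> \<kappa> * N" by (rule field_le_epsilon)
  have "c * N \<le> \<kappa>"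
  proof (cases "N = 0")
    case False
    then have "N > 0" using N by simp
    moreover have "(c * N) * N \<le> \<kappa> * N" using le by (simp add: power2_eq_square mult.assoc)
    ultimately show ?thesis by (simp only: mult_le_cancel_right_pos)
  qed (use \<kappa> in simp)
  then show ?thesis by (simp add: c_def N_def)
qed

end

locale homogenization = cell_problem \<sigma> L p \<Phi> + smooth_weight w
  for \<sigma> L :: real and p :: "real^'n::finite \<Rightarrow> real" and \<Phi> :: "real^'n \<Rightarrow> real^'n" and w :: "real^'n \<Rightarrow> real" +
  fixes \<eta> :: real
  assumes \<eta>: "\<eta> > 0"
begin

abbreviation K :: "real^'n^'n" where "K \<equiv> K_matrix \<sigma> L p \<Phi>"
abbreviation m_eps :: "real \<Rightarrow> real^'n \<Rightarrow> real" where "m_eps \<epsilon> x \<equiv> m ((1/\<epsilon>) *\<^sub>R x)"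
definition M :: real where "M = cell_mean L m"
abbreviation N :: "(real^'n \<Rightarrow> real) \<Rightarrow> real" where "N \<psi> \<equiv> H1_sum_norm \<psi> (grad \<psi>)"

lemma N_nonneg: "N \<psi> \<ge> 0" by (simp add: H1_sum_norm_def wnorm_nonneg)

lemma m_bounds:
  obtains a A where "a > 0" "\<And>y. a \<le> m y" "\<And>y. m y \<le> A"
proof -
  have "continuous_on UNIV p" using p_smooth Ck_continuous by (auto simp: smooth_def simp del: Ck.simps)
  then obtain B where B: "B > 0" "\<And>y. norm (p y) \<le> B" using periodic_bounded[OF p_per L] by metis
  show ?thesis
  proof (rule that[of "exp (- (1/\<sigma>) * B)" "exp ((1/\<sigma>) * B)"])
    fix y
    have "\<bar>p y\<bar> \<le> B" using B(2)[of y] by simp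
    then have "(1/\<sigma>) * p y \<le> (1/\<sigma>) * B" "(1/\<sigma>) * (- p y) \<le> (1/\<sigma>) * B" using \<sigma> by (intro mult_left_mono; simp)+
    then show "exp (- (1/\<sigma>) * B) \<le> m y" "m y \<le> exp ((1/\<sigma>) * B)" by auto
  qed simp
qed

lemma flux_cell_mean: "cell_mean L (flux k j) = M * K $ k $ j"
  using cell_integral_pos[OF m_cont _ L] by (simp add: K_entry M_def cell_mean_def)

lemma K_symmetric: "K $ k $ j = K $ j $ k"
  unfolding K_entry flux_mean_symmetric[of k j] ..

lemma K_inner: "(K *v a) \<bullet> b = (\<Sum>k\<in>UNIV. \<Sum>j\<in>UNIV. K $ k $ j * (a $ k * b $ j))"
proof -
  have "(K *v a) \<bullet> b = (\<Sum>j\<in>UNIV. \<Sum>k\<in>UNIV. K $ j $ k * (a $ k * b $ j))"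
    by (simp add: inner_vec_def matrix_vector_mult_def sum_distrib_left sum_distrib_right mult_ac)
  also have "\<dots> = (\<Sum>k\<in>UNIV. \<Sum>j\<in>UNIV. K $ j $ k * (a $ k * b $ j))" by (rule sum.swap)
  finally show ?thesis using K_symmetric by simp
qed

lemma oscillation_to_mean:
  assumes h: "sqint w h" and g: "continuous_on UNIV g" "periodic L g" and d: "d > 0"
  shows "\<forall>\<^sub>F \<epsilon> in at_right 0. \<forall>\<psi>. test_function \<psi> \<longrightarrow>
    \<bar>(LINT x|lebesgue. h x * \<psi> x * g ((1/\<epsilon>) *\<^sub>R x) * w x) - cell_mean L g * (LINT x|lebesgue. h x * \<psi> x * w x)\<bar> \<le> d * N \<psi>"
proof -
  have gc: "continuous_on UNIV (\<lambda>y. g y - cell_mean L g)" by (intro continuous_intros g)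
  have gp: "periodic L (\<lambda>y. g y - cell_mean L g)" using g(2) by (simp add: periodic_def)
  obtain B where B: "B > 0" "\<And>x. norm (g x) \<le> B" using periodic_bounded[OF g(2) L g(1)] by metis
  from weighted_oscillation[OF h gc gp cell_integral_minus_cell_mean[OF g(1) L] L d]
  show ?thesis
  proof eventually_elim
    case (elim \<epsilon>)
    show ?case
    proof (intro allI impI)
      fix \<psi> :: "real^'n \<Rightarrow> real" assume \<psi>: "test_function \<psi>"
      note sp = test_function_sqint[OF \<psi>]
      have m: "(\<lambda>x. g ((1/\<epsilon>) *\<^sub>R x) *\<^sub>R \<psi> x) \<in> borel_measurable lebesgue"
        by (intro continuous_imp_measurable_lebesgue continuous_intros continuous_on_scaled g test_functionD(3)[OF \<psi>])
      have "sqint w (\<lambda>x. g ((1/\<epsilon>) *\<^sub>R x) *\<^sub>R \<psi> x)"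
        by (rule sqint_dominate(1)[OF sp(1) m, of B]) (use B in \<open>auto simp: abs_mult intro!: mult_right_mono\<close>)
      from sqint_inner[OF h this] have i1: "integrable lebesgue (\<lambda>x. h x * \<psi> x * g ((1/\<epsilon>) *\<^sub>R x) * w x)" by (simp add: mult_ac)
      from sqint_inner[OF h sp(1)] have i2: "integrable lebesgue (\<lambda>x. h x * \<psi> x * w x)" by simp
      have "(LINT x|lebesgue. h x * \<psi> x * (g ((1/\<epsilon>) *\<^sub>R x) - cell_mean L g) * w x)
        = (LINT x|lebesgue. h x * \<psi> x * g ((1/\<epsilon>) *\<^sub>R x) * w x - cell_mean L g * (h x * \<psi> x * w x))"
        by (intro Bochner_Integration.integral_cong refl) (simp add: algebra_simps)
      also have "\<dots> = (LINT x|lebesgue. h x * \<psi> x * g ((1/\<epsilon>) *\<^sub>R x) * w x) - cell_mean L g * (LINT x|lebesgue. h x * \<psi> x * w x)"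
        using i1 i2 by simp
      finally show "\<bar>(LINT x|lebesgue. h x * \<psi> x * g ((1/\<epsilon>) *\<^sub>R x) * w x) - cell_mean L g * (LINT x|lebesgue. h x * \<psi> x * w x)\<bar> \<le> d * N \<psi>"
        using elim[rule_format, OF \<psi>] unfolding H1_sum_norm_def by (simp only:)
    qed
  qed
qed

text \<open>The derivatives of the oscillating coefficients carry a factor \<open>1 / \<epsilon>\<close>, but they add up to the
divergence of the flux, which is \<open>0\<close>.\<close>

lemma flux_by_parts:
  assumes b: "test_function b" and \<psi>: "test_function \<psi>" and e: "\<epsilon> > 0"
  shows "(\<Sum>j\<in>UNIV. LINT x|lebesgue. b x * flux k j ((1/\<epsilon>) *\<^sub>R x) * partial j \<psi> x)
    = - (\<Sum>j\<in>UNIV. LINT x|lebesgue. partial j b x * flux k j ((1/\<epsilon>) *\<^sub>R x) * \<psi> x)"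
proof -
  note bt = test_functionD[OF b] and pt = test_functionD[OF \<psi>]
  have dc: "continuous_on UNIV (partial j (flux k j))" for j using flux_C1 by simp
  have each: "(LINT x|lebesgue. b x * flux k j ((1/\<epsilon>) *\<^sub>R x) * partial j \<psi> x)
     = - (LINT x|lebesgue. partial j b x * flux k j ((1/\<epsilon>) *\<^sub>R x) * \<psi> x) - (LINT x|lebesgue. b x * \<psi> x * (1/\<epsilon>) * partial j (flux k j) ((1/\<epsilon>) *\<^sub>R x))" for j
  proof -
    have C: "Ck 1 (\<lambda>x. b x * flux k j ((1/\<epsilon>) *\<^sub>R x))" by (intro Ck_mult bt Ck_scaled flux_C1)
    have d: "partial j (\<lambda>x. b x * flux k j ((1/\<epsilon>) *\<^sub>R x)) x = b x * ((1/\<epsilon>) * partial j (flux k j) ((1/\<epsilon>) *\<^sub>R x)) + partial j b x * flux k j ((1/\<epsilon>) *\<^sub>R x)" for x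
      using partial_mult[OF bt(4) partial_scaled(2)[OF flux_C1]] partial_scaled(1)[OF flux_C1] by simp
    have i1: "integrable lebesgue (\<lambda>x. partial j b x * flux k j ((1/\<epsilon>) *\<^sub>R x) * \<psi> x)"
      using test_functionD[OF test_function_partial[OF b]] pt
      by (intro integrable_csupp continuous_on_mult continuous_on_scaled flux_cont csupp_weaken[OF pt(2)]) auto
    have i2: "integrable lebesgue (\<lambda>x. b x * \<psi> x * (1/\<epsilon>) * partial j (flux k j) ((1/\<epsilon>) *\<^sub>R x))"
      by (intro integrable_csupp continuous_on_mult continuous_on_const continuous_on_scaled dc bt pt csupp_weaken[OF pt(2)]) auto
    have "(LINT x|lebesgue. b x * flux k j ((1/\<epsilon>) *\<^sub>R x) * partial j \<psi> x)
      = - (LINT x|lebesgue. partial j (\<lambda>x. b x * flux k j ((1/\<epsilon>) *\<^sub>R x)) x * \<psi> x)"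
      by (rule integral_by_parts[OF C pt(1,2)])
    also have "(LINT x|lebesgue. partial j (\<lambda>x. b x * flux k j ((1/\<epsilon>) *\<^sub>R x)) x * \<psi> x)
       = (LINT x|lebesgue. partial j b x * flux k j ((1/\<epsilon>) *\<^sub>R x) * \<psi> x + b x * \<psi> x * (1/\<epsilon>) * partial j (flux k j) ((1/\<epsilon>) *\<^sub>R x))"
      by (intro Bochner_Integration.integral_cong refl) (simp only: d, simp add: algebra_simps)
    finally show ?thesis using i1 i2 by simp
  qed
  have "(\<Sum>j\<in>UNIV. LINT x|lebesgue. b x * \<psi> x * (1/\<epsilon>) * partial j (flux k j) ((1/\<epsilon>) *\<^sub>R x))
     = (LINT x|lebesgue. (\<Sum>j\<in>UNIV. b x * \<psi> x * (1/\<epsilon>) * partial j (flux k j) ((1/\<epsilon>) *\<^sub>R x)))"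
    by (intro Bochner_Integration.integral_sum[symmetric] integrable_csupp continuous_on_mult continuous_on_const continuous_on_scaled dc bt pt csupp_weaken[OF pt(2)]) auto
  also have "\<dots> = 0" by (simp only: sum_distrib_left[symmetric] flux_divergence_free mult_zero_right integral_zero)
  finally show ?thesis unfolding each sum_subtractf by (simp add: sum_negf)
qed

end

section \<open>The two-scale expansion\<close>

context homogenization begin

definition expansion :: "(real^'n \<Rightarrow> real) \<Rightarrow> real \<Rightarrow> real^'n \<Rightarrow> real" where
  "expansion v \<epsilon> x = v x + \<epsilon> * (\<Sum>k\<in>UNIV. corrector k ((1/\<epsilon>) *\<^sub>R x) * partial k v x)"

definition weighted_partial :: "(real^'n \<Rightarrow> real) \<Rightarrow> 'n \<Rightarrow> real^'n \<Rightarrow> real" where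
  "weighted_partial v k x = w x * partial k v x"

text \<open>Dividing by \<open>w\<close> writes the derivative of \<open>w * partial k v\<close> as a density with respect to the weight, the
form in which \<open>oscillation_to_mean\<close> applies.\<close>

definition flux_source :: "(real^'n \<Rightarrow> real) \<Rightarrow> 'n \<Rightarrow> 'n \<Rightarrow> real^'n \<Rightarrow> real" where
  "flux_source v k j x = partial j (weighted_partial v k) x / w x"

text \<open>The remainders of order \<open>\<epsilon>\<close> in the expansion and in its gradient both have this shape.\<close>

definition corr_sum :: "('n \<Rightarrow> real^'n \<Rightarrow> 'b::euclidean_space) \<Rightarrow> real \<Rightarrow> real^'n \<Rightarrow> 'b" where
  "corr_sum V \<epsilon> x = (\<Sum>k\<in>UNIV. corrector k ((1/\<epsilon>) *\<^sub>R x) *\<^sub>R V k x)"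

text \<open>Correctors are periodic, hence bounded; the constant does not depend on \<open>\<epsilon>\<close>.\<close>

lemma corr_sum_bound:
  obtains C where "C \<ge> 0" "\<And>\<epsilon> V. (\<And>k. continuous_on UNIV (V k)) \<Longrightarrow> (\<And>k. csupp (V k)) \<Longrightarrow>
     sqint w (corr_sum V \<epsilon> :: _ \<Rightarrow> 'b::euclidean_space) \<and> wnorm w (corr_sum V \<epsilon>) \<le> C * (\<Sum>k\<in>UNIV. wnorm w (V k))"
proof -
  have "\<exists>B. B > 0 \<and> (\<forall>x. norm (corrector k x) \<le> B)" for k
    using periodic_bounded[OF corrector_per L corrector_cont] by metis
  then obtain B where B: "\<And>k. B k > 0" "\<And>k x. norm (corrector k x) \<le> B k" by metis
  define C where "C = (\<Sum>k\<in>UNIV. B k)"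
  have BC: "B k \<le> C" for k unfolding C_def by (rule member_le_sum) (use B(1) in \<open>auto simp: less_imp_le\<close>)
  have C0: "C \<ge> 0" unfolding C_def using B(1) by (intro sum_nonneg) (auto simp: less_imp_le)
  show ?thesis
  proof (rule that[OF C0])
    fix \<epsilon> and V :: "'n \<Rightarrow> real^'n \<Rightarrow> 'b" assume V: "\<And>k. continuous_on UNIV (V k)" "\<And>k. csupp (V k)"
    have each: "sqint w (\<lambda>x. corrector k ((1/\<epsilon>) *\<^sub>R x) *\<^sub>R V k x) \<and> wnorm w (\<lambda>x. corrector k ((1/\<epsilon>) *\<^sub>R x) *\<^sub>R V k x) \<le> C * wnorm w (V k)" for k
    proof -
      have m: "(\<lambda>x. corrector k ((1/\<epsilon>) *\<^sub>R x) *\<^sub>R V k x) \<in> borel_measurable lebesgue"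
        by (intro continuous_imp_measurable_lebesgue continuous_on_scaleR continuous_on_scaled corrector_cont V)
      have b: "norm (corrector k ((1/\<epsilon>) *\<^sub>R x) *\<^sub>R V k x) \<le> C * norm (V k x)" for x
      proof -
        have "\<bar>corrector k ((1/\<epsilon>) *\<^sub>R x)\<bar> \<le> C" using B(2) BC[of k] by (metis order_trans real_norm_def)
        then show ?thesis by (simp add: mult_right_mono)
      qed
      show ?thesis using sqint_dominate[OF sqint_csupp[OF V] m b C0] by blast
    qed
    have "wnorm w (corr_sum V \<epsilon>) \<le> (\<Sum>k\<in>UNIV. wnorm w (\<lambda>x. corrector k ((1/\<epsilon>) *\<^sub>R x) *\<^sub>R V k x))"
      unfolding corr_sum_def[abs_def] using each by (intro wnorm_sum) blast
    also have "\<dots> \<le> (\<Sum>k\<in>UNIV. C * wnorm w (V k))" using each by (intro sum_mono) blast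
    finally show "sqint w (corr_sum V \<epsilon>) \<and> wnorm w (corr_sum V \<epsilon>) \<le> C * (\<Sum>k\<in>UNIV. wnorm w (V k))"
      unfolding sum_distrib_left[symmetric] corr_sum_def[abs_def] using each by (auto intro!: sqint_sum)
  qed
qed

lemma test_function_partials:
  assumes "test_function v" shows "test_function (partial k v)" "test_function (weighted_partial v k)"
  using test_function_partial[OF assms] test_function_mult[OF test_function_partial[OF assms] w_smooth]
  by (simp_all add: weighted_partial_def[abs_def])

lemma flux_source_sqint: "test_function v \<Longrightarrow> sqint w (flux_source v k j)"
  unfolding flux_source_def[abs_def]
  using test_functionD(2,3)[OF test_function_partial[OF test_function_partials(2)]] by (intro sqint_div_weight)

lemma expansion_C1:
  assumes v: "test_function v"
  shows "Ck 1 (expansion v \<epsilon>)" "csupp (expansion v \<epsilon>)"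
proof -
  show "Ck 1 (expansion v \<epsilon>)" unfolding expansion_def[abs_def]
    by (intro Ck_add Ck_mult Ck_const Ck_sum Ck_scaled corrector_C1 test_functionD(1) test_function_partials v)
  have s: "csupp (\<lambda>x. \<Sum>k\<in>UNIV. corrector k ((1/\<epsilon>) *\<^sub>R x) * partial k v x)"
  proof (rule csupp_sum)
    fix k show "csupp (\<lambda>x. corrector k ((1/\<epsilon>) *\<^sub>R x) * partial k v x)"
      by (rule csupp_weaken[OF test_functionD(2)[OF test_function_partials(1)[OF v, of k]]]) simp
  qed
  show "csupp (expansion v \<epsilon>)" unfolding expansion_def[abs_def]
    by (rule csupp_weaken2[OF test_functionD(2)[OF v] s]) simp
qed

text \<open>Differentiating the corrector produces a factor \<open>1 / \<epsilon>\<close> that cancels the \<open>\<epsilon>\<close> in front of it. These terms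
join \<open>grad v\<close> to form the flux of the cell problem.\<close>

lemma grad_expansion:
  assumes v: "test_function v" and e: "\<epsilon> > 0"
  shows "m_eps \<epsilon> x * grad (expansion v \<epsilon>) x $ j
    = (\<Sum>k\<in>UNIV. partial k v x * flux k j ((1/\<epsilon>) *\<^sub>R x)) + \<epsilon> * (m_eps \<epsilon> x *\<^sub>R corr_sum (\<lambda>k. grad (partial k v)) \<epsilon> x) $ j"
proof -
  have dk: "partial j (\<lambda>x. corrector k ((1/\<epsilon>) *\<^sub>R x) * partial k v x) x
     = corrector k ((1/\<epsilon>) *\<^sub>R x) * partial j (partial k v) x + (1/\<epsilon>) * partial j (corrector k) ((1/\<epsilon>) *\<^sub>R x) * partial k v x"
    "(\<lambda>x. corrector k ((1/\<epsilon>) *\<^sub>R x) * partial k v x) differentiable (at x)" for k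
  proof -
    note d = partial_scaled[OF corrector_C1[of k], where c="1/\<epsilon>" and x=x]
    note dv = test_functionD(4)[OF test_function_partials(1)[OF v]]
    show "partial j (\<lambda>x. corrector k ((1/\<epsilon>) *\<^sub>R x) * partial k v x) x
     = corrector k ((1/\<epsilon>) *\<^sub>R x) * partial j (partial k v) x + (1/\<epsilon>) * partial j (corrector k) ((1/\<epsilon>) *\<^sub>R x) * partial k v x"
      using partial_mult[OF d(2) dv] d(1) by simp
    show "(\<lambda>x. corrector k ((1/\<epsilon>) *\<^sub>R x) * partial k v x) differentiable (at x)" using d(2) dv by (rule differentiable_mult)
  qed
  have ds: "partial j (\<lambda>x. \<Sum>k\<in>I. corrector k ((1/\<epsilon>) *\<^sub>R x) * partial k v x) x = (\<Sum>k\<in>I. partial j (\<lambda>x. corrector k ((1/\<epsilon>) *\<^sub>R x) * partial k v x) x)"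
    "(\<lambda>x. \<Sum>k\<in>I. corrector k ((1/\<epsilon>) *\<^sub>R x) * partial k v x) differentiable (at x)" for I
  proof -
    have "partial j (\<lambda>x. \<Sum>k\<in>I. corrector k ((1/\<epsilon>) *\<^sub>R x) * partial k v x) x = (\<Sum>k\<in>I. partial j (\<lambda>x. corrector k ((1/\<epsilon>) *\<^sub>R x) * partial k v x) x)
      \<and> (\<lambda>x. \<Sum>k\<in>I. corrector k ((1/\<epsilon>) *\<^sub>R x) * partial k v x) differentiable (at x)"
    proof (induction I rule: infinite_finite_induct)
      case (insert k I)
      then show ?case using dk(2)[of k] partial_add[OF dk(2)[of k], of "\<lambda>x. \<Sum>k\<in>I. corrector k ((1/\<epsilon>) *\<^sub>R x) * partial k v x" j] by (auto intro: differentiable_add)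
    qed auto
    then show "partial j (\<lambda>x. \<Sum>k\<in>I. corrector k ((1/\<epsilon>) *\<^sub>R x) * partial k v x) x = (\<Sum>k\<in>I. partial j (\<lambda>x. corrector k ((1/\<epsilon>) *\<^sub>R x) * partial k v x) x)"
    "(\<lambda>x. \<Sum>k\<in>I. corrector k ((1/\<epsilon>) *\<^sub>R x) * partial k v x) differentiable (at x)" by auto
  qed
  let ?S = "\<lambda>x. \<Sum>k\<in>UNIV. corrector k ((1/\<epsilon>) *\<^sub>R x) * partial k v x"
  have d1: "(\<lambda>x. \<epsilon> * ?S x) differentiable (at x)" using differentiable_mult[OF differentiable_const ds(2)] by blast
  have "partial j (expansion v \<epsilon>) x = partial j v x + \<epsilon> * partial j ?S x"
    unfolding expansion_def[abs_def]
    using partial_add[OF test_functionD(4)[OF v] d1, of j] partial_mult[OF differentiable_const[of \<epsilon>] ds(2), where i=j] by simp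
  also have "\<dots> = partial j v x + (\<Sum>k\<in>UNIV. partial j (corrector k) ((1/\<epsilon>) *\<^sub>R x) * partial k v x)
     + \<epsilon> * (\<Sum>k\<in>UNIV. corrector k ((1/\<epsilon>) *\<^sub>R x) * partial j (partial k v) x)"
    unfolding ds(1) dk(1) using e by (simp add: sum.distrib sum_distrib_left distrib_left mult.assoc)
  also have "partial j v x + (\<Sum>k\<in>UNIV. partial j (corrector k) ((1/\<epsilon>) *\<^sub>R x) * partial k v x)
     = (\<Sum>k\<in>UNIV. ((if k = j then 1 else 0) + partial j (corrector k) ((1/\<epsilon>) *\<^sub>R x)) * partial k v x)"
    by (simp add: distrib_right sum.distrib if_distrib[of "\<lambda>t. t * _"] cong: if_cong)
  finally show ?thesis
    by (simp add: grad_def corr_sum_def sum_component cell_flux_def sum_distrib_left algebra_simps)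
qed

lemma expansion_form:
  assumes v: "test_function v" and \<psi>: "test_function \<psi>" and e: "\<epsilon> > 0"
  shows "energy_form \<sigma> \<eta> (m_eps \<epsilon>) (expansion v \<epsilon>) (grad (expansion v \<epsilon>)) \<psi> (grad \<psi>)
    = - \<sigma> * (\<Sum>k\<in>UNIV. \<Sum>j\<in>UNIV. LINT x|lebesgue. flux_source v k j x * \<psi> x * flux k j ((1/\<epsilon>) *\<^sub>R x) * w x)
      + \<eta> * (LINT x|lebesgue. v x * \<psi> x * m_eps \<epsilon> x * w x)
      + \<epsilon> * energy_form \<sigma> \<eta> (m_eps \<epsilon>) (corr_sum (\<lambda>k. partial k v) \<epsilon>) (corr_sum (\<lambda>k. grad (partial k v)) \<epsilon>) \<psi> (grad \<psi>)"
proof -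
  note vt = test_functionD[OF v] and pt = test_functionD[OF \<psi>]
  have gpt: "continuous_on UNIV (grad \<psi>)" "csupp (grad \<psi>)" using grad_continuous[OF pt(1)] csupp_grad[OF pt(2)] by auto
  have mc: "continuous_on UNIV (m_eps \<epsilon>)" by (rule continuous_on_scaled[OF m_cont])
  obtain A where A: "\<And>y. m y \<le> A" using m_bounds by metis
  note a = mc less_imp_le[OF exp_gt_zero] A
  let ?r = "corr_sum (\<lambda>k. grad (partial k v)) \<epsilon>" and ?q = "corr_sum (\<lambda>k. partial k v) \<epsilon>"
  have sr: "sqint w ?r" and sq: "sqint w ?q"
  proof -
    show "sqint w ?r"
      using corr_sum_bound[where 'b="real^'n"] test_functionD[OF test_function_partials(1)[OF v]] grad_continuous csupp_grad by metis
    show "sqint w ?q"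
      using corr_sum_bound[where 'b=real] test_functionD[OF test_function_partials(1)[OF v]] by metis
  qed
  note sp = test_function_sqint[OF \<psi>]
  note sv = test_function_sqint[OF v]
  have i1: "integrable lebesgue (\<lambda>x. weighted_partial v k x * flux k j ((1/\<epsilon>) *\<^sub>R x) * partial j \<psi> x)" for k j
    by (intro integrable_csupp continuous_on_mult continuous_on_scaled flux_cont test_functionD(3) test_function_partials v \<psi> csupp_weaken[OF csupp_partial[OF pt(2), of j]]) simp
  have i2: "integrable lebesgue (\<lambda>x. (?r x \<bullet> grad \<psi> x) * (m_eps \<epsilon> x * w x))" by (rule weighted_inner_bound(1)[OF a sr sp(2)])
  have i3: "integrable lebesgue (\<lambda>x. (?q x \<bullet> \<psi> x) * (m_eps \<epsilon> x * w x))" by (rule weighted_inner_bound(1)[OF a sq sp(1)])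
  have i4: "integrable lebesgue (\<lambda>x. (v x \<bullet> \<psi> x) * (m_eps \<epsilon> x * w x))" by (rule weighted_inner_bound(1)[OF a sv(1) sp(1)])
  have pw: "(grad (expansion v \<epsilon>) x \<bullet> grad \<psi> x) * (m_eps \<epsilon> x * w x)
     = (\<Sum>k\<in>UNIV. \<Sum>j\<in>UNIV. weighted_partial v k x * flux k j ((1/\<epsilon>) *\<^sub>R x) * partial j \<psi> x) + \<epsilon> * ((?r x \<bullet> grad \<psi> x) * (m_eps \<epsilon> x * w x))" for x
  proof -
    have "(grad (expansion v \<epsilon>) x \<bullet> grad \<psi> x) * (m_eps \<epsilon> x * w x)
       = (\<Sum>j\<in>UNIV. (m_eps \<epsilon> x * grad (expansion v \<epsilon>) x $ j) * (partial j \<psi> x * w x))"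
      by (simp add: inner_vec_def grad_def[of \<psi>] sum_distrib_left sum_distrib_right mult_ac)
    also have "\<dots> = (\<Sum>j\<in>UNIV. \<Sum>k\<in>UNIV. weighted_partial v k x * flux k j ((1/\<epsilon>) *\<^sub>R x) * partial j \<psi> x)
        + (\<Sum>j\<in>UNIV. \<epsilon> * (m_eps \<epsilon> x *\<^sub>R ?r x) $ j * (partial j \<psi> x * w x))"
      unfolding grad_expansion[OF v e] distrib_right sum.distrib
      by (simp add: weighted_partial_def sum_distrib_left sum_distrib_right mult_ac)
    also have "(\<Sum>j\<in>UNIV. \<Sum>k\<in>UNIV. weighted_partial v k x * flux k j ((1/\<epsilon>) *\<^sub>R x) * partial j \<psi> x)
        = (\<Sum>k\<in>UNIV. \<Sum>j\<in>UNIV. weighted_partial v k x * flux k j ((1/\<epsilon>) *\<^sub>R x) * partial j \<psi> x)" by (rule sum.swap)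
    also have "(\<Sum>j\<in>UNIV. \<epsilon> * (m_eps \<epsilon> x *\<^sub>R ?r x) $ j * (partial j \<psi> x * w x)) = \<epsilon> * ((?r x \<bullet> grad \<psi> x) * (m_eps \<epsilon> x * w x))"
      by (simp add: inner_vec_def grad_def[of \<psi>] sum_distrib_left sum_distrib_right mult_ac)
    finally show ?thesis .
  qed
  have "(LINT x|lebesgue. (grad (expansion v \<epsilon>) x \<bullet> grad \<psi> x) * (m_eps \<epsilon> x * w x))
     = (\<Sum>k\<in>UNIV. \<Sum>j\<in>UNIV. LINT x|lebesgue. weighted_partial v k x * flux k j ((1/\<epsilon>) *\<^sub>R x) * partial j \<psi> x)
       + \<epsilon> * (LINT x|lebesgue. (?r x \<bullet> grad \<psi> x) * (m_eps \<epsilon> x * w x))"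
    unfolding pw using i1 i2 by (simp add: Bochner_Integration.integral_sum)
  also have "(\<Sum>k\<in>UNIV. \<Sum>j\<in>UNIV. LINT x|lebesgue. weighted_partial v k x * flux k j ((1/\<epsilon>) *\<^sub>R x) * partial j \<psi> x)
     = - (\<Sum>k\<in>UNIV. \<Sum>j\<in>UNIV. LINT x|lebesgue. flux_source v k j x * \<psi> x * flux k j ((1/\<epsilon>) *\<^sub>R x) * w x)"
  proof -
    have "(LINT x|lebesgue. partial j (weighted_partial v k) x * flux k j ((1/\<epsilon>) *\<^sub>R x) * \<psi> x)
       = (LINT x|lebesgue. flux_source v k j x * \<psi> x * flux k j ((1/\<epsilon>) *\<^sub>R x) * w x)" for k j
      by (intro Bochner_Integration.integral_cong refl) (simp add: flux_source_def less_imp_neq[OF w_pos, symmetric])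
    then show ?thesis unfolding flux_by_parts[OF test_function_partials(2)[OF v] \<psi> e] by (simp add: sum_negf)
  qed
  finally have t1: "(LINT x|lebesgue. (grad (expansion v \<epsilon>) x \<bullet> grad \<psi> x) * (m_eps \<epsilon> x * w x))
     = - (\<Sum>k\<in>UNIV. \<Sum>j\<in>UNIV. LINT x|lebesgue. flux_source v k j x * \<psi> x * flux k j ((1/\<epsilon>) *\<^sub>R x) * w x)
       + \<epsilon> * (LINT x|lebesgue. (?r x \<bullet> grad \<psi> x) * (m_eps \<epsilon> x * w x))" .
  have "(LINT x|lebesgue. (expansion v \<epsilon> x \<bullet> \<psi> x) * (m_eps \<epsilon> x * w x))
    = (LINT x|lebesgue. (v x \<bullet> \<psi> x) * (m_eps \<epsilon> x * w x) + \<epsilon> * ((?q x \<bullet> \<psi> x) * (m_eps \<epsilon> x * w x)))"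
    by (intro Bochner_Integration.integral_cong refl) (simp add: expansion_def corr_sum_def algebra_simps)
  also have "\<dots> = (LINT x|lebesgue. (v x \<bullet> \<psi> x) * (m_eps \<epsilon> x * w x)) + \<epsilon> * (LINT x|lebesgue. (?q x \<bullet> \<psi> x) * (m_eps \<epsilon> x * w x))"
    using i3 i4 by simp
  finally show ?thesis unfolding energy_form_def t1 by (simp add: algebra_simps)
qed

text \<open>The integration by parts of \<open>expansion_form\<close> with the constant coefficients \<open>K\<close> in place of the flux.\<close>

lemma homogenized_form:
  assumes v: "test_function v" and \<psi>: "test_function \<psi>"
  shows "(LINT x|lebesgue. ((K *v grad v x) \<bullet> grad \<psi> x) * w x)
    = - (\<Sum>k\<in>UNIV. \<Sum>j\<in>UNIV. K $ k $ j * (LINT x|lebesgue. flux_source v k j x * \<psi> x * w x))"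
proof -
  note pt = test_functionD[OF \<psi>]
  have i1: "integrable lebesgue (\<lambda>x. weighted_partial v k x * partial j \<psi> x)" for k j
    by (intro integrable_csupp continuous_on_mult test_functionD(3) test_function_partials v \<psi> csupp_weaken[OF csupp_partial[OF pt(2), of j]]) simp
  have "(LINT x|lebesgue. ((K *v grad v x) \<bullet> grad \<psi> x) * w x)
    = (LINT x|lebesgue. (\<Sum>k\<in>UNIV. \<Sum>j\<in>UNIV. K $ k $ j * (weighted_partial v k x * partial j \<psi> x)))"
    by (intro Bochner_Integration.integral_cong refl) (simp add: K_inner grad_def weighted_partial_def sum_distrib_left sum_distrib_right mult_ac)
  also have "\<dots> = (\<Sum>k\<in>UNIV. \<Sum>j\<in>UNIV. K $ k $ j * (LINT x|lebesgue. weighted_partial v k x * partial j \<psi> x))"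
    using i1 by (simp add: Bochner_Integration.integral_sum)
  also have "\<dots> = - (\<Sum>k\<in>UNIV. \<Sum>j\<in>UNIV. K $ k $ j * (LINT x|lebesgue. flux_source v k j x * \<psi> x * w x))"
  proof -
    have "(LINT x|lebesgue. weighted_partial v k x * partial j \<psi> x) = - (LINT x|lebesgue. flux_source v k j x * \<psi> x * w x)" for k j
    proof -
      have "(LINT x|lebesgue. weighted_partial v k x * partial j \<psi> x) = - (LINT x|lebesgue. partial j (weighted_partial v k) x * \<psi> x)"
        by (rule integral_by_parts[OF test_functionD(1)[OF test_function_partials(2)[OF v]] pt(1,2)])
      also have "(LINT x|lebesgue. partial j (weighted_partial v k) x * \<psi> x) = (LINT x|lebesgue. flux_source v k j x * \<psi> x * w x)"
        by (intro Bochner_Integration.integral_cong refl) (simp add: flux_source_def less_imp_neq[OF w_pos, symmetric])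
      finally show ?thesis .
    qed
    then show ?thesis by (simp add: sum_negf)
  qed
  finally show ?thesis .
qed

lemma matrix_form_bound:
  obtains C where "C \<ge> 0" "\<And>G H. sqint w G \<Longrightarrow> sqint w H \<Longrightarrow>
     integrable lebesgue (\<lambda>x. ((K *v G x) \<bullet> H x) * w x) \<and> \<bar>LINT x|lebesgue. ((K *v G x) \<bullet> H x) * w x\<bar> \<le> C * (wnorm w G * wnorm w H)"
proof -
  have bl: "bounded_linear ((*v) K)" using matrix_vector_mul_linear linear_conv_bounded_linear by blast
  then obtain C where C: "C > 0" "\<And>x. norm (K *v x) \<le> norm x * C" using bounded_linear.pos_bounded by blast
  show ?thesis
  proof (rule that[of C])
    fix G H :: "real^'n \<Rightarrow> real^'n" assume G: "sqint w G" and H: "sqint w H"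
    have m: "(\<lambda>x. K *v G x) \<in> borel_measurable lebesgue"
      using G unfolding sqint_def by (intro borel_measurable_continuous_on[OF linear_continuous_on[OF bl]]) auto
    have b: "norm (K *v G x) \<le> C * norm (G x)" for x using C(2) by (simp add: mult.commute)
    note d = sqint_dominate[OF G m b less_imp_le[OF C(1)]]
    have "\<bar>LINT x|lebesgue. ((K *v G x) \<bullet> H x) * w x\<bar> \<le> wnorm w (\<lambda>x. K *v G x) * wnorm w H" by (rule weighted_Cauchy_Schwarz[OF d(1) H])
    also have "\<dots> \<le> C * wnorm w G * wnorm w H" using d(2) wnorm_nonneg by (intro mult_right_mono) auto
    finally show "integrable lebesgue (\<lambda>x. ((K *v G x) \<bullet> H x) * w x) \<and> \<bar>LINT x|lebesgue. ((K *v G x) \<bullet> H x) * w x\<bar> \<le> C * (wnorm w G * wnorm w H)"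
      using sqint_inner[OF d(1) H] by (simp add: mult.assoc)
  qed (use C in auto)
qed

end

section \<open>Convergence of the solutions\<close>

lemma has_weak_grad_diff:
  assumes "has_weak_grad u g" "has_weak_grad v h"
  shows "has_weak_grad (\<lambda>x. u x - v x) (\<lambda>x. g x - h x)"
  unfolding has_weak_grad_iff
proof (intro conjI allI impI)
  have l: "locally_integrable u" "locally_integrable g" "locally_integrable v" "locally_integrable h"
    using assms by (auto simp: has_weak_grad_def)
  show "locally_integrable (\<lambda>x. u x - v x)" "locally_integrable (\<lambda>x. g x - h x)"
    using l by (auto simp: locally_integrable_def set_integrable_def scaleR_diff_right right_diff_distrib)
  fix \<phi> :: "real^'a \<Rightarrow> real" and i assume \<phi>: "test_function \<phi>"
  note p\<phi> = test_functionD(2,3)[OF test_function_partial[OF \<phi>, of i]]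
  have i: "integrable lebesgue (\<lambda>x. u x * partial i \<phi> x)" "integrable lebesgue (\<lambda>x. v x * partial i \<phi> x)"
    using integrable_local_multR[OF l(1) p\<phi>(2,1)] integrable_local_multR[OF l(3) p\<phi>(2,1)] by auto
  have i2: "integrable lebesgue (\<lambda>x. \<phi> x * g x $ i)" "integrable lebesgue (\<lambda>x. \<phi> x * h x $ i)"
    using integrable_local_mult[OF locally_integrable_nth[OF l(2)] test_functionD(3,2)[OF \<phi>]]
      integrable_local_mult[OF locally_integrable_nth[OF l(4)] test_functionD(3,2)[OF \<phi>]] by auto
  have "(LINT x|lebesgue. u x * partial i \<phi> x) = - (LINT x|lebesgue. \<phi> x * g x $ i)"
    using assms(1) \<phi> unfolding has_weak_grad_iff by blast
  moreover have "(LINT x|lebesgue. v x * partial i \<phi> x) = - (LINT x|lebesgue. \<phi> x * h x $ i)"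
    using assms(2) \<phi> unfolding has_weak_grad_iff by blast
  ultimately show "(LINT x|lebesgue. (u x - v x) * partial i \<phi> x) = - (LINT x|lebesgue. \<phi> x * (g x - h x) $ i)"
    using i i2 by (simp add: left_diff_distrib right_diff_distrib)
qed

lemma has_weak_grad_wgrad: "has_weak_grad u g \<Longrightarrow> has_weak_grad u (wgrad u)"
  unfolding wgrad_def by (rule someI[of "has_weak_grad u"])

context weight begin

lemma wpair_diff: "wpair w u g \<Longrightarrow> wpair w v h \<Longrightarrow> wpair w (\<lambda>x. u x - v x) (\<lambda>x. g x - h x)"
  by (auto simp: wpair_def intro: has_weak_grad_diff sqint_diff)

lemma wpair_C1: "Ck 1 v \<Longrightarrow> csupp v \<Longrightarrow> wpair w v (grad v)"
  unfolding wpair_def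
  by (intro conjI has_weak_grad_C1 sqint_csupp grad_continuous csupp_grad) (auto dest: Ck_continuous simp del: Ck.simps)

text \<open>A factor bounded above and away from \<open>0\<close> does not change the space. This identifies the spaces for all
\<open>\<epsilon>\<close> with the one for \<open>w\<close>.\<close>

lemma sqint_equivalent_weight:
  fixes U :: "real^'n \<Rightarrow> 'b::euclidean_space"
  assumes U: "U \<in> borel_measurable lebesgue" and a: "continuous_on UNIV a" "\<And>x. a0 \<le> a x" "0 < a0" "\<And>x. a x \<le> A" and c: "c > 0"
  shows "integrable lebesgue (\<lambda>x. (norm (U x))\<^sup>2 * (c * (a x * w x))) \<longleftrightarrow> sqint w U"
proof
  have [measurable]: "U \<in> borel_measurable lebesgue" "w \<in> borel_measurable lebesgue" "a \<in> borel_measurable lebesgue"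
    using U w_meas a(1) continuous_imp_measurable_lebesgue by blast+
  assume i: "integrable lebesgue (\<lambda>x. (norm (U x))\<^sup>2 * (c * (a x * w x)))"
  then have "integrable lebesgue (\<lambda>x. (1 / (c * a0)) * ((norm (U x))\<^sup>2 * (c * (a x * w x))))" by (rule integrable_mult_right)
  then have "integrable lebesgue (\<lambda>x. (norm (U x))\<^sup>2 * w x)"
  proof (rule Bochner_Integration.integrable_bound)
    show "(\<lambda>x. (norm (U x))\<^sup>2 * w x) \<in> borel_measurable lebesgue" by measurable
    have "(norm (U x))\<^sup>2 * w x \<le> (1 / (c * a0)) * ((norm (U x))\<^sup>2 * (c * (a x * w x)))" for x
    proof -
      have "(norm (U x))\<^sup>2 * w x * a0 \<le> (norm (U x))\<^sup>2 * w x * a x" using a(2) w_nonneg by (intro mult_left_mono) auto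
      then show ?thesis using c a(3) by (simp add: field_simps)
    qed
    then show "AE x in lebesgue. norm ((norm (U x))\<^sup>2 * w x) \<le> norm ((1 / (c * a0)) * ((norm (U x))\<^sup>2 * (c * (a x * w x))))"
      unfolding real_norm_def abs_of_nonneg[OF mult_nonneg_nonneg[OF zero_le_power2 w_nonneg]]
      by (intro AE_I2 order_trans[OF _ abs_ge_self])
  qed
  then show "sqint w U" using U by (simp add: sqint_def)
next
  have [measurable]: "U \<in> borel_measurable lebesgue" "w \<in> borel_measurable lebesgue" "a \<in> borel_measurable lebesgue"
    using U w_meas a(1) continuous_imp_measurable_lebesgue by blast+
  assume s: "sqint w U"
  then have "integrable lebesgue (\<lambda>x. (c * A) * ((norm (U x))\<^sup>2 * w x))" by (simp add: sqint_def)
  then show "integrable lebesgue (\<lambda>x. (norm (U x))\<^sup>2 * (c * (a x * w x)))"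
  proof (rule Bochner_Integration.integrable_bound)
    show "(\<lambda>x. (norm (U x))\<^sup>2 * (c * (a x * w x))) \<in> borel_measurable lebesgue" by measurable
    show "AE x in lebesgue. norm ((norm (U x))\<^sup>2 * (c * (a x * w x))) \<le> norm ((c * A) * ((norm (U x))\<^sup>2 * w x))"
    proof (rule AE_I2)
      fix x
      have ax: "0 \<le> a x" using a(2)[of x] a(3) by linarith
      have "norm ((norm (U x))\<^sup>2 * (c * (a x * w x))) = ((norm (U x))\<^sup>2 * w x * c) * a x"
        using ax c w_nonneg[of x] by (simp add: abs_mult)
      also have "\<dots> \<le> ((norm (U x))\<^sup>2 * w x * c) * A"
        using a(4) w_nonneg c by (intro mult_left_mono) auto
      also have "\<dots> \<le> norm ((c * A) * ((norm (U x))\<^sup>2 * w x))"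
        unfolding real_norm_def by (rule order_trans[OF _ abs_ge_self]) (simp add: mult_ac)
      finally show "norm ((norm (U x))\<^sup>2 * (c * (a x * w x))) \<le> norm ((c * A) * ((norm (U x))\<^sup>2 * w x))" .
    qed
  qed
qed

lemma H1_imp_wpair:
  assumes a: "continuous_on UNIV a" "\<And>x. a0 \<le> a x" "0 < a0" "\<And>x. a x \<le> A" and c: "c > 0"
    and u: "u \<in> H1 (\<lambda>x. c * (a x * w x))"
  shows "wpair w u (wgrad u)"
proof -
  have hw: "has_weak_grad u (wgrad u)" using u has_weak_grad_wgrad by (auto simp: H1_def)
  have gm: "wgrad u \<in> borel_measurable lebesgue" using hw locally_integrable_measurable by (auto simp: has_weak_grad_def)
  have um: "u \<in> borel_measurable lebesgue" using u by (auto simp: H1_def L2_def)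
  have "sqint w u" using sqint_equivalent_weight[OF um a c] u by (simp add: H1_def L2_def)
  moreover have "sqint w (wgrad u)" using sqint_equivalent_weight[OF gm a c] u by (simp add: H1_def)
  ultimately show ?thesis using hw by (simp add: wpair_def)
qed

lemma wpair_imp_H1:
  assumes a: "continuous_on UNIV a" "\<And>x. a0 \<le> a x" "0 < a0" "\<And>x. a x \<le> A" and c: "c > 0"
    and u: "wpair w u g"
  shows "u \<in> H1 (\<lambda>x. c * (a x * w x))" "AE x in lebesgue. wgrad u x = g x"
proof -
  have hw: "has_weak_grad u (wgrad u)" using u has_weak_grad_wgrad by (auto simp: wpair_def)
  have gm: "wgrad u \<in> borel_measurable lebesgue" using hw locally_integrable_measurable by (auto simp: has_weak_grad_def)
  show ae: "AE x in lebesgue. wgrad u x = g x" using weak_grad_unique[OF hw] u by (simp add: wpair_def)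
  have s: "sqint w u" "sqint w g" using u by (auto simp: wpair_def)
  have um: "u \<in> borel_measurable lebesgue" using s(1) by (simp add: sqint_def)
  have "AE x in lebesgue. g x = wgrad u x" using ae by eventually_elim simp
  then have "sqint w (wgrad u)" by (rule sqint_cong_AE[OF s(2) gm])
  then show "u \<in> H1 (\<lambda>x. c * (a x * w x))"
    using sqint_equivalent_weight[OF um a c] sqint_equivalent_weight[OF gm a c] s(1) um hw
    unfolding H1_def L2_def by (simp only: mem_Collect_eq real_norm_def power2_abs) blast
qed

end

context homogenization begin

text \<open>By \<open>expansion_form\<close> the residual consists of oscillating integrals and a term of order \<open>\<epsilon>\<close>. Replacing the
oscillating factors by their means leaves \<open>M\<close> times the residual of \<open>v\<close> in the homogenized equation,
which equals the homogenized form of \<open>u0 - v\<close>. The constant \<open>C\<close> is the same for all \<open>v\<close> and \<open>d\<close>, while the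
range of admissible \<open>\<epsilon>\<close> depends on them.\<close>

lemma expansion_residual:
  assumes f: "sqint w f" and u0: "wpair w u0 g0"
    and eq0: "\<And>\<psi>. test_function \<psi> \<Longrightarrow> \<sigma> * (LINT x|lebesgue. ((K *v g0 x) \<bullet> grad \<psi> x) * w x)
       + \<eta> * (LINT x|lebesgue. u0 x * \<psi> x * w x) = (LINT x|lebesgue. f x * \<psi> x * w x)"
  obtains C where "C \<ge> 0" "\<And>d v. d > 0 \<Longrightarrow> test_function v \<Longrightarrow> wnorm w (\<lambda>x. u0 x - v x) < d \<Longrightarrow> wnorm w (\<lambda>x. g0 x - grad v x) < d \<Longrightarrow>
     \<forall>\<^sub>F \<epsilon> in at_right 0. \<forall>\<psi>. test_function \<psi> \<longrightarrow>
       \<bar>(LINT x|lebesgue. f x * \<psi> x * (m_eps \<epsilon> x * w x)) - energy_form \<sigma> \<eta> (m_eps \<epsilon>) (expansion v \<epsilon>) (grad (expansion v \<epsilon>)) \<psi> (grad \<psi>)\<bar> \<le> C * d * N \<psi>"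
proof -
  obtain a0 A where mb: "a0 > 0" "\<And>y. a0 \<le> m y" "\<And>y. m y \<le> A" using m_bounds by metis
  obtain CK where CK: "CK \<ge> 0" "\<And>G H. sqint w G \<Longrightarrow> sqint w H \<Longrightarrow>
     integrable lebesgue (\<lambda>x. ((K *v G x) \<bullet> H x) * w x) \<and> \<bar>LINT x|lebesgue. ((K *v G x) \<bullet> H x) * w x\<bar> \<le> CK * (wnorm w G * wnorm w H)"
    by (rule matrix_form_bound) blast
  obtain Cr where Cr: "Cr \<ge> 0" "\<And>\<epsilon> V. (\<And>k. continuous_on UNIV (V k)) \<Longrightarrow> (\<And>k. csupp (V k)) \<Longrightarrow>
     sqint w (corr_sum V \<epsilon> :: _ \<Rightarrow> real^'n) \<and> wnorm w (corr_sum V \<epsilon>) \<le> Cr * (\<Sum>k\<in>UNIV. wnorm w (V k))"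
    by (rule corr_sum_bound[where 'b="real^'n"]) blast
  obtain Cq where Cq: "Cq \<ge> 0" "\<And>\<epsilon> V. (\<And>k. continuous_on UNIV (V k)) \<Longrightarrow> (\<And>k. csupp (V k)) \<Longrightarrow>
     sqint w (corr_sum V \<epsilon> :: _ \<Rightarrow> real) \<and> wnorm w (corr_sum V \<epsilon>) \<le> Cq * (\<Sum>k\<in>UNIV. wnorm w (V k))"
    by (rule corr_sum_bound[where 'b=real]) blast
  let ?n2 = "real CARD('n) * real CARD('n)"
  \<comment> \<open>One summand for each group of terms in the decomposition \<open>split\<close> below.\<close>
  define C where "C = 1 + \<sigma> * ?n2 + \<bar>M\<bar> * (\<sigma> * CK + \<eta>) + 1"
  have C: "C \<ge> 0" unfolding C_def using \<sigma> \<eta> CK(1) by (intro add_nonneg_nonneg mult_nonneg_nonneg) auto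
  have su: "sqint w u0" "sqint w g0" using u0 by (auto simp: wpair_def)
  show ?thesis
  proof (rule that[OF C])
    fix d v assume d: "d > 0" and v: "test_function v" and near: "wnorm w (\<lambda>x. u0 x - v x) < d" "wnorm w (\<lambda>x. g0 x - grad v x) < d"
    note sv = test_function_sqint[OF v]
    define h where "h x = f x - \<eta> * v x" for x
    have sh: "sqint w h" unfolding h_def using sqint_diff[OF f sqint_scale[OF sv(1), of \<eta>]] by simp
    define S where "S = (\<sigma> + \<eta>) * A * (Cq * (\<Sum>k\<in>UNIV. wnorm w (partial k v)) + Cr * (\<Sum>k\<in>UNIV. wnorm w (grad (partial k v))))"
    have A0: "A > 0" using mb(1) order_trans[OF mb(2,3)] by (meson less_le_trans)
    have S: "S \<ge> 0" unfolding S_def using \<sigma> \<eta> A0 Cq(1) Cr(1)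
      by (intro mult_nonneg_nonneg add_nonneg_nonneg sum_nonneg wnorm_nonneg) auto
    have e1: "\<forall>\<^sub>F \<epsilon> in at_right 0. \<forall>\<psi>. test_function \<psi> \<longrightarrow>
      \<bar>(LINT x|lebesgue. h x * \<psi> x * m_eps \<epsilon> x * w x) - M * (LINT x|lebesgue. h x * \<psi> x * w x)\<bar> \<le> d * N \<psi>"
      unfolding M_def by (rule oscillation_to_mean[OF sh m_cont m_per d])
    have e2: "\<forall>\<^sub>F \<epsilon> in at_right 0. \<forall>k j. \<forall>\<psi>. test_function \<psi> \<longrightarrow>
      \<bar>(LINT x|lebesgue. flux_source v k j x * \<psi> x * flux k j ((1/\<epsilon>) *\<^sub>R x) * w x) - M * K $ k $ j * (LINT x|lebesgue. flux_source v k j x * \<psi> x * w x)\<bar> \<le> d * N \<psi>"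
      unfolding flux_cell_mean[symmetric]
      by (intro eventually_all_finite oscillation_to_mean flux_source_sqint v flux_cont flux_per d)
    have e3: "\<forall>\<^sub>F \<epsilon> in at_right 0. 0 < \<epsilon> \<and> \<epsilon> < d / (S + 1)"
    proof -
      have "d / (S + 1) > 0" using d S by simp
      then show ?thesis unfolding eventually_at_right_field by blast
    qed
    show "\<forall>\<^sub>F \<epsilon> in at_right 0. \<forall>\<psi>. test_function \<psi> \<longrightarrow>
       \<bar>(LINT x|lebesgue. f x * \<psi> x * (m_eps \<epsilon> x * w x)) - energy_form \<sigma> \<eta> (m_eps \<epsilon>) (expansion v \<epsilon>) (grad (expansion v \<epsilon>)) \<psi> (grad \<psi>)\<bar> \<le> C * d * N \<psi>"
      using e1 e2 e3
    proof eventually_elim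
      case (elim \<epsilon>)
      show ?case
      proof (intro allI impI)
        fix \<psi> :: "real^'n \<Rightarrow> real" assume \<psi>: "test_function \<psi>"
        note sp = test_function_sqint[OF \<psi>]
        have e: "\<epsilon> > 0" and es: "\<epsilon> * (S + 1) \<le> d" using elim(3) S by (auto simp: field_simps)
        have mc: "continuous_on UNIV (m_eps \<epsilon>)" by (rule continuous_on_scaled[OF m_cont])
        note a = mc less_imp_le[OF exp_gt_zero] mb(3)
        let ?R = "energy_form \<sigma> \<eta> (m_eps \<epsilon>) (corr_sum (\<lambda>k. partial k v) \<epsilon>) (corr_sum (\<lambda>k. grad (partial k v)) \<epsilon>) \<psi> (grad \<psi>)"
        define F where "F = (LINT x|lebesgue. h x * \<psi> x * m_eps \<epsilon> x * w x)"
        define F0 where "F0 = (LINT x|lebesgue. h x * \<psi> x * w x)"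
        define G where "G k j = (LINT x|lebesgue. flux_source v k j x * \<psi> x * flux k j ((1/\<epsilon>) *\<^sub>R x) * w x)" for k j
        define G0 where "G0 k j = (LINT x|lebesgue. flux_source v k j x * \<psi> x * w x)" for k j
        have bF: "\<bar>F - M * F0\<bar> \<le> d * N \<psi>" unfolding F_def F0_def using elim(1) \<psi> by blast
        have bG: "\<bar>G k j - M * K $ k $ j * G0 k j\<bar> \<le> d * N \<psi>" for k j unfolding G_def G0_def using elim(2) \<psi> by blast
        have if1: "integrable lebesgue (\<lambda>x. f x * \<psi> x * (m_eps \<epsilon> x * w x))" using weighted_inner_bound(1)[OF a f sp(1)] by simp
        have if2: "integrable lebesgue (\<lambda>x. v x * \<psi> x * (m_eps \<epsilon> x * w x))" using weighted_inner_bound(1)[OF a sv(1) sp(1)] by simp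
        have if3: "integrable lebesgue (\<lambda>x. f x * \<psi> x * w x)" using sqint_inner[OF f sp(1)] by simp
        have if4: "integrable lebesgue (\<lambda>x. v x * \<psi> x * w x)" using sqint_inner[OF sv(1) sp(1)] by simp
        have if5: "integrable lebesgue (\<lambda>x. u0 x * \<psi> x * w x)" using sqint_inner[OF su(1) sp(1)] by simp
        have Feq: "F = (LINT x|lebesgue. f x * \<psi> x * (m_eps \<epsilon> x * w x)) - \<eta> * (LINT x|lebesgue. v x * \<psi> x * m_eps \<epsilon> x * w x)"
        proof -
          have "F = (LINT x|lebesgue. f x * \<psi> x * (m_eps \<epsilon> x * w x) - \<eta> * (v x * \<psi> x * (m_eps \<epsilon> x * w x)))"
            unfolding F_def by (intro Bochner_Integration.integral_cong refl) (simp add: h_def algebra_simps)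
          then show ?thesis using if1 if2 by (simp add: mult.assoc)
        qed
        have F0eq: "F0 = (LINT x|lebesgue. f x * \<psi> x * w x) - \<eta> * (LINT x|lebesgue. v x * \<psi> x * w x)"
        proof -
          have "F0 = (LINT x|lebesgue. f x * \<psi> x * w x - \<eta> * (v x * \<psi> x * w x))"
            unfolding F0_def by (intro Bochner_Integration.integral_cong refl) (simp add: h_def algebra_simps)
          then show ?thesis using if3 if4 by simp
        qed
        have mean: "F0 + \<sigma> * (\<Sum>k\<in>UNIV. \<Sum>j\<in>UNIV. K $ k $ j * G0 k j)
           = \<sigma> * (LINT x|lebesgue. ((K *v (g0 x - grad v x)) \<bullet> grad \<psi> x) * w x) + \<eta> * (LINT x|lebesgue. (u0 x - v x) \<bullet> \<psi> x * w x)"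
        proof -
          have x1: "(LINT x|lebesgue. ((K *v (g0 x - grad v x)) \<bullet> grad \<psi> x) * w x)
             = (LINT x|lebesgue. ((K *v g0 x) \<bullet> grad \<psi> x) * w x) - (LINT x|lebesgue. ((K *v grad v x) \<bullet> grad \<psi> x) * w x)"
            using CK(2)[OF su(2) sp(2)] CK(2)[OF sv(2) sp(2)] by (simp add: matrix_vector_mult_diff_distrib inner_diff_left left_diff_distrib)
          have x2: "(LINT x|lebesgue. (u0 x - v x) \<bullet> \<psi> x * w x) = (LINT x|lebesgue. u0 x * \<psi> x * w x) - (LINT x|lebesgue. v x * \<psi> x * w x)"
            using if4 if5 by (simp add: left_diff_distrib)
          have x3: "(LINT x|lebesgue. ((K *v grad v x) \<bullet> grad \<psi> x) * w x) = - (\<Sum>k\<in>UNIV. \<Sum>j\<in>UNIV. K $ k $ j * G0 k j)"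
            unfolding G0_def by (rule homogenized_form[OF v \<psi>])
          show ?thesis unfolding x1 x2 x3 F0eq eq0[OF \<psi>, symmetric] by (simp only: ring_distribs minus_minus)
        qed
        have Nge: "wnorm w \<psi> \<le> N \<psi>" "wnorm w (grad \<psi>) \<le> N \<psi>" using wnorm_nonneg[of \<psi>] wnorm_nonneg[of "grad \<psi>"] by (auto simp: H1_sum_norm_def)
        have b1: "\<bar>LINT x|lebesgue. ((K *v (g0 x - grad v x)) \<bullet> grad \<psi> x) * w x\<bar> \<le> CK * (d * N \<psi>)"
          using CK(2)[OF sqint_diff[OF su(2) sv(2)] sp(2)] CK(1) near(2) Nge(2) wnorm_nonneg d
          by (intro order_trans[OF conjunct2[OF CK(2)[OF sqint_diff[OF su(2) sv(2)] sp(2)]]] mult_left_mono mult_mono) auto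
        have b2: "\<bar>LINT x|lebesgue. (u0 x - v x) \<bullet> \<psi> x * w x\<bar> \<le> d * N \<psi>"
          using near(1) Nge(1) wnorm_nonneg d
          by (intro order_trans[OF weighted_Cauchy_Schwarz[OF sqint_diff[OF su(1) sv(1)] sp(1)]] mult_mono) auto
        have b3: "\<bar>M * (F0 + \<sigma> * (\<Sum>k\<in>UNIV. \<Sum>j\<in>UNIV. K $ k $ j * G0 k j))\<bar> \<le> \<bar>M\<bar> * (\<sigma> * CK + \<eta>) * (d * N \<psi>)"
        proof -
          have "\<bar>\<sigma> * (LINT x|lebesgue. ((K *v (g0 x - grad v x)) \<bullet> grad \<psi> x) * w x) + \<eta> * (LINT x|lebesgue. (u0 x - v x) \<bullet> \<psi> x * w x)\<bar>
             \<le> \<sigma> * (CK * (d * N \<psi>)) + \<eta> * (d * N \<psi>)"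
            using b1 b2 \<sigma> \<eta> by (intro order_trans[OF abs_triangle_ineq] add_mono) (auto simp: abs_mult intro!: mult_left_mono)
          then have "\<bar>F0 + \<sigma> * (\<Sum>k\<in>UNIV. \<Sum>j\<in>UNIV. K $ k $ j * G0 k j)\<bar> \<le> (\<sigma> * CK + \<eta>) * (d * N \<psi>)"
            unfolding mean by (simp add: algebra_simps)
          from mult_left_mono[OF this abs_ge_zero[of M]] show ?thesis by (simp add: abs_mult mult.assoc)
        qed
        have b4: "\<bar>\<Sum>k\<in>UNIV. \<Sum>j\<in>UNIV. (G k j - M * K $ k $ j * G0 k j)\<bar> \<le> ?n2 * (d * N \<psi>)"
        proof -
          have "\<bar>\<Sum>k\<in>UNIV. \<Sum>j\<in>UNIV. (G k j - M * K $ k $ j * G0 k j)\<bar> \<le> (\<Sum>k\<in>(UNIV::'n set). \<Sum>j\<in>(UNIV::'n set). d * N \<psi>)"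
            by (intro order_trans[OF sum_abs] sum_mono bG)
          then show ?thesis by (simp add: mult.assoc)
        qed
        have b5: "\<epsilon> * \<bar>?R\<bar> \<le> d * N \<psi>"
        proof -
          note pv = test_functionD[OF test_function_partials(1)[OF v]]
          have q: "sqint w (corr_sum (\<lambda>k. partial k v) \<epsilon>)" "wnorm w (corr_sum (\<lambda>k. partial k v) \<epsilon>) \<le> Cq * (\<Sum>k\<in>UNIV. wnorm w (partial k v))"
            using Cq(2)[of "\<lambda>k. partial k v" \<epsilon>] pv(2,3) by auto
          have r: "sqint w (corr_sum (\<lambda>k. grad (partial k v)) \<epsilon>)" "wnorm w (corr_sum (\<lambda>k. grad (partial k v)) \<epsilon>) \<le> Cr * (\<Sum>k\<in>UNIV. wnorm w (grad (partial k v)))"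
            using Cr(2)[of "\<lambda>k. grad (partial k v)" \<epsilon>] grad_continuous[OF pv(1)] csupp_grad[OF pv(2)] by auto
          have "\<bar>?R\<bar> \<le> (\<sigma> + \<eta>) * A * (H1_sum_norm (corr_sum (\<lambda>k. partial k v) \<epsilon>) (corr_sum (\<lambda>k. grad (partial k v)) \<epsilon>) * N \<psi>)"
            using energy_form_bound[OF a _ _ q(1) r(1) sp] \<sigma> \<eta> by simp
          also have "\<dots> \<le> (\<sigma> + \<eta>) * A * ((Cq * (\<Sum>k\<in>UNIV. wnorm w (partial k v)) + Cr * (\<Sum>k\<in>UNIV. wnorm w (grad (partial k v)))) * N \<psi>)"
            using \<sigma> \<eta> A0 q(2) r(2) N_nonneg unfolding H1_sum_norm_def[of "corr_sum _ _"] by (intro mult_left_mono mult_right_mono add_mono) auto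
          finally have "\<bar>?R\<bar> \<le> S * N \<psi>" by (simp add: S_def mult.assoc)
          then have "\<epsilon> * \<bar>?R\<bar> \<le> \<epsilon> * (S * N \<psi>)" using e by (intro mult_left_mono) auto
          also have "\<dots> = (\<epsilon> * S) * N \<psi>" by simp
          also have "\<dots> \<le> d * N \<psi>" using es e N_nonneg[of \<psi>] by (intro mult_right_mono) (auto simp: algebra_simps)
          finally show ?thesis .
        qed
        \<comment> \<open>Two oscillation errors, the mean value of the residual, and the remainder of order \<open>\<epsilon>\<close>.\<close>
        have split: "(LINT x|lebesgue. f x * \<psi> x * (m_eps \<epsilon> x * w x)) - energy_form \<sigma> \<eta> (m_eps \<epsilon>) (expansion v \<epsilon>) (grad (expansion v \<epsilon>)) \<psi> (grad \<psi>)
           = (F - M * F0) + \<sigma> * (\<Sum>k\<in>UNIV. \<Sum>j\<in>UNIV. (G k j - M * K $ k $ j * G0 k j))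
             + M * (F0 + \<sigma> * (\<Sum>k\<in>UNIV. \<Sum>j\<in>UNIV. K $ k $ j * G0 k j)) - \<epsilon> * ?R"
        proof -
          have D: "(\<Sum>k\<in>UNIV. \<Sum>j\<in>UNIV. (G k j - M * K $ k $ j * G0 k j)) = (\<Sum>k\<in>UNIV. \<Sum>j\<in>UNIV. G k j) - M * (\<Sum>k\<in>UNIV. \<Sum>j\<in>UNIV. K $ k $ j * G0 k j)"
            by (simp add: sum_subtractf sum_distrib_left mult.assoc)
          show ?thesis unfolding D expansion_form[OF v \<psi> e] Feq G_def[symmetric] by (simp add: algebra_simps)
        qed
        have "\<sigma> * \<bar>\<Sum>k\<in>UNIV. \<Sum>j\<in>UNIV. (G k j - M * K $ k $ j * G0 k j)\<bar> \<le> \<sigma> * (?n2 * (d * N \<psi>))"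
          using b4 \<sigma> by (intro mult_left_mono) auto
        then have b4': "\<bar>\<sigma> * (\<Sum>k\<in>UNIV. \<Sum>j\<in>UNIV. (G k j - M * K $ k $ j * G0 k j))\<bar> \<le> \<sigma> * (?n2 * (d * N \<psi>))"
          using \<sigma> by (simp add: abs_mult)
        have b5': "\<bar>\<epsilon> * ?R\<bar> \<le> d * N \<psi>" using b5 e by (simp add: abs_mult)
        have abs4: "\<bar>a1 + a2 + a3 - a4\<bar> \<le> c1 + c2 + c3 + c4" if "\<bar>a1\<bar> \<le> c1" "\<bar>a2\<bar> \<le> c2" "\<bar>a3\<bar> \<le> c3" "\<bar>a4\<bar> \<le> c4" for a1 a2 a3 a4 c1 c2 c3 c4 :: real
          using that by linarith
        have "\<bar>(LINT x|lebesgue. f x * \<psi> x * (m_eps \<epsilon> x * w x)) - energy_form \<sigma> \<eta> (m_eps \<epsilon>) (expansion v \<epsilon>) (grad (expansion v \<epsilon>)) \<psi> (grad \<psi>)\<bar>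
          \<le> d * N \<psi> + \<sigma> * (?n2 * (d * N \<psi>)) + \<bar>M\<bar> * (\<sigma> * CK + \<eta>) * (d * N \<psi>) + d * N \<psi>"
          unfolding split by (rule abs4[OF bF b4' b3 b5'])
        also have "\<dots> = C * d * N \<psi>" by (simp add: C_def algebra_simps)
        finally show "\<bar>(LINT x|lebesgue. f x * \<psi> x * (m_eps \<epsilon> x * w x)) - energy_form \<sigma> \<eta> (m_eps \<epsilon>) (expansion v \<epsilon>) (grad (expansion v \<epsilon>)) \<psi> (grad \<psi>)\<bar> \<le> C * d * N \<psi>" .
      qed
    qed
  qed
qed

text \<open>The distance from \<open>u \<epsilon>\<close> to \<open>u0\<close> is split at the expansion and at \<open>v\<close>. The bound on the gradients is the
energy estimate for \<open>u \<epsilon>\<close> itself.\<close>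

lemma strong_convergence:
  assumes f: "sqint w f" and u0: "wpair w u0 g0"
    and eq0: "\<And>\<psi>. test_function \<psi> \<Longrightarrow> \<sigma> * (LINT x|lebesgue. ((K *v g0 x) \<bullet> grad \<psi> x) * w x)
       + \<eta> * (LINT x|lebesgue. u0 x * \<psi> x * w x) = (LINT x|lebesgue. f x * \<psi> x * w x)"
    and u: "\<And>\<epsilon>. \<epsilon> > 0 \<Longrightarrow> wpair w (u \<epsilon>) (g \<epsilon>)"
    and eq: "\<And>\<epsilon> \<psi>. \<epsilon> > 0 \<Longrightarrow> test_function \<psi> \<Longrightarrow>
       energy_form \<sigma> \<eta> (m_eps \<epsilon>) (u \<epsilon>) (g \<epsilon>) \<psi> (grad \<psi>) = (LINT x|lebesgue. f x * \<psi> x * (m_eps \<epsilon> x * w x))"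
  shows "((\<lambda>\<epsilon>. wnorm w (\<lambda>x. u \<epsilon> x - u0 x)) \<longlongrightarrow> 0) (at_right 0)"
    and "\<exists>B. \<forall>\<epsilon>>0. wnorm w (g \<epsilon>) \<le> B"
proof -
  obtain a0 A where mb: "a0 > 0" "\<And>y. a0 \<le> m y" "\<And>y. m y \<le> A" using m_bounds by metis
  have A0: "A \<ge> 0" using mb(1) order_trans[OF mb(2,3)] by (meson less_imp_le order_trans)
  define c0 where "c0 = min \<sigma> \<eta> * a0 / 2"
  have c0: "c0 > 0" using \<sigma> \<eta> mb(1) by (simp add: c0_def)
  have mc: "continuous_on UNIV (m_eps \<epsilon>)" for \<epsilon> by (rule continuous_on_scaled[OF m_cont])
  have m0: "0 \<le> m y" for y by simp
  show "\<exists>B. \<forall>\<epsilon>>0. wnorm w (g \<epsilon>) \<le> B"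
  proof (intro exI allI impI)
    fix \<epsilon> :: real assume e: "\<epsilon> > 0"
    have "c0 * H1_sum_norm (u \<epsilon>) (g \<epsilon>) \<le> A * wnorm w f"
      unfolding c0_def
    proof (rule energy_estimate[OF mc mb(2,1,3) \<sigma> \<eta> u[OF e]])
      show "0 \<le> A * wnorm w f" by (intro mult_nonneg_nonneg wnorm_nonneg A0)
      fix \<psi> :: "real^'n \<Rightarrow> real" assume \<psi>: "test_function \<psi>"
      note sp = test_function_sqint[OF \<psi>]
      have "\<bar>energy_form \<sigma> \<eta> (m_eps \<epsilon>) (u \<epsilon>) (g \<epsilon>) \<psi> (grad \<psi>)\<bar> \<le> A * (wnorm w f * wnorm w \<psi>)"
        unfolding eq[OF e \<psi>] using weighted_inner_bound(2)[OF mc m0 mb(3) f sp(1)] by simp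
      also have "\<dots> \<le> A * (wnorm w f * N \<psi>)"
        using A0 wnorm_nonneg[of f] wnorm_nonneg[of "grad \<psi>"] by (intro mult_left_mono) (auto simp: H1_sum_norm_def)
      finally show "\<bar>energy_form \<sigma> \<eta> (m_eps \<epsilon>) (u \<epsilon>) (g \<epsilon>) \<psi> (grad \<psi>)\<bar> \<le> A * wnorm w f * N \<psi>" by (simp add: mult.assoc)
    qed
    then have "H1_sum_norm (u \<epsilon>) (g \<epsilon>) \<le> A * wnorm w f / c0" using c0 by (simp add: pos_le_divide_eq mult.commute)
    then show "wnorm w (g \<epsilon>) \<le> A * wnorm w f / c0" using wnorm_nonneg[of "u \<epsilon>"] by (simp add: H1_sum_norm_def)
  qed
  obtain C where C: "C \<ge> 0" "\<And>d v. d > 0 \<Longrightarrow> test_function v \<Longrightarrow> wnorm w (\<lambda>x. u0 x - v x) < d \<Longrightarrow> wnorm w (\<lambda>x. g0 x - grad v x) < d \<Longrightarrow>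
     \<forall>\<^sub>F \<epsilon> in at_right 0. \<forall>\<psi>. test_function \<psi> \<longrightarrow>
       \<bar>(LINT x|lebesgue. f x * \<psi> x * (m_eps \<epsilon> x * w x)) - energy_form \<sigma> \<eta> (m_eps \<epsilon>) (expansion v \<epsilon>) (grad (expansion v \<epsilon>)) \<psi> (grad \<psi>)\<bar> \<le> C * d * N \<psi>"
    using expansion_residual[OF f u0 eq0] by blast
  obtain Cq where Cq: "Cq \<ge> 0" "\<And>\<epsilon> V. (\<And>k. continuous_on UNIV (V k)) \<Longrightarrow> (\<And>k. csupp (V k)) \<Longrightarrow>
     sqint w (corr_sum V \<epsilon> :: _ \<Rightarrow> real) \<and> wnorm w (corr_sum V \<epsilon>) \<le> Cq * (\<Sum>k\<in>UNIV. wnorm w (V k))"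
    by (rule corr_sum_bound[where 'b=real]) blast
  have su: "sqint w u0" "sqint w g0" using u0 by (auto simp: wpair_def)
  \<comment> \<open>The distances from \<open>u \<epsilon>\<close> to the expansion, from the expansion to \<open>v\<close>, and from \<open>v\<close> to \<open>u0\<close>.\<close>
  define C1 where "C1 = C / c0 + 2"
  have C1: "C1 > 0" using C(1) c0 by (simp add: C1_def add_nonneg_pos)
  have close: "\<forall>\<^sub>F \<epsilon> in at_right 0. wnorm w (\<lambda>x. u \<epsilon> x - u0 x) \<le> C1 * d" if d: "d > 0" for d
  proof -
    obtain v where v: "test_function v" and near: "wnorm w (\<lambda>x. u0 x - v x) < d" "wnorm w (\<lambda>x. g0 x - grad v x) < d"
      using test_dense_H1[OF u0 d] by blast
    define S where "S = Cq * (\<Sum>k\<in>UNIV. wnorm w (partial k v))"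
    have S: "S \<ge> 0" unfolding S_def using Cq(1) wnorm_nonneg by (intro mult_nonneg_nonneg sum_nonneg) auto
    have e3: "\<forall>\<^sub>F \<epsilon> in at_right 0. 0 < \<epsilon> \<and> \<epsilon> < d / (S + 1)"
    proof -
      have "d / (S + 1) > 0" using d S by simp
      then show ?thesis unfolding eventually_at_right_field by blast
    qed
    show ?thesis using C(2)[OF d v near] e3
    proof eventually_elim
      case (elim \<epsilon>)
      have e: "\<epsilon> > 0" and es: "\<epsilon> * (S + 1) \<le> d" using elim(2) S by (auto simp: field_simps)
      let ?W = "expansion v \<epsilon>"
      note sv = test_function_sqint[OF v]
      have pW: "wpair w ?W (grad ?W)" using expansion_C1[OF v] by (rule wpair_C1)
      then have sW: "sqint w ?W" "sqint w (grad ?W)" by (auto simp: wpair_def)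
      have sue: "sqint w (u \<epsilon>)" "sqint w (g \<epsilon>)" using u[OF e] by (auto simp: wpair_def)
      have "c0 * H1_sum_norm (\<lambda>x. u \<epsilon> x - ?W x) (\<lambda>x. g \<epsilon> x - grad ?W x) \<le> C * d"
        unfolding c0_def
      proof (rule energy_estimate[OF mc mb(2,1,3) \<sigma> \<eta> wpair_diff[OF u[OF e] pW]])
        show "0 \<le> C * d" using C(1) d by simp
        fix \<psi> :: "real^'n \<Rightarrow> real" assume \<psi>: "test_function \<psi>"
        note sp = test_function_sqint[OF \<psi>]
        show "\<bar>energy_form \<sigma> \<eta> (m_eps \<epsilon>) (\<lambda>x. u \<epsilon> x - ?W x) (\<lambda>x. g \<epsilon> x - grad ?W x) \<psi> (grad \<psi>)\<bar> \<le> C * d * N \<psi>"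
          unfolding energy_form_diff(1)[OF mc m0 mb(3) sue sp sW] eq[OF e \<psi>] using elim(1) \<psi> by blast
      qed
      then have "H1_sum_norm (\<lambda>x. u \<epsilon> x - ?W x) (\<lambda>x. g \<epsilon> x - grad ?W x) \<le> C * d / c0" using c0 by (simp add: pos_le_divide_eq mult.commute)
      then have n1: "wnorm w (\<lambda>x. u \<epsilon> x - ?W x) \<le> C * d / c0"
        using wnorm_nonneg[of "\<lambda>x. g \<epsilon> x - grad ?W x"] by (simp add: H1_sum_norm_def)
      have n2: "wnorm w (\<lambda>x. ?W x - v x) \<le> d"
      proof -
        have "(\<lambda>x. ?W x - v x) = (\<lambda>x. \<epsilon> *\<^sub>R corr_sum (\<lambda>k. partial k v) \<epsilon> x)" by (simp add: expansion_def corr_sum_def)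
        then have "wnorm w (\<lambda>x. ?W x - v x) = \<epsilon> * wnorm w (corr_sum (\<lambda>k. partial k v) \<epsilon>)"
          using wnorm_scale[of \<epsilon> "corr_sum (\<lambda>k. partial k v) \<epsilon>"] e by simp
        also have "\<dots> \<le> \<epsilon> * S"
          unfolding S_def using Cq(2)[of "\<lambda>k. partial k v" \<epsilon>] test_functionD(2,3)[OF test_function_partials(1)[OF v]] e
          by (intro mult_left_mono) auto
        also have "\<dots> \<le> d" using es e by (simp add: algebra_simps)
        finally show ?thesis .
      qed
      have "wnorm w (\<lambda>x. u \<epsilon> x - u0 x) \<le> wnorm w (\<lambda>x. u \<epsilon> x - ?W x) + wnorm w (\<lambda>x. ?W x - u0 x)"
        by (rule wnorm_diff_triangle[OF sue(1) sW(1) su(1)])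
      also have "wnorm w (\<lambda>x. ?W x - u0 x) \<le> wnorm w (\<lambda>x. ?W x - v x) + wnorm w (\<lambda>x. v x - u0 x)"
        by (rule wnorm_diff_triangle[OF sW(1) sv(1) su(1)])
      also have "wnorm w (\<lambda>x. v x - u0 x) \<le> d" using near(1) wnorm_minus_commute[of v u0] by simp
      finally have "wnorm w (\<lambda>x. u \<epsilon> x - u0 x) \<le> C * d / c0 + (d + d)" using n1 n2 by linarith
      then show ?case by (simp add: C1_def algebra_simps)
    qed
  qed
  show "((\<lambda>\<epsilon>. wnorm w (\<lambda>x. u \<epsilon> x - u0 x)) \<longlongrightarrow> 0) (at_right 0)"
  proof (rule tendstoI)
    fix e :: real assume "e > 0"
    then have d: "e / (2 * C1) > 0" using C1 by simp
    show "\<forall>\<^sub>F \<epsilon> in at_right 0. dist (wnorm w (\<lambda>x. u \<epsilon> x - u0 x)) 0 < e"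
      using close[OF d]
    proof eventually_elim
      case (elim \<epsilon>)
      then have "wnorm w (\<lambda>x. u \<epsilon> x - u0 x) \<le> e / 2" using C1 by simp
      then show ?case using \<open>e > 0\<close> wnorm_nonneg[of "\<lambda>x. u \<epsilon> x - u0 x"] by simp
    qed
  qed
qed

text \<open>The functions \<open>w * partial i t\<close> are test functions, because \<open>w\<close> is smooth.\<close>

lemma weak_gradient_by_parts:
  assumes u: "wpair w u g" and t: "test_function t"
  shows "(LINT x|lebesgue. (g x \<bullet> grad t x) * w x) = - (LINT x|lebesgue. u x * (\<Sum>i\<in>UNIV. flux_source t i i x) * w x)"
proof -
  have s: "sqint w u" "sqint w g" and wg: "has_weak_grad u g" using u by (auto simp: wpair_def)
  note pt = test_function_partials[OF t]
  have i1: "integrable lebesgue (\<lambda>x. weighted_partial t i x * g x $ i)" for i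
    using integrable_local_mult[OF locally_integrable_nth[OF sqint_locally_integrable[OF s(2)]] test_functionD(3,2)[OF pt(2)[of i]]] by simp
  have i2: "integrable lebesgue (\<lambda>x. u x * flux_source t i i x * w x)" for i
    using sqint_inner[OF s(1) flux_source_sqint[OF t]] by simp
  have "(LINT x|lebesgue. (g x \<bullet> grad t x) * w x) = (LINT x|lebesgue. (\<Sum>i\<in>UNIV. weighted_partial t i x * g x $ i))"
    by (intro Bochner_Integration.integral_cong refl) (simp add: inner_vec_def grad_def weighted_partial_def sum_distrib_left sum_distrib_right mult_ac)
  also have "\<dots> = (\<Sum>i\<in>UNIV. LINT x|lebesgue. weighted_partial t i x * g x $ i)" using i1 by simp
  also have "\<dots> = (\<Sum>i\<in>UNIV. - (LINT x|lebesgue. u x * partial i (weighted_partial t i) x))"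
    using wg pt(2) unfolding has_weak_grad_iff by (intro sum.cong refl) simp
  also have "\<dots> = (\<Sum>i\<in>UNIV. - (LINT x|lebesgue. u x * flux_source t i i x * w x))"
    by (intro sum.cong refl arg_cong[of _ _ uminus] Bochner_Integration.integral_cong) (simp add: flux_source_def less_imp_neq[OF w_pos, symmetric])
  also have "\<dots> = - (LINT x|lebesgue. (\<Sum>i\<in>UNIV. u x * flux_source t i i x * w x))" using i2 by (simp add: sum_negf)
  finally show ?thesis by (simp add: sum_distrib_left sum_distrib_right)
qed

text \<open>For the gradient of a test function in place of \<open>h\<close>, \<open>weak_gradient_by_parts\<close> reduces the claim to the
convergence of \<open>u \<epsilon>\<close>; the uniform bound \<open>B\<close> controls the error of this replacement.\<close>

lemma weak_gradient_convergence:
  fixes u :: "real \<Rightarrow> real^'n \<Rightarrow> real"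
  assumes u0: "wpair w u0 g0" and u: "\<And>\<epsilon>. \<epsilon> > 0 \<Longrightarrow> wpair w (u \<epsilon>) (g \<epsilon>)"
    and lim: "((\<lambda>\<epsilon>. wnorm w (\<lambda>x. u \<epsilon> x - u0 x)) \<longlongrightarrow> 0) (at_right 0)"
    and bd: "\<forall>\<epsilon>>0. wnorm w (g \<epsilon>) \<le> B" and v: "wpair w v h"
  shows "((\<lambda>\<epsilon>. LINT x|lebesgue. (g \<epsilon> x \<bullet> h x) * w x) \<longlongrightarrow> (LINT x|lebesgue. (g0 x \<bullet> h x) * w x)) (at_right 0)"
proof (rule tendstoI)
  fix r :: real assume r: "r > 0"
  have su: "sqint w u0" "sqint w g0" and sh: "sqint w h" using u0 v by (auto simp: wpair_def)
  define B1 where "B1 = B + wnorm w g0"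
  have B1: "B1 \<ge> 0" using bd[rule_format, of 1] wnorm_nonneg[of "g 1"] wnorm_nonneg[of g0] by (simp add: B1_def)
  define d where "d = r / (2 * (B1 + 1))"
  have d: "d > 0" using r B1 by (simp add: d_def)
  obtain t where t: "test_function t" "wnorm w (\<lambda>x. h x - grad t x) < d" using test_dense_H1[OF v d] by blast
  define F where "F x = (\<Sum>i\<in>UNIV. flux_source t i i x)" for x
  have F: "sqint w F" unfolding F_def[abs_def] by (intro sqint_sum flux_source_sqint t)
  have st: "sqint w (grad t)" using test_function_sqint(2)[OF t(1)] .
  have "((\<lambda>\<epsilon>. wnorm w (\<lambda>x. u \<epsilon> x - u0 x) * wnorm w F) \<longlongrightarrow> 0 * wnorm w F) (at_right 0)"
    by (intro tendsto_intros lim)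
  then have "\<forall>\<^sub>F \<epsilon> in at_right 0. wnorm w (\<lambda>x. u \<epsilon> x - u0 x) * wnorm w F < r / 2"
    using order_tendstoD(2)[of _ 0 _ "r/2"] r by simp
  moreover have "\<forall>\<^sub>F \<epsilon> in at_right 0. 0 < (\<epsilon>::real)" by (rule eventually_at_right_less)
  ultimately show "\<forall>\<^sub>F \<epsilon> in at_right 0. dist (LINT x|lebesgue. (g \<epsilon> x \<bullet> h x) * w x) (LINT x|lebesgue. (g0 x \<bullet> h x) * w x) < r"
  proof eventually_elim
    case (elim \<epsilon>)
    have pd: "wpair w (\<lambda>x. u \<epsilon> x - u0 x) (\<lambda>x. g \<epsilon> x - g0 x)" by (rule wpair_diff[OF u[OF elim(2)] u0])
    then have sd: "sqint w (\<lambda>x. u \<epsilon> x - u0 x)" "sqint w (\<lambda>x. g \<epsilon> x - g0 x)" by (auto simp: wpair_def)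
    have sg: "sqint w (g \<epsilon>)" using u[OF elim(2)] by (simp add: wpair_def)
    have i1: "integrable lebesgue (\<lambda>x. ((g \<epsilon> x - g0 x) \<bullet> (h x - grad t x)) * w x)" by (rule sqint_inner[OF sd(2) sqint_diff[OF sh st]])
    have i2: "integrable lebesgue (\<lambda>x. ((g \<epsilon> x - g0 x) \<bullet> grad t x) * w x)" by (rule sqint_inner[OF sd(2) st])
    have "(LINT x|lebesgue. (g \<epsilon> x \<bullet> h x) * w x) - (LINT x|lebesgue. (g0 x \<bullet> h x) * w x)
      = (LINT x|lebesgue. (g \<epsilon> x \<bullet> h x) * w x - (g0 x \<bullet> h x) * w x)"
      using sqint_inner[OF sg sh] sqint_inner[OF su(2) sh] by simp
    also have "\<dots> = (LINT x|lebesgue. ((g \<epsilon> x - g0 x) \<bullet> (h x - grad t x)) * w x + ((g \<epsilon> x - g0 x) \<bullet> grad t x) * w x)"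
      by (intro Bochner_Integration.integral_cong refl) (simp add: inner_diff_left inner_diff_right algebra_simps)
    also have "\<dots> = (LINT x|lebesgue. ((g \<epsilon> x - g0 x) \<bullet> (h x - grad t x)) * w x) - (LINT x|lebesgue. ((u \<epsilon> x - u0 x) \<bullet> F x) * w x)"
      using i1 i2 weak_gradient_by_parts[OF pd t(1)] by (simp add: F_def)
    finally have eq: "(LINT x|lebesgue. (g \<epsilon> x \<bullet> h x) * w x) - (LINT x|lebesgue. (g0 x \<bullet> h x) * w x)
      = (LINT x|lebesgue. ((g \<epsilon> x - g0 x) \<bullet> (h x - grad t x)) * w x) - (LINT x|lebesgue. ((u \<epsilon> x - u0 x) \<bullet> F x) * w x)" .
    have "wnorm w (\<lambda>x. g \<epsilon> x - g0 x) \<le> B1"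
    proof -
      have "wnorm w (\<lambda>x. g \<epsilon> x + (-1) *\<^sub>R g0 x) \<le> wnorm w (g \<epsilon>) + wnorm w (\<lambda>x. (-1) *\<^sub>R g0 x)"
        by (intro wnorm_triangle sqint_scale sg su)
      then show ?thesis using bd elim(2) wnorm_scale[of "-1" g0] by (simp add: B1_def) (smt (verit))
    qed
    then have "\<bar>LINT x|lebesgue. ((g \<epsilon> x - g0 x) \<bullet> (h x - grad t x)) * w x\<bar> \<le> B1 * d"
      using t(2) wnorm_nonneg B1
      by (intro order_trans[OF weighted_Cauchy_Schwarz[OF sd(2) sqint_diff[OF sh st]]] mult_mono) auto
    also have "B1 * d \<le> r / 2" using B1 r by (simp add: d_def field_simps)
    finally have b1: "\<bar>LINT x|lebesgue. ((g \<epsilon> x - g0 x) \<bullet> (h x - grad t x)) * w x\<bar> \<le> r / 2" .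
    have b2: "\<bar>LINT x|lebesgue. ((u \<epsilon> x - u0 x) \<bullet> F x) * w x\<bar> < r / 2"
      using weighted_Cauchy_Schwarz[OF sd(1) F] elim(1) by linarith
    show ?case unfolding dist_real_def eq using b1 b2 by linarith
  qed
qed

end


lemma (in weight) inner_tendsto:
  assumes u: "\<forall>\<^sub>F \<epsilon> in F. sqint w (u \<epsilon>)" and u0: "sqint w u0" and v: "sqint w v"
    and lim: "((\<lambda>\<epsilon>. wnorm w (\<lambda>x. u \<epsilon> x - u0 x)) \<longlongrightarrow> 0) F"
  shows "((\<lambda>\<epsilon>. LINT x|lebesgue. (u \<epsilon> x \<bullet> v x) * w x) \<longlongrightarrow> (LINT x|lebesgue. (u0 x \<bullet> v x) * w x)) F"
proof -
  have "((\<lambda>\<epsilon>. (LINT x|lebesgue. (u \<epsilon> x \<bullet> v x) * w x) - (LINT x|lebesgue. (u0 x \<bullet> v x) * w x)) \<longlongrightarrow> 0) F"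
  proof (rule tendsto_0_le[OF lim, where K="wnorm w v"])
    show "\<forall>\<^sub>F \<epsilon> in F. norm ((LINT x|lebesgue. (u \<epsilon> x \<bullet> v x) * w x) - (LINT x|lebesgue. (u0 x \<bullet> v x) * w x))
        \<le> norm (wnorm w (\<lambda>x. u \<epsilon> x - u0 x)) * wnorm w v"
      using u
    proof eventually_elim
      case (elim \<epsilon>)
      have "(LINT x|lebesgue. (u \<epsilon> x \<bullet> v x) * w x) - (LINT x|lebesgue. (u0 x \<bullet> v x) * w x)
        = (LINT x|lebesgue. ((u \<epsilon> x - u0 x) \<bullet> v x) * w x)"
        using sqint_inner[OF elim v] sqint_inner[OF u0 v] by (simp add: inner_diff_left left_diff_distrib)
      then show ?case
        using weighted_Cauchy_Schwarz[OF sqint_diff[OF elim u0] v] wnorm_nonneg[of "\<lambda>x. u \<epsilon> x - u0 x"] by simp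
    qed
  qed
  then show ?thesis using LIM_zero_iff by blast
qed

theorem theorem3p10:
  fixes V p f u0 :: "real^'n::finite \<Rightarrow> real"
    and u :: "real \<Rightarrow> real^'n \<Rightarrow> real"
    and \<Phi> :: "real^'n \<Rightarrow> real^'n"
    and \<sigma> L \<eta> :: real
  assumes "\<sigma> > 0" and "L > 0" and "\<eta> > 0"
    and "assumption_A L V p"
    and "assumption_B V"
    and "cell_solution \<sigma> L p \<Phi>"
    and "f \<in> L2 (rho0 \<sigma> V)"
    and "\<And>\<epsilon>. \<epsilon> > 0 \<Longrightarrow> multiscale_solution \<sigma> \<eta> (rho_eps \<sigma> V p \<epsilon>) f (u \<epsilon>)"
    and "homogenized_solution (Sigma_matrix \<sigma> L p \<Phi>) \<eta> (rho0 \<sigma> V) f u0"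
  shows "L2_strong_conv (rho0 \<sigma> V) u u0 (at_right 0) \<and>
         H1_weak_conv (rho0 \<sigma> V) u u0 (at_right 0)"
proof -
  define w where "w = (\<lambda>x. exp (- (1 / \<sigma>) * V x))"
  define C0 where "C0 = (LINT x|lebesgue. w x)"
  have pV: "smooth p" "periodic L p" "smooth V" using assms(4) by (auto simp: assumption_A_def)
  have ws: "smooth w"
    unfolding w_def smooth_def by (intro allI Ck_exp Ck_mult Ck_const) (use pV(3) in \<open>simp add: smooth_def\<close>)
  interpret homogenization \<sigma> L p \<Phi> w \<eta>
  proof
    show "continuous_on UNIV w" using ws Ck_continuous unfolding smooth_def by blast
    show "w x > 0" for x by (simp add: w_def)
  qed (fact assms(1,2,3,6) pV(1,2) ws)+
  define Ce where "Ce \<epsilon> = (LINT x|lebesgue. m_eps \<epsilon> x * w x)" for \<epsilon>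
  have me: "exp (- (1 / \<sigma>) * (V x + p ((1 / \<epsilon>) *\<^sub>R x))) = m_eps \<epsilon> x * w x" for x \<epsilon>
    unfolding w_def by (simp add: exp_add[symmetric] distrib_left)
  have rho0: "rho0 \<sigma> V = (\<lambda>x. (1 / C0) * (1 * w x))"
    by (auto simp: rho0_def gibbs_def C0_def w_def)
  have rhoe: "rho_eps \<sigma> V p \<epsilon> = (\<lambda>x. (1 / Ce \<epsilon>) * (m_eps \<epsilon> x * w x))" for \<epsilon>
    unfolding rho_eps_def gibbs_def me Ce_def by auto
  have uH: "u \<epsilon> \<in> H1 (rho_eps \<sigma> V p \<epsilon>)" if "\<epsilon> > 0" for \<epsilon> using assms(8)[OF that] by (simp add: multiscale_solution_def)
  have u0H: "u0 \<in> H1 (rho0 \<sigma> V)" using assms(9) by (simp add: homogenized_solution_def)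
  have pos: "\<forall>\<^sub>F \<epsilon> in at_right 0. 0 < (\<epsilon>::real)" by (rule eventually_at_right_less)
  show ?thesis
  proof (cases "C0 = 0")
    case True
    \<comment> \<open>Integrals of non-integrable functions and quotients by \<open>0\<close> are \<open>0\<close>: here the density \<open>rho0\<close>
      vanishes identically, and with it all norms and inner products.\<close>
    have r: "rho0 \<sigma> V = (\<lambda>_. 0)" unfolding rho0 True by simp
    have z: "u \<epsilon> \<in> L2 (rho0 \<sigma> V)" "u \<epsilon> \<in> H1 (rho0 \<sigma> V)" if "\<epsilon> > 0" for \<epsilon>
      using uH[OF that] by (auto simp: r H1_def L2_def)
    show ?thesis
      unfolding L2_strong_conv_def H1_weak_conv_def
      using u0H eventually_mono[OF pos z(1)] eventually_mono[OF pos z(2)]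
      by (auto simp: r H1_def L2_norm_def H1_inner_def)
  next
    case False
    have iw: "integrable lebesgue w" using False not_integrable_integral_eq[of lebesgue w] unfolding C0_def by blast
    have "C0 \<ge> 0" unfolding C0_def using w_nonneg by simp
    then have C0: "C0 > 0" using False by simp
    obtain a0 A where mb: "a0 > 0" "\<And>y. a0 \<le> m y" "\<And>y. m y \<le> A" using m_bounds by metis
    have mc: "continuous_on UNIV (m_eps \<epsilon>)" for \<epsilon> by (rule continuous_on_scaled[OF m_cont])
    have Ce: "Ce \<epsilon> > 0" for \<epsilon>
    proof -
      have i: "integrable lebesgue (\<lambda>x. m_eps \<epsilon> x * w x)"
        by (rule integrable_bounded_mult[OF iw continuous_imp_measurable_lebesgue[OF mc], of _ A]) (use mb(3) in simp)
      have "a0 * C0 = (LINT x|lebesgue. a0 * w x)" by (simp add: C0_def)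
      also have "\<dots> \<le> Ce \<epsilon>"
        unfolding Ce_def using i iw mb(2) w_nonneg by (intro integral_mono) (auto intro: mult_right_mono)
      finally show ?thesis using mult_pos_pos[OF mb(1) C0] by linarith
    qed
    \<comment> \<open>The bounds for the oscillating factor \<open>m_eps \<epsilon>\<close> and for the constant factor \<open>1\<close>: with them
      both densities are multiples of \<open>w\<close> to which the same lemmas apply.\<close>
    note ae = mc mb(2,1,3)
    note a1 = continuous_on_const[of UNIV "1::real"] order_refl[of "1::real"] zero_less_one order_refl[of "1::real"]
    have ce: "1 / Ce \<epsilon> > 0" for \<epsilon> using Ce by simp
    have c0: "1 / C0 > 0" using C0 by simp
    have fs: "sqint w f"
    proof -
      have "f \<in> borel_measurable lebesgue" "integrable lebesgue (\<lambda>x. (norm (f x))\<^sup>2 * ((1 / C0) * (1 * w x)))"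
        using assms(7) unfolding rho0 L2_def by auto
      then show ?thesis using sqint_equivalent_weight[OF _ a1 c0, of f] by blast
    qed
    have up: "wpair w (u \<epsilon>) (wgrad (u \<epsilon>))" if "\<epsilon> > 0" for \<epsilon>
      using H1_imp_wpair[OF ae ce] uH[OF that] unfolding rhoe by blast
    have u0p: "wpair w u0 (wgrad u0)" using H1_imp_wpair[OF a1 c0] u0H unfolding rho0 by blast
    have H1p: "\<psi> \<in> H1 (rho0 \<sigma> V) \<Longrightarrow> wpair w \<psi> (wgrad \<psi>)" for \<psi> using H1_imp_wpair[OF a1 c0] unfolding rho0 by blast
    have uH0: "u \<epsilon> \<in> H1 (rho0 \<sigma> V)" if "\<epsilon> > 0" for \<epsilon>
      using wpair_imp_H1(1)[OF a1 c0 up[OF that]] unfolding rho0 .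
    have tp: "wpair w \<psi> (grad \<psi>)" if "test_function \<psi>" for \<psi>
      using wpair_C1 test_functionD(1,2)[OF that] by blast
    have wgrad_cong: "(LINT x|lebesgue. (G x \<bullet> wgrad \<psi> x) * (c * k x)) = c * (LINT x|lebesgue. (G x \<bullet> grad \<psi> x) * k x)"
      if \<psi>: "test_function \<psi>" and G: "G \<in> borel_measurable lebesgue" and k: "k \<in> borel_measurable lebesgue" for G :: "real^'n \<Rightarrow> real^'n" and \<psi> :: "real^'n \<Rightarrow> real" and c k
    proof -
      have hw: "has_weak_grad \<psi> (wgrad \<psi>)" using tp[OF \<psi>] has_weak_grad_wgrad by (auto simp: wpair_def)
      have [measurable]: "wgrad \<psi> \<in> borel_measurable lebesgue" "grad \<psi> \<in> borel_measurable lebesgue"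
        "G \<in> borel_measurable lebesgue" "k \<in> borel_measurable lebesgue"
        using hw tp[OF \<psi>] locally_integrable_measurable G k by (auto simp: has_weak_grad_def wpair_def)
      have "AE x in lebesgue. wgrad \<psi> x = grad \<psi> x"
        using weak_grad_unique[OF hw] tp[OF \<psi>] by (simp add: wpair_def)
      then have "AE x in lebesgue. (G x \<bullet> wgrad \<psi> x) * (c * k x) = c * ((G x \<bullet> grad \<psi> x) * k x)"
        by eventually_elim simp
      then have "(LINT x|lebesgue. (G x \<bullet> wgrad \<psi> x) * (c * k x)) = (LINT x|lebesgue. c * ((G x \<bullet> grad \<psi> x) * k x))"
        by (intro integral_cong_AE; measurable)
      then show ?thesis by simp
    qed
    have pull: "(LINT x|lebesgue. q x * (c * k x)) = c * (LINT x|lebesgue. q x * k x)" for q k :: "real^'n \<Rightarrow> real" and c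
      by (subst integral_mult_right_zero[symmetric]) (simp add: mult_ac)
    have gm: "wgrad (u \<epsilon>) \<in> borel_measurable lebesgue" if "\<epsilon> > 0" for \<epsilon> using up[OF that] by (simp add: wpair_def sqint_def)
    have ms: "energy_form \<sigma> \<eta> (m_eps \<epsilon>) (u \<epsilon>) (wgrad (u \<epsilon>)) \<psi> (grad \<psi>) = (LINT x|lebesgue. f x * \<psi> x * (m_eps \<epsilon> x * w x))"
      if e: "\<epsilon> > 0" and \<psi>: "test_function \<psi>" for \<epsilon> \<psi>
    proof -
      have mm: "(\<lambda>x. m_eps \<epsilon> x * w x) \<in> borel_measurable lebesgue"
        using continuous_imp_measurable_lebesgue[OF mc] w_meas by (intro borel_measurable_times)
      have "\<psi> \<in> H1 (rho_eps \<sigma> V p \<epsilon>)" using wpair_imp_H1(1)[OF ae ce tp[OF \<psi>]] unfolding rhoe .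
      then have "\<sigma> * (LINT x|lebesgue. (wgrad (u \<epsilon>) x \<bullet> wgrad \<psi> x) * rho_eps \<sigma> V p \<epsilon> x)
                 + \<eta> * (LINT x|lebesgue. u \<epsilon> x * \<psi> x * rho_eps \<sigma> V p \<epsilon> x)
               = (LINT x|lebesgue. f x * \<psi> x * rho_eps \<sigma> V p \<epsilon> x)"
        using assms(8)[OF e] by (simp add: multiscale_solution_def)
      then have "(1 / Ce \<epsilon>) * energy_form \<sigma> \<eta> (m_eps \<epsilon>) (u \<epsilon>) (wgrad (u \<epsilon>)) \<psi> (grad \<psi>) = (1 / Ce \<epsilon>) * (LINT x|lebesgue. f x * \<psi> x * (m_eps \<epsilon> x * w x))"
        unfolding rhoe wgrad_cong[OF \<psi> gm[OF e] mm] pull energy_form_def by (simp add: algebra_simps)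
      then show ?thesis using ce[of \<epsilon>] by (simp only: mult_cancel_left) simp
    qed
    have hs: "\<sigma> * (LINT x|lebesgue. ((K *v wgrad u0 x) \<bullet> grad \<psi> x) * w x)
       + \<eta> * (LINT x|lebesgue. u0 x * \<psi> x * w x) = (LINT x|lebesgue. f x * \<psi> x * w x)"
      if \<psi>: "test_function \<psi>" for \<psi>
    proof -
      have S: "Sigma_matrix \<sigma> L p \<Phi> *v x = \<sigma> *\<^sub>R (K *v x)" for x
        by (simp add: Sigma_matrix_def scaleR_matrix_vector_assoc)
      have Gm: "(\<lambda>x. K *v wgrad u0 x) \<in> borel_measurable lebesgue"
        using u0p unfolding wpair_def sqint_def
        by (intro borel_measurable_continuous_on[OF linear_continuous_on[of "(*v) K"]]) (auto simp: linear_conv_bounded_linear[symmetric])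
      have Sm: "(\<lambda>x. Sigma_matrix \<sigma> L p \<Phi> *v wgrad u0 x) \<in> borel_measurable lebesgue" unfolding S using Gm by measurable
      have mm: "(\<lambda>x. 1 * w x) \<in> borel_measurable lebesgue" using w_meas by simp
      have "\<psi> \<in> H1 (rho0 \<sigma> V)" using wpair_imp_H1(1)[OF a1 c0 tp[OF \<psi>]] unfolding rho0 .
      then have "(LINT x|lebesgue. ((Sigma_matrix \<sigma> L p \<Phi> *v wgrad u0 x) \<bullet> wgrad \<psi> x) * rho0 \<sigma> V x)
                 + \<eta> * (LINT x|lebesgue. u0 x * \<psi> x * rho0 \<sigma> V x)
               = (LINT x|lebesgue. f x * \<psi> x * rho0 \<sigma> V x)"
        using assms(9) by (simp add: homogenized_solution_def)
      then have "(1 / C0) * (LINT x|lebesgue. ((Sigma_matrix \<sigma> L p \<Phi> *v wgrad u0 x) \<bullet> grad \<psi> x) * (1 * w x))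
          + \<eta> * ((1 / C0) * (LINT x|lebesgue. u0 x * \<psi> x * (1 * w x))) = (1 / C0) * (LINT x|lebesgue. f x * \<psi> x * (1 * w x))"
        unfolding rho0 wgrad_cong[OF \<psi> Sm mm] pull .
      then have "(1 / C0) * (\<sigma> * (LINT x|lebesgue. ((K *v wgrad u0 x) \<bullet> grad \<psi> x) * w x)
          + \<eta> * (LINT x|lebesgue. u0 x * \<psi> x * w x)) = (1 / C0) * (LINT x|lebesgue. f x * \<psi> x * w x)"
        unfolding S by (simp add: algebra_simps)
      then show ?thesis using c0 by (simp only: mult_cancel_left) simp
    qed
    have lim: "((\<lambda>\<epsilon>. wnorm w (\<lambda>x. u \<epsilon> x - u0 x)) \<longlongrightarrow> 0) (at_right 0)"
      by (rule strong_convergence(1)[OF fs u0p hs up ms])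
    obtain B where B: "\<forall>\<epsilon>>0. wnorm w (wgrad (u \<epsilon>)) \<le> B"
      using strong_convergence(2)[OF fs u0p hs up ms] by blast
    have su0: "sqint w u0" using u0p by (simp add: wpair_def)
    have sue: "\<forall>\<^sub>F \<epsilon> in at_right 0. sqint w (u \<epsilon>)" using eventually_mono[OF pos] up by (auto simp: wpair_def)
    have "L2_norm (rho0 \<sigma> V) v = sqrt (1 / C0) * wnorm w v" for v
      unfolding L2_norm_def rho0 pull wnorm_def real_sqrt_mult[symmetric] by simp
    then have "((\<lambda>\<epsilon>. L2_norm (rho0 \<sigma> V) (\<lambda>x. u \<epsilon> x - u0 x)) \<longlongrightarrow> sqrt (1 / C0) * 0) (at_right 0)"
      by (simp only:) (intro tendsto_intros lim)
    moreover have "u0 \<in> L2 (rho0 \<sigma> V)" "\<forall>\<^sub>F \<epsilon> in at_right 0. u \<epsilon> \<in> L2 (rho0 \<sigma> V)"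
      using u0H eventually_mono[OF pos, of "\<lambda>\<epsilon>. u \<epsilon> \<in> L2 (rho0 \<sigma> V)"] uH0 by (auto simp: H1_def)
    ultimately have "L2_strong_conv (rho0 \<sigma> V) u u0 (at_right 0)" by (simp add: L2_strong_conv_def)
    have wk: "((\<lambda>\<epsilon>. H1_inner (rho0 \<sigma> V) (u \<epsilon>) \<psi>) \<longlongrightarrow> H1_inner (rho0 \<sigma> V) u0 \<psi>) (at_right 0)"
      if \<psi>: "\<psi> \<in> H1 (rho0 \<sigma> V)" for \<psi>
    proof -
      have sp: "sqint w \<psi>" using H1p[OF \<psi>] by (simp add: wpair_def)
      have t1: "((\<lambda>\<epsilon>. LINT x|lebesgue. u \<epsilon> x * \<psi> x * w x) \<longlongrightarrow> (LINT x|lebesgue. u0 x * \<psi> x * w x)) (at_right 0)"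
        using inner_tendsto[OF sue su0 sp lim] by simp
      note t2 = weak_gradient_convergence[OF u0p up lim B H1p[OF \<psi>]]
      have e: "H1_inner (rho0 \<sigma> V) v \<psi> = (1 / C0) * (LINT x|lebesgue. v x * \<psi> x * w x) + (1 / C0) * (LINT x|lebesgue. (wgrad v x \<bullet> wgrad \<psi> x) * w x)" for v
        unfolding H1_inner_def rho0 pull by simp
      show ?thesis unfolding e by (intro tendsto_intros t1 t2)
    qed
    have "H1_weak_conv (rho0 \<sigma> V) u u0 (at_right 0)"
      unfolding H1_weak_conv_def by (intro conjI ballI u0H eventually_mono[OF pos uH0] wk)
    with \<open>L2_strong_conv (rho0 \<sigma> V) u u0 (at_right 0)\<close> show ?thesis by blast
  qed
qed

end
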